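(* Let $R$ be a commutative Noetherian local ring and let $M$ be a finitely generated torsion-free $R$-module which has rank. If $M$ is Burch and rigid, then $M$ is free, and $R$ is a field or a discrete valuation ring.
   Context: $\mathfrak{m}$ denotes the maximal ideal of $R$; all modules are finitely generated. An $R$-module $M$ is torsion-free if every non zero-divisor of $R$ is a non zero-divisor on $M$ (equivalently $\bigcup \mathrm{Ass}_R(M)\subseteq \bigcup \mathrm{Ass}(R)$). $M$ has rank if there is an integer $r\ge 0$ such that $M_{\mathfrak{p}}\cong R_{\mathfrak{p}}^{\oplus r}$ for all $\mathfrak{p}\in \mathrm{Ass}(R)$. $M$ is rigid if $\mathrm{Ext}^1_R(M,M)=0$. $M$ is Burch if it is an $R$-submodule of some (finitely generated) $R$-module $T$ such that $\mathfrak{m}(M:_T\mathfrak{m})\nsubseteq \mathfrak{m}M$, where $(M:_T\mathfrak{m})=\{t\in T : \mathfrak{m}t\subseteq M\}$. *)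

theory Defs
  imports "HOL-Algebra.Module" "HOL-Algebra.Ring_Divisibility"
begin

text \<open>
  Records of type \<^typ>\<open>('a, 'b) module\<close> extend ring records, but the locale \<^locale>\<open>module\<close> ignores
  the fields \<open>mult\<close> and \<open>one\<close>; where no product is meant they are \<open>undefined\<close>.
\<close>

section \<open>Local rings and discrete valuation rings\<close>

locale local_ring = cring R for R (structure) +
  assumes unique_maximalideal: "\<exists>!I. maximalideal I R"

definition max_ideal :: "('a, 'k) ring_scheme \<Rightarrow> 'a set" where
  "max_ideal R = (THE I. maximalideal I R)"

locale discrete_valuation_ring = principal_domain R + local_ring R for R (structure) +
  assumes not_field: "\<not> field R"

section \<open>Homomorphisms, quotients, generation\<close>

definition mod_hom ::
    "('a, 'k) ring_scheme \<Rightarrow> ('a, 'b, 'm) module_scheme \<Rightarrow> ('a, 'c, 'n) module_scheme \<Rightarrow> ('b \<Rightarrow> 'c) set" where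
  "mod_hom R M N = {h \<in> hom (add_monoid M) (add_monoid N).
     \<forall>r\<in>carrier R. \<forall>x\<in>carrier M. h (r \<odot>\<^bsub>M\<^esub> x) = r \<odot>\<^bsub>N\<^esub> h x}"

definition mod_isomorphic ::
    "('a, 'k) ring_scheme \<Rightarrow> ('a, 'b, 'm) module_scheme \<Rightarrow> ('a, 'c, 'n) module_scheme \<Rightarrow> bool" where
  "mod_isomorphic R M N \<longleftrightarrow> (\<exists>h\<in>mod_hom R M N. bij_betw h (carrier M) (carrier N))"

text \<open>\<open>Hom\<^sub>R(M, N)\<close>; functions are extensional so that a homomorphism is determined by its values on \<open>M\<close>.\<close>

definition hom_module ::
    "('a, 'k) ring_scheme \<Rightarrow> ('a, 'b, 'm) module_scheme \<Rightarrow> ('a, 'c, 'n) module_scheme \<Rightarrow> ('a, 'b \<Rightarrow> 'c) module" where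
  "hom_module R M N =
     \<lparr>carrier = mod_hom R M N \<inter> extensional (carrier M), monoid.mult = undefined, one = undefined,
      zero = (\<lambda>x\<in>carrier M. \<zero>\<^bsub>N\<^esub>), add = (\<lambda>f g. \<lambda>x\<in>carrier M. f x \<oplus>\<^bsub>N\<^esub> g x),
      smult = (\<lambda>r f. \<lambda>x\<in>carrier M. r \<odot>\<^bsub>N\<^esub> f x)\<rparr>"

definition quotient_module :: "('a, 'b, 'm) module_scheme \<Rightarrow> 'b set \<Rightarrow> ('a, 'b set) module" where
  "quotient_module M N =
     \<lparr>carrier = a_rcosets\<^bsub>M\<^esub> N, monoid.mult = undefined, one = undefined, zero = N, add = set_add M,
      smult = (\<lambda>r X. \<Union>x\<in>X. N +>\<^bsub>M\<^esub> (r \<odot>\<^bsub>M\<^esub> x))\<rparr>"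

definition submodule_span ::
    "('a, 'k) ring_scheme \<Rightarrow> ('a, 'b, 'm) module_scheme \<Rightarrow> 'b set \<Rightarrow> 'b set" where
  "submodule_span R M X = \<Inter>{N. submodule N R M \<and> X \<subseteq> N}"

definition finitely_generated :: "('a, 'k) ring_scheme \<Rightarrow> ('a, 'b, 'm) module_scheme \<Rightarrow> bool" where
  "finitely_generated R M \<longleftrightarrow>
     (\<exists>X. X \<subseteq> carrier M \<and> finite X \<and> submodule_span R M X = carrier M)"

definition regular_module :: "('a, 'k) ring_scheme \<Rightarrow> ('a, 'a) module" where
  "regular_module R =
     \<lparr>carrier = carrier R, monoid.mult = monoid.mult R, one = one R,
      zero = zero R, add = add R, smult = monoid.mult R\<rparr>"

section \<open>Free modules\<close>

text \<open>\<open>R\<^sup>(\<^sup>S\<^sup>)\<close>, realised as the finitely supported functions that vanish outside \<open>S\<close>.\<close>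

definition free_module :: "('a, 'k) ring_scheme \<Rightarrow> 's set \<Rightarrow> ('a, 's \<Rightarrow> 'a) module" where
  "free_module R S =
     \<lparr>carrier = {f. range f \<subseteq> carrier R \<and> (\<forall>x. x \<notin> S \<longrightarrow> f x = \<zero>\<^bsub>R\<^esub>) \<and> finite {x. f x \<noteq> \<zero>\<^bsub>R\<^esub>}},
      monoid.mult = undefined, one = undefined,
      zero = (\<lambda>x. \<zero>\<^bsub>R\<^esub>), add = (\<lambda>f g x. f x \<oplus>\<^bsub>R\<^esub> g x), smult = (\<lambda>r f x. r \<otimes>\<^bsub>R\<^esub> f x)\<rparr>"

text \<open>For \<open>S \<subseteq> M\<close>, the linear map \<open>R\<^sup>(\<^sup>S\<^sup>) \<rightarrow> M\<close> that sends the basis vector at \<open>x\<close> to \<open>x\<close>.\<close>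

definition lincomb :: "('a, 'k) ring_scheme \<Rightarrow> ('a, 'b, 'm) module_scheme \<Rightarrow> ('b \<Rightarrow> 'a) \<Rightarrow> 'b" where
  "lincomb R M f = (\<Oplus>\<^bsub>M\<^esub>x\<in>{x. f x \<noteq> \<zero>\<^bsub>R\<^esub>}. f x \<odot>\<^bsub>M\<^esub> x)"

definition is_basis :: "('a, 'k) ring_scheme \<Rightarrow> ('a, 'b, 'm) module_scheme \<Rightarrow> 'b set \<Rightarrow> bool" where
  "is_basis R M B \<longleftrightarrow>
     B \<subseteq> carrier M \<and> bij_betw (lincomb R M) (carrier (free_module R B)) (carrier M)"

definition is_free :: "('a, 'k) ring_scheme \<Rightarrow> ('a, 'b, 'm) module_scheme \<Rightarrow> bool" where
  "is_free R M \<longleftrightarrow> (\<exists>B. is_basis R M B)"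

section \<open>Torsion-free modules and associated primes\<close>

definition non_zero_divisor_on ::
    "('a, 'k) ring_scheme \<Rightarrow> ('a, 'b, 'm) module_scheme \<Rightarrow> 'a \<Rightarrow> bool" where
  "non_zero_divisor_on R M r \<longleftrightarrow>
     r \<in> carrier R \<and> (\<forall>x\<in>carrier M. r \<odot>\<^bsub>M\<^esub> x = \<zero>\<^bsub>M\<^esub> \<longrightarrow> x = \<zero>\<^bsub>M\<^esub>)"

definition torsion_free :: "('a, 'k) ring_scheme \<Rightarrow> ('a, 'b, 'm) module_scheme \<Rightarrow> bool" where
  "torsion_free R M \<longleftrightarrow>
     (\<forall>r. non_zero_divisor_on R (regular_module R) r \<longrightarrow> non_zero_divisor_on R M r)"

definition associated_primes ::
    "('a, 'k) ring_scheme \<Rightarrow> ('a, 'b, 'm) module_scheme \<Rightarrow> 'a set set" where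
  "associated_primes R M =
     {P. primeideal P R \<and> (\<exists>x\<in>carrier M. P = {r \<in> carrier R. r \<odot>\<^bsub>M\<^esub> x = \<zero>\<^bsub>M\<^esub>})}"

section \<open>Localization at a prime, and rank\<close>

text \<open>The fraction \<open>m/s\<close>, as the class of all pairs \<open>(n, t)\<close> with \<open>u(t m) = u(s n)\<close> for some \<open>u \<notin> P\<close>.\<close>

definition fraction ::
    "('a, 'k) ring_scheme \<Rightarrow> 'a set \<Rightarrow> ('a, 'b, 'm) module_scheme \<Rightarrow> 'b \<Rightarrow> 'a \<Rightarrow> ('b \<times> 'a) set" where
  "fraction R P M m s =
     {(n, t). n \<in> carrier M \<and> t \<in> carrier R - P \<and>
        (\<exists>u\<in>carrier R - P. u \<odot>\<^bsub>M\<^esub> (t \<odot>\<^bsub>M\<^esub> m) = u \<odot>\<^bsub>M\<^esub> (s \<odot>\<^bsub>M\<^esub> n))}"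

text \<open>
  Operations on fractions are unions over all representatives; each such union is a single class.
  Scalars are the fractions of \<open>R\<close>, so this is \<open>M\<^sub>P\<close> as a module over \<open>R\<^sub>P\<close>.
\<close>

definition loc_module ::
    "('a, 'k) ring_scheme \<Rightarrow> 'a set \<Rightarrow> ('a, 'b, 'm) module_scheme \<Rightarrow> (('a \<times> 'a) set, ('b \<times> 'a) set) module" where
  "loc_module R P M =
     \<lparr>carrier = {fraction R P M m s | m s. m \<in> carrier M \<and> s \<in> carrier R - P},
      monoid.mult = undefined, one = undefined,
      zero = fraction R P M \<zero>\<^bsub>M\<^esub> \<one>\<^bsub>R\<^esub>,
      add = (\<lambda>X Y. \<Union>(m, s)\<in>X. \<Union>(n, t)\<in>Y.
               fraction R P M (t \<odot>\<^bsub>M\<^esub> m \<oplus>\<^bsub>M\<^esub> s \<odot>\<^bsub>M\<^esub> n) (s \<otimes>\<^bsub>R\<^esub> t)),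
      smult = (\<lambda>A X. \<Union>(a, s)\<in>A. \<Union>(m, t)\<in>X. fraction R P M (a \<odot>\<^bsub>M\<^esub> m) (s \<otimes>\<^bsub>R\<^esub> t))\<rparr>"

definition loc_ring :: "('a, 'k) ring_scheme \<Rightarrow> 'a set \<Rightarrow> ('a \<times> 'a) set ring" where
  "loc_ring R P =
     (let L = loc_module R P (regular_module R) in
      \<lparr>carrier = carrier L, monoid.mult = smult L, one = fraction R P (regular_module R) \<one>\<^bsub>R\<^esub> \<one>\<^bsub>R\<^esub>,
       zero = zero L, add = add L\<rparr>)"

definition has_rank :: "('a, 'k) ring_scheme \<Rightarrow> ('a, 'b, 'm) module_scheme \<Rightarrow> bool" where
  "has_rank R M \<longleftrightarrow>
     (\<exists>r::nat. \<forall>P\<in>associated_primes R (regular_module R).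
        mod_isomorphic (loc_ring R P) (loc_module R P M) (free_module (loc_ring R P) {..<r}))"

section \<open>Ext and rigidity\<close>

text \<open>
  \<open>Ext\<^sup>1\<close> is the first cohomology of \<open>Hom\<^sub>R(F\<^sub>\<bullet>, N)\<close>, where \<open>F\<^sub>2 \<rightarrow> F\<^sub>1 \<rightarrow> F\<^sub>0 \<rightarrow> M \<rightarrow> 0\<close> is the start
  of the canonical free resolution of \<open>M\<close>: \<open>F\<^sub>0\<close> is free on the set \<open>M\<close>, and each further
  \<open>F\<^sub>i\<close> is free on the kernel of the preceding map. (Choosing a resolution that depends only
  on \<open>M\<close> makes \<open>Ext\<^sup>1\<close> a function; other projective resolutions give an isomorphic module.)
\<close>

definition res0 :: "('a, 'k) ring_scheme \<Rightarrow> ('a, 'b, 'm) module_scheme \<Rightarrow> ('a, 'b \<Rightarrow> 'a) module" where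
  "res0 R M = free_module R (carrier M)"

definition res1 :: "('a, 'k) ring_scheme \<Rightarrow> ('a, 'b, 'm) module_scheme \<Rightarrow> ('a, ('b \<Rightarrow> 'a) \<Rightarrow> 'a) module" where
  "res1 R M = free_module R (a_kernel (res0 R M) M (lincomb R M))"

definition res2 ::
    "('a, 'k) ring_scheme \<Rightarrow> ('a, 'b, 'm) module_scheme \<Rightarrow> ('a, (('b \<Rightarrow> 'a) \<Rightarrow> 'a) \<Rightarrow> 'a) module" where
  "res2 R M = free_module R (a_kernel (res1 R M) (res0 R M) (lincomb R (res0 R M)))"

definition Ext1 ::
    "('a, 'k) ring_scheme \<Rightarrow> ('a, 'b, 'm) module_scheme \<Rightarrow> ('a, 'c, 'n) module_scheme \<Rightarrow>
      ('a, ((('b \<Rightarrow> 'a) \<Rightarrow> 'a) \<Rightarrow> 'c) set) module" where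
  "Ext1 R M N =
     (let d1 = lincomb R (res0 R M);
          d2 = lincomb R (res1 R M);
          H = hom_module R (res1 R M) N;
          cocycles = {\<phi> \<in> carrier H. \<forall>x\<in>carrier (res2 R M). \<phi> (d2 x) = \<zero>\<^bsub>N\<^esub>};
          coboundaries = {restrict (\<psi> \<circ> d1) (carrier (res1 R M)) | \<psi>.
                            \<psi> \<in> carrier (hom_module R (res0 R M) N)}
      in quotient_module (H\<lparr>carrier := cocycles\<rparr>) coboundaries)"

definition rigid :: "('a, 'k) ring_scheme \<Rightarrow> ('a, 'b, 'm) module_scheme \<Rightarrow> bool" where
  "rigid R M \<longleftrightarrow> carrier (Ext1 R M M) = {\<zero>\<^bsub>Ext1 R M M\<^esub>}"

section \<open>Burch modules\<close>

definition ideal_smult ::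
    "('a, 'k) ring_scheme \<Rightarrow> ('a, 'b, 'm) module_scheme \<Rightarrow> 'a set \<Rightarrow> 'b set \<Rightarrow> 'b set" where
  "ideal_smult R T I N = submodule_span R T {a \<odot>\<^bsub>T\<^esub> x | a x. a \<in> I \<and> x \<in> N}"

definition colon :: "('a, 'b, 'm) module_scheme \<Rightarrow> 'b set \<Rightarrow> 'a set \<Rightarrow> 'b set" where
  "colon T N I = {t \<in> carrier T. \<forall>a\<in>I. a \<odot>\<^bsub>T\<^esub> t \<in> N}"

text \<open>
  HOL cannot quantify existentially over types, so the type \<open>'c\<close> in which the overmodule \<open>T\<close>
  lives is a parameter; leaving it a type variable in a hypothesis allows arbitrary \<open>T\<close>.
  The inclusion of \<open>M\<close> in \<open>T\<close> is an injective homomorphism \<open>\<iota>\<close>, since the two types may differ.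
\<close>

definition burch :: "'c itself \<Rightarrow> ('a, 'k) ring_scheme \<Rightarrow> ('a, 'b, 'm) module_scheme \<Rightarrow> bool" where
  "burch TYPE('c) R M \<longleftrightarrow>
     (\<exists>(T :: ('a, 'c) module) \<iota>. module R T \<and> finitely_generated R T \<and>
        \<iota> \<in> mod_hom R M T \<and> inj_on \<iota> (carrier M) \<and>
        \<not> ideal_smult R T (max_ideal R) (colon T (\<iota> ` carrier M) (max_ideal R))
            \<subseteq> ideal_smult R T (max_ideal R) (\<iota> ` carrier M))"

end

theory Submission
  imports Defs
begin

text \<open>
  Let \<open>\<mm>\<close> be the maximal ideal. The Burch condition provides \<open>a \<in> \<mm>\<close> and \<open>t\<close> in the overmodule with \<open>\<mm> t \<subseteq> M\<close> and
  \<open>x = a t \<notin> \<mm> M\<close>. The overmodule enters only through the linear map \<open>\<tau>: \<mm> \<rightarrow> M\<close>, \<open>r \<mapsto> r t\<close>, which satisfies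
  \<open>\<tau>(a) = x\<close>, hence \<open>r x = a \<tau>(r)\<close>. Let \<open>B\<close> be a minimal finite generating set of \<open>M\<close>. All coefficients of relations
  between its elements lie in \<open>\<mm>\<close>, and \<open>M\<close> is free once they all vanish.

  Rigidity produces endomorphisms. The coefficient \<open>\<gamma>\<^sub>b(y)\<close> of \<open>b \<in> B\<close> in an element \<open>y\<close> is linear modulo \<open>\<mm>\<close>. Since
  \<open>Ext\<^sup>1(M, M) = 0\<close>, the map \<open>y \<mapsto> \<gamma>\<^sub>b(y) x\<close> can be corrected by a multiple of \<open>a\<close> to an endomorphism \<open>\<phi>\<^sub>b\<close> of \<open>M\<close>
  (\<open>lift_functional_mod_max_ideal\<close>). As \<open>x\<close> is a minimal generator, a unit multiple \<open>\<pi>\<close> of some \<open>\<phi>\<^sub>b\<close> fixes \<open>x\<close>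
  modulo \<open>a\<close>, and \<open>\<pi>\<close> has image in \<open>R x + a M\<close>. Over a complete ring one would split off a cyclic summand by
  lifting idempotents. Instead, the image of \<open>\<pi>\<^sup>s\<^sup>+\<^sup>1\<close> lies in \<open>R w + a\<^sup>s\<^sup>+\<^sup>1 M\<close> with \<open>w = \<pi>\<^sup>s x\<close>
  (\<open>funpow_image_cyclic_mod_power\<close>), and by Nakayama the maps \<open>\<pi>\<^sup>s\<^sup>+\<^sup>1 \<circ> \<phi>\<^sub>b\<close> show that every coefficient \<open>c\<^sub>b\<close> of
  a relation satisfies \<open>c\<^sub>b w \<in> a\<^sup>s\<^sup>+\<^sup>1 M\<close> (\<open>ex_near_x_killed_by_relations\<close>).

  The ring elements with this property for all \<open>s\<close> form an ideal. By an argument of Artin-Rees type it contains no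
  nonzerodivisor on \<open>M\<close>, so, \<open>M\<close> being torsion-free, it consists of zero divisors and lies in an associated prime
  of \<open>R\<close> by prime avoidance (\<open>relations_in_associated_prime\<close>). There \<open>B\<close> remains a minimal generating set, so \<open>B\<close> has
  at most as many elements as the rank. By a dimension count in residue fields, the relations then lie in every
  associated prime. Since \<open>M\<close> is free at the associated primes, they vanish there, and hence they
  vanish (\<open>relations_trivial\<close>). So \<open>B\<close> is a basis of \<open>M\<close>.

  Finally \<open>r x = a \<tau>(r)\<close>, read off at a unit coefficient of \<open>x\<close>, gives \<open>\<mm> = a R\<close>; and \<open>z a = 0\<close> implies
  \<open>z x = \<tau>(z a) = 0\<close>, hence \<open>z = 0\<close>. A Noetherian local ring whose maximal ideal is generated by a nonzerodivisor
  is a discrete valuation ring.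
\<close>

section \<open>Linear combinations and module homomorphisms\<close>

abbreviation (in module) scalar_mult (infixl \<open>\<cdot>\<close> 70) where
  "r \<cdot> y \<equiv> r \<odot>\<^bsub>M\<^esub> y"

context module
begin

lemma comb_closed [simp]:
  assumes "c \<in> B \<rightarrow> carrier R" "e \<in> B \<rightarrow> carrier M"
  shows "(\<Oplus>\<^bsub>M\<^esub>i\<in>B. c i \<cdot> e i) \<in> carrier M"
  by (rule M.finsum_closed) (use assms in auto)

lemma comb_insert:
  assumes "finite B" "b \<notin> B" "c \<in> insert b B \<rightarrow> carrier R" "e \<in> insert b B \<rightarrow> carrier M"
  shows "(\<Oplus>\<^bsub>M\<^esub>i\<in>insert b B. c i \<cdot> e i) = c b \<cdot> e b \<oplus>\<^bsub>M\<^esub> (\<Oplus>\<^bsub>M\<^esub>i\<in>B. c i \<cdot> e i)"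
  using assms by (intro M.finsum_insert) auto

lemma comb_remove:
  assumes "finite B" "b \<in> B" "c \<in> B \<rightarrow> carrier R" "e \<in> B \<rightarrow> carrier M"
  shows "(\<Oplus>\<^bsub>M\<^esub>i\<in>B. c i \<cdot> e i) = c b \<cdot> e b \<oplus>\<^bsub>M\<^esub> (\<Oplus>\<^bsub>M\<^esub>i\<in>B - {b}. c i \<cdot> e i)"
  using comb_insert[of "B - {b}" b c e] assms by (simp add: insert_absorb Pi_def)

lemma comb_cong:
  assumes "\<And>i. i \<in> B \<Longrightarrow> c i = d i" "d \<in> B \<rightarrow> carrier R" "e \<in> B \<rightarrow> carrier M"
  shows "(\<Oplus>\<^bsub>M\<^esub>i\<in>B. c i \<cdot> e i) = (\<Oplus>\<^bsub>M\<^esub>i\<in>B. d i \<cdot> e i)"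
  by (rule M.finsum_cong') (use assms in auto)

lemma comb_add:
  assumes "c \<in> B \<rightarrow> carrier R" "d \<in> B \<rightarrow> carrier R" "e \<in> B \<rightarrow> carrier M"
  shows "(\<Oplus>\<^bsub>M\<^esub>i\<in>B. (c i \<oplus> d i) \<cdot> e i)
    = (\<Oplus>\<^bsub>M\<^esub>i\<in>B. c i \<cdot> e i) \<oplus>\<^bsub>M\<^esub> (\<Oplus>\<^bsub>M\<^esub>i\<in>B. d i \<cdot> e i)"
proof -
  have "(\<Oplus>\<^bsub>M\<^esub>i\<in>B. (c i \<oplus> d i) \<cdot> e i) = (\<Oplus>\<^bsub>M\<^esub>i\<in>B. c i \<cdot> e i \<oplus>\<^bsub>M\<^esub> d i \<cdot> e i)"
    by (rule M.finsum_cong') (use assms in \<open>auto simp: Pi_iff smult_l_distr\<close>)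
  also have "\<dots> = (\<Oplus>\<^bsub>M\<^esub>i\<in>B. c i \<cdot> e i) \<oplus>\<^bsub>M\<^esub> (\<Oplus>\<^bsub>M\<^esub>i\<in>B. d i \<cdot> e i)"
    by (rule M.finsum_addf) (use assms in auto)
  finally show ?thesis .
qed

lemma comb_smult:
  assumes "finite B" "r \<in> carrier R" "c \<in> B \<rightarrow> carrier R" "e \<in> B \<rightarrow> carrier M"
  shows "(\<Oplus>\<^bsub>M\<^esub>i\<in>B. (r \<otimes> c i) \<cdot> e i) = r \<cdot> (\<Oplus>\<^bsub>M\<^esub>i\<in>B. c i \<cdot> e i)"
proof -
  have "(\<Oplus>\<^bsub>M\<^esub>i\<in>B. (r \<otimes> c i) \<cdot> e i) = (\<Oplus>\<^bsub>M\<^esub>i\<in>B. r \<cdot> (c i \<cdot> e i))"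
    by (rule M.finsum_cong') (use assms in \<open>auto simp: Pi_iff smult_assoc1\<close>)
  also have "\<dots> = r \<cdot> (\<Oplus>\<^bsub>M\<^esub>i\<in>B. c i \<cdot> e i)"
    by (rule finsum_smult_ldistr[symmetric]) (use assms in auto)
  finally show ?thesis .
qed

lemma comb_zero:
  assumes "\<And>i. i \<in> B \<Longrightarrow> c i = \<zero>" "e \<in> B \<rightarrow> carrier M"
  shows "(\<Oplus>\<^bsub>M\<^esub>i\<in>B. c i \<cdot> e i) = \<zero>\<^bsub>M\<^esub>"
  by (rule M.add.finprod_one_eqI) (use assms in \<open>auto simp: Pi_iff\<close>)

lemma comb_delta:
  assumes "finite B" "b \<in> B" "r \<in> carrier R" "e \<in> B \<rightarrow> carrier M"
  shows "(\<Oplus>\<^bsub>M\<^esub>i\<in>B. (if i = b then r else \<zero>) \<cdot> e i) = r \<cdot> e b"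
proof -
  have "(\<Oplus>\<^bsub>M\<^esub>i\<in>B - {b}. (if i = b then r else \<zero>) \<cdot> e i) = \<zero>\<^bsub>M\<^esub>"
    by (rule comb_zero) (use assms in auto)
  moreover have "e b \<in> carrier M" using assms by auto
  ultimately show ?thesis
    using comb_remove[of B b "\<lambda>i. if i = b then r else \<zero>" e] assms by simp
qed

lemma comb_minus:
  assumes "finite B" "c \<in> B \<rightarrow> carrier R" "e \<in> B \<rightarrow> carrier M"
  shows "(\<Oplus>\<^bsub>M\<^esub>i\<in>B. (\<ominus> c i) \<cdot> e i) = \<ominus>\<^bsub>M\<^esub> (\<Oplus>\<^bsub>M\<^esub>i\<in>B. c i \<cdot> e i)"
proof -
  have "(\<Oplus>\<^bsub>M\<^esub>i\<in>B. (\<ominus> c i) \<cdot> e i) = (\<Oplus>\<^bsub>M\<^esub>i\<in>B. ((\<ominus> \<one>) \<otimes> c i) \<cdot> e i)"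
    by (rule comb_cong) (use assms in \<open>auto simp: Pi_iff R.l_minus\<close>)
  also have "\<dots> = (\<ominus> \<one>) \<cdot> (\<Oplus>\<^bsub>M\<^esub>i\<in>B. c i \<cdot> e i)"
    by (rule comb_smult) (use assms in auto)
  finally show ?thesis using assms by (simp add: smult_l_minus)
qed

lemma comb_diff:
  assumes "finite B" "c \<in> B \<rightarrow> carrier R" "d \<in> B \<rightarrow> carrier R" "e \<in> B \<rightarrow> carrier M"
  shows "(\<Oplus>\<^bsub>M\<^esub>i\<in>B. (c i \<ominus> d i) \<cdot> e i)
    = (\<Oplus>\<^bsub>M\<^esub>i\<in>B. c i \<cdot> e i) \<ominus>\<^bsub>M\<^esub> (\<Oplus>\<^bsub>M\<^esub>i\<in>B. d i \<cdot> e i)"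
  unfolding R.minus_eq M.minus_eq comb_minus[OF assms(1,3,4), symmetric]
  by (rule comb_add) (use assms in auto)

lemma comb_comb:
  assumes "finite I" "finite B" "c \<in> I \<rightarrow> carrier R"
    and "\<And>i j. i \<in> I \<Longrightarrow> j \<in> B \<Longrightarrow> A i j \<in> carrier R" and "e \<in> B \<rightarrow> carrier M"
  shows "(\<Oplus>\<^bsub>M\<^esub>i\<in>I. c i \<cdot> (\<Oplus>\<^bsub>M\<^esub>j\<in>B. A i j \<cdot> e j))
    = (\<Oplus>\<^bsub>M\<^esub>j\<in>B. (\<Oplus>i\<in>I. c i \<otimes> A i j) \<cdot> e j)"
  using assms(1,3,4)
proof (induction I rule: finite_induct)
  case empty
  show ?case by (simp add: comb_zero assms)
next
  case (insert k I)
  let ?e = "\<lambda>i. \<Oplus>\<^bsub>M\<^esub>j\<in>B. A i j \<cdot> e j"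
  have ck: "c k \<in> carrier R" and cI: "c \<in> I \<rightarrow> carrier R" using insert.prems by auto
  have "(\<Oplus>\<^bsub>M\<^esub>i\<in>insert k I. c i \<cdot> ?e i)
      = c k \<cdot> ?e k \<oplus>\<^bsub>M\<^esub> (\<Oplus>\<^bsub>M\<^esub>i\<in>I. c i \<cdot> ?e i)"
    by (rule comb_insert) (use insert assms in auto)
  also have "(\<Oplus>\<^bsub>M\<^esub>i\<in>I. c i \<cdot> ?e i) = (\<Oplus>\<^bsub>M\<^esub>j\<in>B. (\<Oplus>i\<in>I. c i \<otimes> A i j) \<cdot> e j)"
    by (rule insert.IH) (use insert in auto)
  also have "c k \<cdot> ?e k = (\<Oplus>\<^bsub>M\<^esub>j\<in>B. (c k \<otimes> A k j) \<cdot> e j)"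
    by (rule comb_smult[symmetric]) (use insert assms in auto)
  also have "(\<Oplus>\<^bsub>M\<^esub>j\<in>B. (c k \<otimes> A k j) \<cdot> e j) \<oplus>\<^bsub>M\<^esub> (\<Oplus>\<^bsub>M\<^esub>j\<in>B. (\<Oplus>i\<in>I. c i \<otimes> A i j) \<cdot> e j)
      = (\<Oplus>\<^bsub>M\<^esub>j\<in>B. (c k \<otimes> A k j \<oplus> (\<Oplus>i\<in>I. c i \<otimes> A i j)) \<cdot> e j)"
    by (rule comb_add[symmetric]) (use insert.prems assms in \<open>auto simp: Pi_iff intro!: R.finsum_closed\<close>)
  also have "\<dots> = (\<Oplus>\<^bsub>M\<^esub>j\<in>B. (\<Oplus>i\<in>insert k I. c i \<otimes> A i j) \<cdot> e j)"
  proof (rule comb_cong)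
    fix j assume "j \<in> B"
    show "c k \<otimes> A k j \<oplus> (\<Oplus>i\<in>I. c i \<otimes> A i j) = (\<Oplus>i\<in>insert k I. c i \<otimes> A i j)"
      by (rule R.finsum_insert[symmetric]) (use insert \<open>j \<in> B\<close> in auto)
  qed (use insert.prems assms in \<open>auto simp: Pi_iff intro!: R.finsum_closed\<close>)
  finally show ?case .
qed

lemma submodule_comb:
  assumes "submodule N R M" "finite B" "c \<in> B \<rightarrow> carrier R" "e \<in> B \<rightarrow> N"
  shows "(\<Oplus>\<^bsub>M\<^esub>i\<in>B. c i \<cdot> e i) \<in> N"
  using assms(2-4)
proof (induction B rule: finite_induct)
  case empty
  from submoduleE(2)[OF assms(1)] obtain y where y: "y \<in> N" by auto
  with submoduleE(1)[OF assms(1)] have "y \<in> carrier M" by auto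
  with submoduleE(4)[OF assms(1) R.zero_closed y] show ?case by simp
next
  case (insert b B)
  have "e \<in> insert b B \<rightarrow> carrier M" using insert.prems submoduleE(1)[OF assms(1)] by auto
  then show ?case
    using insert submoduleE(4,5)[OF assms(1)] by (subst comb_insert) (auto simp: Pi_iff)
qed

lemma submodule_zero: "submodule N R M \<Longrightarrow> \<zero>\<^bsub>M\<^esub> \<in> N"
  using submodule_comb[of N "{}" "\<lambda>_. \<zero>" "\<lambda>_. \<zero>\<^bsub>M\<^esub>"] by simp

lemma submodule_diff:
  assumes "submodule N R M" "x \<in> N" "y \<in> N"
  shows "x \<ominus>\<^bsub>M\<^esub> y \<in> N"
  unfolding M.minus_eq using submoduleE(3,5)[OF assms(1)] assms by auto

lemma submodule_if_closed:
  assumes "H \<subseteq> carrier M" "\<zero>\<^bsub>M\<^esub> \<in> H" "\<And>a b. \<lbrakk>a \<in> H ; b \<in> H\<rbrakk> \<Longrightarrow> a \<oplus>\<^bsub>M\<^esub> b \<in> H"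
    "\<And>a x. \<lbrakk>a \<in> carrier R; x \<in> H\<rbrakk> \<Longrightarrow> a \<cdot> x \<in> H"
  shows "submodule H R M"
proof (rule submoduleI)
  fix a assume a: "a \<in> H"
  then have "\<ominus>\<^bsub>M\<^esub> a = (\<ominus> \<one>) \<cdot> a" using assms(1) by (subst smult_l_minus) auto
  then show "\<ominus>\<^bsub>M\<^esub> a \<in> H" using assms(4)[OF _ a, of "\<ominus> \<one>"] by simp
qed (use assms in auto)

lemma combs_submodule:
  assumes "finite B" "e \<in> B \<rightarrow> carrier M"
  shows "submodule {\<Oplus>\<^bsub>M\<^esub>i\<in>B. c i \<cdot> e i | c. c \<in> B \<rightarrow> carrier R} R M" (is "submodule ?S R M")
proof (rule submodule_if_closed)
  show "?S \<subseteq> carrier M" using comb_closed[OF _ assms(2)] by auto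
  show "\<zero>\<^bsub>M\<^esub> \<in> ?S"
    using comb_zero[of B "\<lambda>_. \<zero>" e] assms(2) by (auto intro!: exI[of _ "\<lambda>_. \<zero>"])
next
  fix x y assume "x \<in> ?S" "y \<in> ?S"
  then obtain c d where "c \<in> B \<rightarrow> carrier R" "x = (\<Oplus>\<^bsub>M\<^esub>i\<in>B. c i \<cdot> e i)"
    "d \<in> B \<rightarrow> carrier R" "y = (\<Oplus>\<^bsub>M\<^esub>i\<in>B. d i \<cdot> e i)" by auto
  then show "x \<oplus>\<^bsub>M\<^esub> y \<in> ?S"
    using comb_add[of c B d e] assms(2) by (auto intro!: exI[of _ "\<lambda>i. c i \<oplus> d i"])
next
  fix r x assume "r \<in> carrier R" "x \<in> ?S"
  then obtain c where "c \<in> B \<rightarrow> carrier R" "x = (\<Oplus>\<^bsub>M\<^esub>i\<in>B. c i \<cdot> e i)" by auto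
  then show "r \<cdot> x \<in> ?S"
    using comb_smult[of B r c e] assms \<open>r \<in> carrier R\<close> by (auto intro!: exI[of _ "\<lambda>i. r \<otimes> c i"])
qed

end

lemma mod_homD:
  assumes "h \<in> mod_hom R M N"
  shows "x \<in> carrier M \<Longrightarrow> h x \<in> carrier N"
    and "x \<in> carrier M \<Longrightarrow> y \<in> carrier M \<Longrightarrow> h (x \<oplus>\<^bsub>M\<^esub> y) = h x \<oplus>\<^bsub>N\<^esub> h y"
    and "r \<in> carrier R \<Longrightarrow> x \<in> carrier M \<Longrightarrow> h (r \<odot>\<^bsub>M\<^esub> x) = r \<odot>\<^bsub>N\<^esub> h x"
  using assms by (auto simp: mod_hom_def hom_def Pi_iff)

lemma mod_homI:
  assumes "\<And>x. x \<in> carrier M \<Longrightarrow> h x \<in> carrier N"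
    and "\<And>x y. x \<in> carrier M \<Longrightarrow> y \<in> carrier M \<Longrightarrow> h (x \<oplus>\<^bsub>M\<^esub> y) = h x \<oplus>\<^bsub>N\<^esub> h y"
    and "\<And>r x. r \<in> carrier R \<Longrightarrow> x \<in> carrier M \<Longrightarrow> h (r \<odot>\<^bsub>M\<^esub> x) = r \<odot>\<^bsub>N\<^esub> h x"
  shows "h \<in> mod_hom R M N"
  using assms by (auto simp: mod_hom_def hom_def)

lemma mod_hom_zero:
  assumes "module R M" "module R N" "h \<in> mod_hom R M N"
  shows "h \<zero>\<^bsub>M\<^esub> = \<zero>\<^bsub>N\<^esub>"
proof -
  interpret M: module R M by fact
  interpret N: module R N by fact
  show ?thesis
    using mod_homD(3)[OF assms(3) M.R.zero_closed M.M.zero_closed] mod_homD(1)[OF assms(3)] by simp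
qed

lemma mod_hom_minus:
  assumes "module R M" "module R N" "h \<in> mod_hom R M N" "x \<in> carrier M" "y \<in> carrier M"
  shows "h (x \<ominus>\<^bsub>M\<^esub> y) = h x \<ominus>\<^bsub>N\<^esub> h y"
proof -
  interpret M: module R M by fact
  interpret N: module R N by fact
  have "h (\<ominus>\<^bsub>M\<^esub> y) = h ((\<ominus>\<^bsub>R\<^esub> \<one>\<^bsub>R\<^esub>) \<odot>\<^bsub>M\<^esub> y)" using assms(5) by (simp add: M.smult_l_minus)
  also have "\<dots> = \<ominus>\<^bsub>N\<^esub> h y"
    using assms(5) mod_homD[OF assms(3)] by (simp add: N.smult_l_minus)
  finally show ?thesis using assms mod_homD[OF assms(3)] by (simp add: M.M.minus_eq N.M.minus_eq)
qed

lemma mod_hom_comb: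
  assumes "module R M" "module R N" "h \<in> mod_hom R M N"
    and "finite B" "c \<in> B \<rightarrow> carrier R" "e \<in> B \<rightarrow> carrier M"
  shows "h (\<Oplus>\<^bsub>M\<^esub>i\<in>B. c i \<odot>\<^bsub>M\<^esub> e i) = (\<Oplus>\<^bsub>N\<^esub>i\<in>B. c i \<odot>\<^bsub>N\<^esub> h (e i))"
proof -
  interpret M: module R M by fact
  interpret N: module R N by fact
  show ?thesis using assms(4-6)
  proof (induction B rule: finite_induct)
    case empty
    show ?case by (simp add: mod_hom_zero[OF assms(1-3)])
  next
    case (insert b B)
    then have "(\<lambda>i. h (e i)) \<in> insert b B \<rightarrow> carrier N" using mod_homD(1)[OF assms(3)] by auto
    then show ?case
      using insert mod_homD[OF assms(3)] by (simp add: M.comb_insert N.comb_insert Pi_iff)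
  qed
qed

section \<open>Noetherian rings, annihilators and prime avoidance\<close>

locale noetherian_cring = noetherian_ring R + cring R for R (structure)

locale noetherian_local_ring = noetherian_cring R + local_ring R for R (structure)

lemma (in noetherian_ring) ex_maximal_ideal_in_family:
  assumes "X \<noteq> {}" "\<And>x. x \<in> X \<Longrightarrow> ideal (I x) R"
  obtains x where "x \<in> X" "\<And>y. y \<in> X \<Longrightarrow> I x \<subseteq> I y \<Longrightarrow> I y = I x"
proof -
  have "\<exists>K\<in>I ` X. \<forall>J\<in>I ` X. K \<subseteq> J \<longrightarrow> J = K"
  proof (rule subset_Zorn_nonempty)
    fix C assume C: "C \<noteq> {}" "subset.chain (I ` X) C"
    then have "subset.chain {I. ideal I R} C" using assms(2) by (auto simp: pred_on.chain_def)
    from ideal_chain_is_trivial[OF C(1) this] have "\<Union>C \<in> C" .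
    with C(2) show "\<Union>C \<in> I ` X" by (auto simp: pred_on.chain_def)
  qed (use assms(1) in auto)
  with that show ?thesis by auto
qed

lemma (in noetherian_ring) ascending_ideals_stabilize:
  assumes "\<And>k. ideal (I k) R" "\<And>k. I k \<subseteq> I (Suc k)"
  obtains k where "\<And>l. l \<ge> k \<Longrightarrow> I l = I (k :: nat)"
proof -
  obtain k where k: "\<And>l. I k \<subseteq> I l \<Longrightarrow> I l = I k"
    using ex_maximal_ideal_in_family[of UNIV I] assms(1) by auto
  have "I k \<subseteq> I l" if "l \<ge> k" for l using lift_Suc_mono_le[of I, OF assms(2) that] .
  with k that show ?thesis by blast
qed

lemma (in cring) ideal_if_closed:
  assumes "I \<subseteq> carrier R" "\<zero> \<in> I" "\<And>a b. a \<in> I \<Longrightarrow> b \<in> I \<Longrightarrow> a \<oplus> b \<in> I"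
    and "\<And>x a. x \<in> carrier R \<Longrightarrow> a \<in> I \<Longrightarrow> x \<otimes> a \<in> I"
  shows "ideal I R"
proof (rule idealI)
  show "ring R" by unfold_locales
  show "subgroup I (add_monoid R)"
  proof (rule subgroup.intro)
    fix x assume x: "x \<in> I"
    then have "(\<ominus> \<one>) \<otimes> x = \<ominus> x" using assms(1) by (subst l_minus) auto
    then show "inv\<^bsub>add_monoid R\<^esub> x \<in> I" using assms(4)[of "\<ominus> \<one>" x] x by (simp add: a_inv_def)
  qed (use assms in auto)
  fix a x assume "a \<in> I" "x \<in> carrier R"
  then show "x \<otimes> a \<in> I" "a \<otimes> x \<in> I" using assms m_comm[of a x] by auto
qed

lemma (in cring) one_notin_primeideal: "primeideal P R \<Longrightarrow> \<one> \<in> carrier R - P"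
  using ideal.one_imp_carrier[of P R] primeideal.I_notcarr[of P R] primeideal.axioms(1)[of P R] by auto

lemma (in cring) primeideal_complement_mult:
  "primeideal P R \<Longrightarrow> u \<in> carrier R - P \<Longrightarrow> v \<in> carrier R - P \<Longrightarrow> u \<otimes> v \<in> carrier R - P"
  using primeideal.I_prime[of P R u v] by auto

text \<open>The product of the individual multipliers works, since it stays outside the prime ideal. This one lemma serves
  for common denominators and for the fact that a prime ideal that contains a finite intersection of ideals
  contains one of them.\<close>

lemma (in cring) common_multiplier:
  assumes P: "primeideal P R" and "finite S"
    and "\<And>j. j \<in> S \<Longrightarrow> \<exists>u\<in>carrier R - P. Q j u"
    and "\<And>j u v. j \<in> S \<Longrightarrow> u \<in> carrier R - P \<Longrightarrow> v \<in> carrier R - P \<Longrightarrow> Q j u \<Longrightarrow> Q j (v \<otimes> u)"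
  shows "\<exists>u\<in>carrier R - P. \<forall>j\<in>S. Q j u"
  using assms(2-4)
proof (induction S rule: finite_induct)
  case empty
  show ?case using one_notin_primeideal[OF P] by auto
next
  case (insert k S)
  obtain u where u: "u \<in> carrier R - P" "\<forall>j\<in>S. Q j u" using insert.IH insert.prems by auto
  obtain v where v: "v \<in> carrier R - P" "Q k v" using insert.prems(1)[of k] by auto
  have "v \<otimes> u \<in> carrier R - P" by (rule primeideal_complement_mult[OF P v(1) u(1)])
  moreover have "Q k (v \<otimes> u)" using insert.prems(2)[of k v u] u(1) v m_comm[of u v] by auto
  moreover have "Q j (v \<otimes> u)" if "j \<in> S" for j using insert.prems(2)[of j u v] u v(1) that by auto
  ultimately show ?case by auto
qed

text \<open>For a family, because the annihilator of a relation, viewed as a vector of coefficients, is needed.\<close>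

definition annihilator :: "('a, 'k) ring_scheme \<Rightarrow> 'i set \<Rightarrow> ('i \<Rightarrow> 'a) \<Rightarrow> 'a set" where
  "annihilator R B c = {r \<in> carrier R. \<forall>b\<in>B. r \<otimes>\<^bsub>R\<^esub> c b = \<zero>\<^bsub>R\<^esub>}"

lemma (in cring) annihilator_ideal:
  assumes "c \<in> B \<rightarrow> carrier R"
  shows "ideal (annihilator R B c) R"
  by (rule ideal_if_closed) (use assms in \<open>auto simp: annihilator_def l_distr m_assoc Pi_iff\<close>)

text \<open>If \<open>r s\<close> kills \<open>c\<close> and \<open>s c \<noteq> 0\<close>, then \<open>r\<close> kills \<open>s c\<close>, which by maximality has no larger annihilator.\<close>

lemma (in cring) primeideal_annihilator_if_maximal:
  assumes c: "c \<in> B \<rightarrow> carrier R" and nz: "\<exists>b\<in>B. c b \<noteq> \<zero>"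
    and max: "\<And>s. s \<in> carrier R \<Longrightarrow> \<exists>b\<in>B. s \<otimes> c b \<noteq> \<zero> \<Longrightarrow>
      annihilator R B (\<lambda>b. s \<otimes> c b) \<subseteq> annihilator R B c"
  shows "primeideal (annihilator R B c) R"
proof (rule primeidealI[OF annihilator_ideal[OF c] is_cring])
  have "\<one> \<notin> annihilator R B c" using nz c by (force simp: annihilator_def Pi_iff)
  then show "carrier R \<noteq> annihilator R B c" by auto
next
  fix r s assume rs: "r \<in> carrier R" "s \<in> carrier R" "r \<otimes> s \<in> annihilator R B c"
  show "r \<in> annihilator R B c \<or> s \<in> annihilator R B c"
  proof (cases "\<exists>b\<in>B. s \<otimes> c b \<noteq> \<zero>")
    case True
    have "r \<in> annihilator R B (\<lambda>b. s \<otimes> c b)"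
      using rs c by (auto simp: annihilator_def m_assoc Pi_iff)
    with max[OF rs(2) True] show ?thesis by auto
  qed (use rs in \<open>auto simp: annihilator_def\<close>)
qed

text \<open>A maximal element among the annihilators of the nonzero multiples is prime. It is the intersection of the annihilators
  of finitely many entries, hence equal to one of these, and so it is an associated prime of the ring itself.\<close>

lemma (in noetherian_cring) ex_multiple_with_prime_annihilator:
  assumes B: "finite B" and c: "c \<in> B \<rightarrow> carrier R" and nz: "\<exists>b\<in>B. c b \<noteq> \<zero>"
  obtains z b where "z \<in> carrier R" "b \<in> B"
    and "annihilator R B (\<lambda>b. z \<otimes> c b) \<in> associated_primes R (regular_module R)"
    and "annihilator R B (\<lambda>b. z \<otimes> c b) = annihilator R {b} (\<lambda>b. z \<otimes> c b)"
proof -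
  let ?nz = "\<lambda>z. \<exists>b\<in>B. z \<otimes> c b \<noteq> \<zero>"
  let ?A = "\<lambda>z. annihilator R B (\<lambda>b. z \<otimes> c b)"
  have mult: "(\<lambda>b. z \<otimes> c b) \<in> B \<rightarrow> carrier R" if "z \<in> carrier R" for z using c that by auto
  define Z where "Z = {z \<in> carrier R. ?nz z}"
  have "\<one> \<otimes> c b = c b" if "b \<in> B" for b using c that by (auto simp: Pi_iff)
  then have "\<one> \<in> Z" using nz by (auto simp: Z_def)
  then have "Z \<noteq> {}" by blast
  moreover have "ideal (?A z) R" if "z \<in> Z" for z using that by (intro annihilator_ideal mult) (auto simp: Z_def)
  ultimately have "\<exists>z\<in>Z. \<forall>w\<in>Z. ?A z \<subseteq> ?A w \<longrightarrow> ?A w = ?A z"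
    by (rule ex_maximal_ideal_in_family[of Z ?A]) blast+
  then obtain z where z: "z \<in> Z" and max: "\<forall>w\<in>Z. ?A z \<subseteq> ?A w \<longrightarrow> ?A w = ?A z" ..
  then have z: "z \<in> carrier R" "?nz z" by (auto simp: Z_def)
  have prime: "primeideal (?A z) R"
  proof (rule primeideal_annihilator_if_maximal[OF mult[OF z(1)] z(2)])
    fix s assume s: "s \<in> carrier R" "\<exists>b\<in>B. s \<otimes> (z \<otimes> c b) \<noteq> \<zero>"
    have eq: "s \<otimes> (z \<otimes> c b) = (s \<otimes> z) \<otimes> c b" if "b \<in> B" for b
      using s(1) z(1) c that by (auto simp: m_assoc Pi_iff)
    then have A: "annihilator R B (\<lambda>b. s \<otimes> (z \<otimes> c b)) = ?A (s \<otimes> z)"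
      unfolding annihilator_def by (intro Collect_cong conj_cong refl ball_cong) simp
    have "r \<otimes> (s \<otimes> z \<otimes> c b) = s \<otimes> (r \<otimes> (z \<otimes> c b))" if "b \<in> B" "r \<in> carrier R" for b r
      using s(1) z(1) c that by (simp add: Pi_iff m_ac)
    then have "?A z \<subseteq> ?A (s \<otimes> z)" using s(1) by (auto simp: annihilator_def)
    moreover have "s \<otimes> z \<in> Z" using s z(1) eq by (auto simp: Z_def)
    ultimately have "?A (s \<otimes> z) = ?A z" using max by blast
    with A show "annihilator R B (\<lambda>b. s \<otimes> (z \<otimes> c b)) \<subseteq> ?A z" by simp
  qed
  have "\<exists>b\<in>B. annihilator R {b} (\<lambda>b. z \<otimes> c b) \<subseteq> ?A z"
  proof (rule ccontr)
    assume "\<not> ?thesis"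
    then have *: "\<exists>u\<in>carrier R - ?A z. u \<otimes> (z \<otimes> c b) = \<zero>" if "b \<in> B" for b
      using that by (fastforce simp: annihilator_def)
    have "\<exists>u\<in>carrier R - ?A z. \<forall>b\<in>B. u \<otimes> (z \<otimes> c b) = \<zero>"
    proof (rule common_multiplier[OF prime B])
      fix b u v assume "b \<in> B" "u \<in> carrier R - ?A z" "v \<in> carrier R - ?A z" "u \<otimes> (z \<otimes> c b) = \<zero>"
      then show "(v \<otimes> u) \<otimes> (z \<otimes> c b) = \<zero>" using z(1) c by (subst m_assoc) auto
    qed (use * in auto)
    then show False by (auto simp: annihilator_def)
  qed
  then obtain b where b: "b \<in> B" "?A z = annihilator R {b} (\<lambda>b. z \<otimes> c b)"
    by (auto simp: annihilator_def)
  have "z \<otimes> c b \<in> carrier R" using b z(1) c by auto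
  then have "?A z \<in> associated_primes R (regular_module R)"
    using prime b by (auto simp: associated_primes_def regular_module_def annihilator_def)
  with b z(1) show ?thesis using that by blast
qed

text \<open>If \<open>a\<close> avoids the previous primes but lies in the new prime \<open>P\<close>, then \<open>a + b\<close> avoids all of them for any \<open>b\<close>
  outside \<open>P\<close> that lies in \<open>J\<close> and in all previous primes. Such \<open>b\<close> exists since none of these ideals is contained in
  \<open>P\<close>; for the primes this is where incomparability is used.\<close>

lemma (in cring) prime_avoidance:
  assumes "finite \<P>" and "\<And>P. P \<in> \<P> \<Longrightarrow> primeideal P R"
    and "\<And>P P'. P \<in> \<P> \<Longrightarrow> P' \<in> \<P> \<Longrightarrow> P \<subseteq> P' \<Longrightarrow> P = P'"
    and J: "ideal J R" and "\<And>P. P \<in> \<P> \<Longrightarrow> \<not> J \<subseteq> P"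
  shows "\<exists>a\<in>J. \<forall>P\<in>\<P>. a \<notin> P"
  using assms(1-3,5)
proof (induction \<P> rule: finite_induct)
  case empty
  then show ?case using additive_subgroup.zero_closed[OF ideal.axioms(1)[OF J]] by auto
next
  case (insert P \<P>)
  have P: "primeideal P R" using insert by auto
  have ideals: "ideal I R" if "I \<in> insert P (insert J \<P>)" for I
    using that J insert.prems(1) primeideal.axioms(1) by auto
  obtain a where a: "a \<in> J" "\<forall>P\<in>\<P>. a \<notin> P" using insert by (metis insertCI)
  show ?case
  proof (cases "a \<in> P")
    case True
    have "\<exists>b\<in>carrier R - P. \<forall>I\<in>insert J \<P>. b \<in> I"
    proof (rule common_multiplier[OF P])
      fix I assume I: "I \<in> insert J \<P>"
      then have "\<not> I \<subseteq> P" using insert.prems(2)[of I P] insert.prems(3)[of P] insert.hyps by auto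
      then show "\<exists>u\<in>carrier R - P. u \<in> I" using ideals[of I] I ideal.Icarr[of I R] by auto
    next
      fix I u v assume "I \<in> insert J \<P>" "u \<in> carrier R - P" "v \<in> carrier R - P" "u \<in> I"
      then show "v \<otimes> u \<in> I" using ideals[of I] ideal.I_l_closed[of I R] by auto
    qed (use insert.hyps in auto)
    then obtain b where b: "b \<in> carrier R" "b \<notin> P" "b \<in> J" "\<forall>I\<in>\<P>. b \<in> I" by auto
    have aR: "a \<in> carrier R" using a ideal.Icarr[OF J] by auto
    have sum: "x \<in> I" if "ideal I R" "y \<in> I" "x \<oplus> y \<in> I" "x \<in> carrier R" for I x y
    proof -
      have y: "y \<in> carrier R" using that ideal.Icarr by metis
      have "x = (x \<oplus> y) \<oplus> \<ominus> y" using that(4) y by (simp add: a_assoc r_neg)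
      also have "\<dots> \<in> I"
        using additive_subgroup.a_closed[OF ideal.axioms(1)[OF that(1)] that(3)
            additive_subgroup.a_inv_closed[OF ideal.axioms(1)[OF that(1)] that(2)]] .
      finally show ?thesis .
    qed
    have "a \<oplus> b \<in> J" using a(1) b(3) additive_subgroup.a_closed ideal.axioms(1)[OF J] by metis
    moreover have "a \<oplus> b \<notin> P" using sum[of P a b] ideals[of P] b True aR a_comm[of a b] by auto
    moreover have "a \<oplus> b \<notin> I" if "I \<in> \<P>" for I
      using sum[of I b a] ideals[of I] that a b aR by auto
    ultimately show ?thesis by auto
  qed (use a in auto)
qed

text \<open>Every annihilator of a nonzero element lies in a maximal one, and the maximal ones are associated primes. There are
  only finitely many of them: if the elements \<open>Y\<close> with maximal annihilators generate the same ideal as a finite subset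
  \<open>F\<close>, then each maximal annihilator contains the intersection of the annihilators of the elements of \<open>F\<close>,
  hence equals one of them. Now prime avoidance applies.\<close>

lemma (in noetherian_cring) zero_divisor_ideal_le_associated_prime:
  assumes J: "ideal J R" and zd: "\<And>d. d \<in> J \<Longrightarrow> \<exists>z\<in>carrier R - {\<zero>}. d \<otimes> z = \<zero>"
  shows "\<exists>P\<in>associated_primes R (regular_module R). J \<subseteq> P"
proof -
  let ?A = "\<lambda>y. annihilator R {y} (\<lambda>y. y)"
  define Y where "Y = {y \<in> carrier R - {\<zero>}. \<forall>w\<in>carrier R - {\<zero>}. ?A y \<subseteq> ?A w \<longrightarrow> ?A w = ?A y}"
  have ideal: "ideal (?A y) R" if "y \<in> carrier R" for y by (rule annihilator_ideal) (use that in auto)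
  have prime: "primeideal (?A y) R" if "y \<in> Y" for y
  proof (rule primeideal_annihilator_if_maximal)
    fix s assume s: "s \<in> carrier R" "\<exists>b\<in>{y}. s \<otimes> b \<noteq> \<zero>"
    have y: "y \<in> carrier R" using that by (auto simp: Y_def)
    have "r \<otimes> (s \<otimes> y) = s \<otimes> (r \<otimes> y)" if "r \<in> carrier R" for r
      using s(1) y that by (simp add: m_ac)
    then have "?A y \<subseteq> ?A (s \<otimes> y)" using s(1) by (auto simp: annihilator_def)
    with that s y have "?A (s \<otimes> y) = ?A y" by (auto simp: Y_def)
    then show "annihilator R {y} (\<lambda>b. s \<otimes> b) \<subseteq> ?A y" by (auto simp: annihilator_def)
  qed (use that in \<open>auto simp: Y_def\<close>)
  have above: "\<exists>y\<in>Y. ?A z \<subseteq> ?A y" if z: "z \<in> carrier R - {\<zero>}" for z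
  proof -
    let ?S = "{y \<in> carrier R - {\<zero>}. ?A z \<subseteq> ?A y}"
    obtain y where y: "y \<in> ?S" and max: "\<And>w. w \<in> ?S \<Longrightarrow> ?A y \<subseteq> ?A w \<Longrightarrow> ?A w = ?A y"
      by (rule ex_maximal_ideal_in_family[of ?S ?A]) (use z ideal in auto)
    have "y \<in> Y" unfolding Y_def using y max by auto
    with y show ?thesis by auto
  qed
  have YR: "Y \<subseteq> carrier R" by (auto simp: Y_def)
  obtain F where F: "F \<in> {F. finite F \<and> F \<subseteq> Y}"
    and maxF: "\<And>G. G \<in> {F. finite F \<and> F \<subseteq> Y} \<Longrightarrow> Idl F \<subseteq> Idl G \<Longrightarrow> Idl G = Idl F"
    by (rule ex_maximal_ideal_in_family[of "{F. finite F \<and> F \<subseteq> Y}" "\<lambda>F. Idl F"])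
      (use YR in \<open>auto intro!: genideal_ideal\<close>)
  then have F: "finite F" "F \<subseteq> Y" by auto
  have inF: "y \<in> Idl F" if "y \<in> Y" for y
  proof -
    have ins: "insert y F \<subseteq> carrier R" using F YR that by auto
    have "Idl F \<subseteq> Idl (insert y F)" using subset_Idl_subset[OF ins, of F] by auto
    then have "Idl (insert y F) = Idl F" using maxF[of "insert y F"] F that by auto
    with genideal_self[OF ins] show ?thesis by auto
  qed
  have "?A ` Y \<subseteq> ?A ` F"
  proof (rule image_subsetI)
    fix y assume y: "y \<in> Y"
    have "\<exists>f\<in>F. ?A f \<subseteq> ?A y"
    proof (rule ccontr)
      assume "\<not> ?thesis"
      then have *: "\<exists>u\<in>carrier R - ?A y. u \<otimes> f = \<zero>" if "f \<in> F" for f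
        using that by (fastforce simp: annihilator_def)
      have "\<exists>u\<in>carrier R - ?A y. \<forall>f\<in>F. u \<otimes> f = \<zero>"
      proof (rule common_multiplier[OF prime[OF y] F(1)])
        fix f u v assume "f \<in> F" "u \<in> carrier R - ?A y" "v \<in> carrier R - ?A y" "u \<otimes> f = \<zero>"
        then show "(v \<otimes> u) \<otimes> f = \<zero>" using F(2) YR by (subst m_assoc) auto
      qed (use * in auto)
      then obtain u where u: "u \<in> carrier R" "u \<notin> ?A y" "\<forall>f\<in>F. u \<otimes> f = \<zero>" by auto
      have "ideal {x \<in> carrier R. u \<otimes> x = \<zero>} R"
        by (rule ideal_if_closed) (use u(1) in \<open>auto simp: r_distr m_lcomm\<close>)
      then have "Idl F \<subseteq> {x \<in> carrier R. u \<otimes> x = \<zero>}"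
        by (rule genideal_minimal) (use u F(2) YR in auto)
      with inF[OF y] u show False by (auto simp: annihilator_def)
    qed
    then obtain f where f: "f \<in> F" "?A f \<subseteq> ?A y" by auto
    with F(2) y have "?A y = ?A f" by (auto simp: Y_def)
    with f show "?A y \<in> ?A ` F" by auto
  qed
  then have fin: "finite (?A ` Y)" using F(1) finite_subset by blast
  have "\<exists>P\<in>?A ` Y. J \<subseteq> P"
  proof (rule ccontr)
    assume "\<not> ?thesis"
    then have "\<exists>a\<in>J. \<forall>P\<in>?A ` Y. a \<notin> P"
    proof (intro prime_avoidance[OF fin _ _ J])
      fix P P' assume "P \<in> ?A ` Y" "P' \<in> ?A ` Y" "P \<subseteq> P'"
      then show "P = P'" by (auto simp: Y_def)
    qed (use prime in auto)
    then obtain a where a: "a \<in> J" "\<And>y. y \<in> Y \<Longrightarrow> a \<notin> ?A y" by auto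
    from zd[OF a(1)] obtain z where z: "z \<in> carrier R - {\<zero>}" "a \<otimes> z = \<zero>" by auto
    from above[OF z(1)] obtain y where y: "y \<in> Y" "?A z \<subseteq> ?A y" by auto
    have "a \<in> ?A z" using z a(1) ideal.Icarr[OF J] by (auto simp: annihilator_def)
    with y a show False by auto
  qed
  then obtain y where "y \<in> Y" "J \<subseteq> ?A y" by auto
  moreover from this(1) have "?A y \<in> associated_primes R (regular_module R)"
    using prime[of y] YR by (auto simp: associated_primes_def regular_module_def annihilator_def)
  ultimately show ?thesis by blast
qed

context noetherian_local_ring
begin

lemma max_ideal: "maximalideal (max_ideal R) R"
  unfolding max_ideal_def by (rule theI') (rule unique_maximalideal)

lemma max_ideal_unique: "maximalideal I R \<Longrightarrow> I = max_ideal R"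
  using max_ideal unique_maximalideal by blast

lemma ideal_max_ideal: "ideal (max_ideal R) R"
  using max_ideal maximalideal.axioms(1) by blast

lemma max_ideal_closed [simp]: "r \<in> max_ideal R \<Longrightarrow> r \<in> carrier R"
  using ideal.Icarr[OF ideal_max_ideal] .

lemma max_ideal_add: "r \<in> max_ideal R \<Longrightarrow> s \<in> max_ideal R \<Longrightarrow> r \<oplus> s \<in> max_ideal R"
  using additive_subgroup.a_closed ideal.axioms(1)[OF ideal_max_ideal] by metis

lemma max_ideal_mult: "r \<in> carrier R \<Longrightarrow> s \<in> max_ideal R \<Longrightarrow> r \<otimes> s \<in> max_ideal R"
  using ideal.I_l_closed[OF ideal_max_ideal] by metis

lemma max_ideal_zero [simp]: "\<zero> \<in> max_ideal R"
  using additive_subgroup.zero_closed ideal.axioms(1)[OF ideal_max_ideal] by metis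

lemma max_ideal_minus: "r \<in> max_ideal R \<Longrightarrow> \<ominus> r \<in> max_ideal R"
  using max_ideal_mult[of "\<ominus> \<one>" r] by (simp add: l_minus)

lemma one_notin_max_ideal: "\<one> \<notin> max_ideal R"
  using max_ideal maximalideal.I_notcarr ideal.one_imp_carrier ideal_max_ideal by metis

lemma unit_if_notin_max_ideal:
  assumes "r \<in> carrier R" "r \<notin> max_ideal R"
  shows "r \<in> Units R"
proof (rule ccontr)
  assume r: "r \<notin> Units R"
  have "\<one> \<notin> PIdl r"
  proof
    assume "\<one> \<in> PIdl r"
    then obtain s where "s \<in> carrier R" "\<one> = s \<otimes> r" by (auto simp: cgenideal_def)
    with r assms(1) show False by (auto simp: Units_def m_comm)
  qed
  let ?S = "{I. ideal I R \<and> PIdl r \<subseteq> I \<and> \<one> \<notin> I}"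
  obtain I where "I \<in> ?S" and max: "\<And>J. J \<in> ?S \<Longrightarrow> I \<subseteq> J \<Longrightarrow> J = I"
    by (rule ex_maximal_ideal_in_family[of ?S "\<lambda>I. I"])
      (use cgenideal_ideal[OF assms(1)] \<open>\<one> \<notin> PIdl r\<close> in auto)
  then have I: "ideal I R" "PIdl r \<subseteq> I" "\<one> \<notin> I" by auto
  have "maximalideal I R"
  proof (rule maximalidealI[OF I(1)])
    show "carrier R \<noteq> I" using I(3) by auto
    fix J assume J: "ideal J R" "I \<subseteq> J" "J \<subseteq> carrier R"
    then show "J = I \<or> J = carrier R"
      using max[of J] I(2) ideal.one_imp_carrier[OF J(1)] by blast
  qed
  then have "I = max_ideal R" by (rule max_ideal_unique)
  with I(2) cgenideal_self[OF assms(1)] assms(2) show False by auto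
qed

lemma not_unit_if_max_ideal:
  assumes "r \<in> max_ideal R"
  shows "r \<notin> Units R"
proof
  assume "r \<in> Units R"
  then obtain s where "s \<in> carrier R" "s \<otimes> r = \<one>" by (auto simp: Units_def)
  with max_ideal_mult[of s r] assms one_notin_max_ideal show False by auto
qed

lemma notin_max_ideal_add:
  assumes "r \<in> carrier R" "r \<notin> max_ideal R" "s \<in> max_ideal R"
  shows "r \<oplus> s \<notin> max_ideal R"
proof
  assume "r \<oplus> s \<in> max_ideal R"
  then have "(r \<oplus> s) \<oplus> \<ominus> s \<in> max_ideal R" using max_ideal_add max_ideal_minus assms(3) by auto
  moreover have "(r \<oplus> s) \<oplus> \<ominus> s = r" using assms by (simp add: a_assoc r_neg)
  ultimately show False using assms by auto
qed

end

section \<open>Ascending chains of submodules and Nakayama's lemma\<close>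

context module
begin

lemma submodule_finsum:
  assumes "submodule N R M" "f \<in> A \<rightarrow> N"
  shows "finsum M f A \<in> N"
  using assms(2)
proof (induction A rule: infinite_finite_induct)
  case (insert a A)
  have "f \<in> insert a A \<rightarrow> carrier M" using insert.prems submoduleE(1)[OF assms(1)] by auto
  then show ?case using insert submoduleE(5)[OF assms(1)] by (subst M.finsum_insert) auto
qed (use submodule_zero[OF assms(1)] in auto)

lemma submodule_plus_line:
  assumes N: "submodule N R M" and I: "ideal I R" and v: "v \<in> carrier M"
  shows "submodule {n \<oplus>\<^bsub>M\<^esub> r \<cdot> v | n r. n \<in> N \<and> r \<in> I} R M" (is "submodule ?S R M")
proof (rule submodule_if_closed)
  have NM: "n \<in> carrier M" if "n \<in> N" for n using submoduleE(1)[OF N] that by auto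
  have IR: "r \<in> carrier R" if "r \<in> I" for r using ideal.Icarr[OF I that] .
  show "?S \<subseteq> carrier M" using NM IR v by auto
  have "\<zero>\<^bsub>M\<^esub> = \<zero>\<^bsub>M\<^esub> \<oplus>\<^bsub>M\<^esub> \<zero> \<cdot> v" using v by simp
  then show "\<zero>\<^bsub>M\<^esub> \<in> ?S"
    using submodule_zero[OF N] additive_subgroup.zero_closed[OF ideal.axioms(1)[OF I]] by blast
  show "x \<oplus>\<^bsub>M\<^esub> y \<in> ?S" if xy: "x \<in> ?S" "y \<in> ?S" for x y
  proof -
    from xy obtain n r n' r' where *: "n \<in> N" "n' \<in> N" "r \<in> I" "r' \<in> I"
      "x = n \<oplus>\<^bsub>M\<^esub> r \<cdot> v" "y = n' \<oplus>\<^bsub>M\<^esub> r' \<cdot> v" by blast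
    then have "x \<oplus>\<^bsub>M\<^esub> y = (n \<oplus>\<^bsub>M\<^esub> n') \<oplus>\<^bsub>M\<^esub> (r \<oplus> r') \<cdot> v"
      using NM[of n] NM[of n'] IR[of r] IR[of r'] v by (simp add: smult_l_distr M.a_ac)
    moreover have "r \<oplus> r' \<in> I"
      using additive_subgroup.a_closed[OF ideal.axioms(1)[OF I]] * by auto
    ultimately show ?thesis using submoduleE(5)[OF N, of n n'] * by blast
  qed
  show "a \<cdot> x \<in> ?S" if a: "a \<in> carrier R" "x \<in> ?S" for a x
  proof -
    from a obtain n r where *: "n \<in> N" "r \<in> I" "x = n \<oplus>\<^bsub>M\<^esub> r \<cdot> v" by blast
    then have "a \<cdot> x = (a \<cdot> n) \<oplus>\<^bsub>M\<^esub> (a \<otimes> r) \<cdot> v"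
      using NM[of n] IR[of r] v a by (simp add: smult_r_distr smult_assoc1)
    then show ?thesis
      using submoduleE(4)[OF N, of a n] ideal.I_l_closed[OF I, of r a] * a by blast
  qed
qed

lemma mem_submodule_if_add_mem:
  assumes N: "submodule N R M" and "y \<in> N" "x \<oplus>\<^bsub>M\<^esub> y \<in> N" "x \<in> carrier M"
  shows "x \<in> N"
proof -
  have "y \<in> carrier M" using submoduleE(1)[OF N] assms by auto
  then have "x = (x \<oplus>\<^bsub>M\<^esub> y) \<ominus>\<^bsub>M\<^esub> y" using assms(4) by (simp add: M.minus_eq M.a_assoc M.r_neg)
  with submodule_diff[OF N assms(3,2)] show ?thesis by simp
qed

lemma submodule_coeff_ideal:
  assumes N: "submodule N R M" and K: "submodule K R M" and v: "v \<in> carrier M"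
  shows "ideal {r \<in> carrier R. \<exists>y\<in>K. r \<cdot> v \<oplus>\<^bsub>M\<^esub> y \<in> N} R"
proof (rule R.ideal_if_closed)
  have KM: "y \<in> carrier M" if "y \<in> K" for y using submoduleE(1)[OF K] that by auto
  show "\<zero> \<in> {r \<in> carrier R. \<exists>y\<in>K. r \<cdot> v \<oplus>\<^bsub>M\<^esub> y \<in> N}"
    using v submodule_zero[OF N] submodule_zero[OF K] by (auto intro!: bexI[of _ "\<zero>\<^bsub>M\<^esub>"])
  fix r s assume "r \<in> {r \<in> carrier R. \<exists>y\<in>K. r \<cdot> v \<oplus>\<^bsub>M\<^esub> y \<in> N}"
    "s \<in> {r \<in> carrier R. \<exists>y\<in>K. r \<cdot> v \<oplus>\<^bsub>M\<^esub> y \<in> N}"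
  then obtain y z where *: "r \<in> carrier R" "s \<in> carrier R" "y \<in> K" "z \<in> K"
    "r \<cdot> v \<oplus>\<^bsub>M\<^esub> y \<in> N" "s \<cdot> v \<oplus>\<^bsub>M\<^esub> z \<in> N" by auto
  have "(r \<oplus> s) \<cdot> v \<oplus>\<^bsub>M\<^esub> (y \<oplus>\<^bsub>M\<^esub> z) = (r \<cdot> v \<oplus>\<^bsub>M\<^esub> y) \<oplus>\<^bsub>M\<^esub> (s \<cdot> v \<oplus>\<^bsub>M\<^esub> z)"
    using * KM[of y] KM[of z] v by (simp add: smult_l_distr M.a_ac)
  with submoduleE(5)[OF N *(5,6)] submoduleE(5)[OF K *(3,4)] *
  show "r \<oplus> s \<in> {r \<in> carrier R. \<exists>y\<in>K. r \<cdot> v \<oplus>\<^bsub>M\<^esub> y \<in> N}" by force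
next
  have KM: "y \<in> carrier M" if "y \<in> K" for y using submoduleE(1)[OF K] that by auto
  fix a r assume a: "a \<in> carrier R" and "r \<in> {r \<in> carrier R. \<exists>y\<in>K. r \<cdot> v \<oplus>\<^bsub>M\<^esub> y \<in> N}"
  then obtain y where *: "r \<in> carrier R" "y \<in> K" "r \<cdot> v \<oplus>\<^bsub>M\<^esub> y \<in> N" by auto
  have "(a \<otimes> r) \<cdot> v \<oplus>\<^bsub>M\<^esub> a \<cdot> y = a \<cdot> (r \<cdot> v \<oplus>\<^bsub>M\<^esub> y)"
    using * KM[of y] v a by (simp add: smult_assoc1 smult_r_distr)
  with submoduleE(4)[OF N a *(3)] submoduleE(4)[OF K a *(2)] * a
  show "a \<otimes> r \<in> {r \<in> carrier R. \<exists>y\<in>K. r \<cdot> v \<oplus>\<^bsub>M\<^esub> y \<in> N}" by force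
qed auto

end

locale noetherian_local_module = module R M + R?: noetherian_local_ring R for R (structure) and M (structure)

context noetherian_local_module
begin

text \<open>By induction on the generators: after adjoining a generator \<open>b\<close>, an element \<open>r b + y\<close> of the chain is controlled by
  the ideal of the possible coefficients \<open>r\<close> and by the part of the chain in the span of the other
  generators, and both stabilize.\<close>

lemma submodule_chain_stabilizes_on_span:
  assumes N: "\<And>k. submodule (N k) R M" "\<And>k. N k \<subseteq> N (Suc k)"
    and "finite B" "B \<subseteq> carrier M"
  shows "\<exists>k. \<forall>l\<ge>k. N l \<inter> {\<Oplus>\<^bsub>M\<^esub>b\<in>B. c b \<cdot> b | c. c \<in> B \<rightarrow> carrier R} \<subseteq> N (k :: nat)"
  using assms(3,4)
proof (induction B rule: finite_induct)
  case empty
  show ?case using submodule_zero[OF N(1)] by auto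
next
  case (insert b B)
  define S where "S = {\<Oplus>\<^bsub>M\<^esub>b\<in>B. c b \<cdot> b | c. c \<in> B \<rightarrow> carrier R}"
  define I where "I k = {r \<in> carrier R. \<exists>y\<in>S. r \<cdot> b \<oplus>\<^bsub>M\<^esub> y \<in> N k}" for k
  have b: "b \<in> carrier M" and BM: "B \<subseteq> carrier M" using insert.prems by auto
  have mono: "N k \<subseteq> N l" if "k \<le> l" for k l using lift_Suc_mono_le[of N, OF N(2) that] .
  have S: "submodule S R M" unfolding S_def by (rule combs_submodule) (use insert in auto)
  have "ideal (I k) R" for k unfolding I_def by (rule submodule_coeff_ideal[OF N(1) S b])
  moreover have "I k \<subseteq> I (Suc k)" for k using N(2)[of k] by (auto simp: I_def)
  ultimately have "\<exists>k. \<forall>l\<ge>k. I l = I k"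
    by (rule ascending_ideals_stabilize[of I]) blast+
  then obtain k1 where k1: "\<forall>l\<ge>k1. I l = I k1" ..
  from insert.IH[OF BM, folded S_def] obtain k2 where k2: "\<forall>l\<ge>k2. N l \<inter> S \<subseteq> N k2" ..
  define k where "k = max k1 k2"
  have "z \<in> N k" if l: "l \<ge> k" and z: "z \<in> N l" "z = (\<Oplus>\<^bsub>M\<^esub>b\<in>insert b B. c b \<cdot> b)"
    "c \<in> insert b B \<rightarrow> carrier R" for l z c
  proof -
    define y where "y = (\<Oplus>\<^bsub>M\<^esub>b\<in>B. c b \<cdot> b)"
    have y: "y \<in> S" using z(3) by (auto simp: S_def y_def)
    have zy: "z = c b \<cdot> b \<oplus>\<^bsub>M\<^esub> y"
      unfolding z(2) y_def by (rule comb_insert) (use insert z in auto)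
    have cb: "c b \<in> carrier R" using z(3) by auto
    then have "c b \<in> I l" using z(1) zy y by (auto simp: I_def)
    moreover have "I l = I k" using k1 l by (metis k_def max.bounded_iff max.cobounded1)
    ultimately obtain y' where y': "y' \<in> S" "c b \<cdot> b \<oplus>\<^bsub>M\<^esub> y' \<in> N k" by (auto simp: I_def)
    have carr: "y \<in> carrier M" "y' \<in> carrier M" using submoduleE(1)[OF S] y y' by auto
    have "z \<ominus>\<^bsub>M\<^esub> (c b \<cdot> b \<oplus>\<^bsub>M\<^esub> y') \<in> N l" using z(1) y'(2) mono[OF l] submodule_diff[OF N(1)] by auto
    moreover have eq: "z \<ominus>\<^bsub>M\<^esub> (c b \<cdot> b \<oplus>\<^bsub>M\<^esub> y') = y \<ominus>\<^bsub>M\<^esub> y'"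
    proof -
      have "(p \<oplus>\<^bsub>M\<^esub> y) \<ominus>\<^bsub>M\<^esub> (p \<oplus>\<^bsub>M\<^esub> y') = y \<ominus>\<^bsub>M\<^esub> y'" if p: "p \<in> carrier M" for p
      proof -
        have "(p \<oplus>\<^bsub>M\<^esub> y) \<ominus>\<^bsub>M\<^esub> (p \<oplus>\<^bsub>M\<^esub> y') = (p \<oplus>\<^bsub>M\<^esub> \<ominus>\<^bsub>M\<^esub> p) \<oplus>\<^bsub>M\<^esub> (y \<oplus>\<^bsub>M\<^esub> \<ominus>\<^bsub>M\<^esub> y')"
          using p carr by (simp add: M.minus_eq M.minus_add M.a_ac)
        with p carr show ?thesis by (simp add: M.r_neg M.minus_eq)
      qed
      with zy cb b show ?thesis by simp
    qed
    moreover have "y \<ominus>\<^bsub>M\<^esub> y' \<in> S" by (rule submodule_diff[OF S y y'(1)])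
    ultimately have "y \<ominus>\<^bsub>M\<^esub> y' \<in> N k2" using k2 l by (auto simp: k_def)
    then have "z \<ominus>\<^bsub>M\<^esub> (c b \<cdot> b \<oplus>\<^bsub>M\<^esub> y') \<in> N k" using mono[of k2 k] eq by (auto simp: k_def)
    then have "z \<oplus>\<^bsub>M\<^esub> \<ominus>\<^bsub>M\<^esub> (c b \<cdot> b \<oplus>\<^bsub>M\<^esub> y') \<in> N k" by (simp add: M.minus_eq)
    moreover have "\<ominus>\<^bsub>M\<^esub> (c b \<cdot> b \<oplus>\<^bsub>M\<^esub> y') \<in> N k" using submoduleE(3)[OF N(1) y'(2)] .
    moreover have "z \<in> carrier M" using z(1) submoduleE(1)[OF N(1)] by auto
    ultimately show "z \<in> N k" using mem_submodule_if_add_mem[OF N(1)] by blast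
  qed
  then show ?case by (intro exI[of _ k]) blast
qed

text \<open>The version for a finite family modulo a submodule. Adjoining \<open>R v\<^sub>0\<close> to \<open>N\<close> removes \<open>v\<^sub>0\<close> from the family, so by induction
  the other elements lie in \<open>N + R v\<^sub>0\<close>; substituting this in the condition for \<open>v\<^sub>0\<close> shows that a unit multiple
  of \<open>v\<^sub>0\<close> lies in \<open>N\<close>.\<close>

lemma nakayama:
  assumes "submodule N R M" "finite B" "v \<in> B \<rightarrow> carrier M"
    and "\<And>b. b \<in> B \<Longrightarrow> \<exists>\<mu>\<in>B \<rightarrow> max_ideal R. v b \<oplus>\<^bsub>M\<^esub> (\<Oplus>\<^bsub>M\<^esub>i\<in>B. \<mu> i \<cdot> v i) \<in> N"
    and "b \<in> B"
  shows "v b \<in> N"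
  using assms(2,1,3,4,5)
proof (induction B arbitrary: N b rule: finite_induct)
  case (insert b0 B)
  note N = insert.prems(1)
  have NM: "n \<in> carrier M" if "n \<in> N" for n using submoduleE(1)[OF N] that by auto
  have v: "v b \<in> carrier M" if "b \<in> insert b0 B" for b using insert.prems(2) that by auto
  have v0: "v b0 \<in> carrier M" and vB: "v \<in> B \<rightarrow> carrier M" using v by auto
  let ?N = "\<lambda>I. {n \<oplus>\<^bsub>M\<^esub> r \<cdot> v b0 | n r. n \<in> N \<and> r \<in> I}"
  have N1: "submodule (?N (carrier R)) R M" by (rule submodule_plus_line[OF N R.oneideal v0])
  have N2: "submodule (?N (max_ideal R)) R M" by (rule submodule_plus_line[OF N ideal_max_ideal v0])
  have split: "(\<Oplus>\<^bsub>M\<^esub>i\<in>insert b0 B. \<mu> i \<cdot> v i) = \<mu> b0 \<cdot> v b0 \<oplus>\<^bsub>M\<^esub> (\<Oplus>\<^bsub>M\<^esub>i\<in>B. \<mu> i \<cdot> v i)"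
    if "\<mu> \<in> insert b0 B \<rightarrow> max_ideal R" for \<mu>
    by (rule comb_insert) (use insert.hyps that v in \<open>auto simp: Pi_iff\<close>)
  have other: "v b \<in> ?N (carrier R)" if b: "b \<in> B" for b
  proof (rule insert.IH[OF N1 vB _ b])
    fix b assume b: "b \<in> B"
    from insert.prems(3)[of b] b obtain \<mu> where \<mu>: "\<mu> \<in> insert b0 B \<rightarrow> max_ideal R"
      and mem: "v b \<oplus>\<^bsub>M\<^esub> (\<Oplus>\<^bsub>M\<^esub>i\<in>insert b0 B. \<mu> i \<cdot> v i) \<in> N" by blast
    let ?s = "\<Oplus>\<^bsub>M\<^esub>i\<in>B. \<mu> i \<cdot> v i"
    have \<mu>0: "\<mu> b0 \<in> carrier R" and \<mu>B: "\<mu> \<in> B \<rightarrow> max_ideal R" using \<mu> by auto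
    have s: "?s \<in> carrier M" by (rule comb_closed) (use \<mu>B vB in \<open>auto simp: Pi_iff\<close>)
    have "v b \<oplus>\<^bsub>M\<^esub> ?s = (v b \<oplus>\<^bsub>M\<^esub> (\<mu> b0 \<cdot> v b0 \<oplus>\<^bsub>M\<^esub> ?s)) \<oplus>\<^bsub>M\<^esub> (\<ominus> \<mu> b0) \<cdot> v b0"
    proof -
      have "(v b \<oplus>\<^bsub>M\<^esub> (\<mu> b0 \<cdot> v b0 \<oplus>\<^bsub>M\<^esub> ?s)) \<oplus>\<^bsub>M\<^esub> (\<ominus> \<mu> b0) \<cdot> v b0
        = (v b \<oplus>\<^bsub>M\<^esub> ?s) \<oplus>\<^bsub>M\<^esub> (\<mu> b0 \<cdot> v b0 \<oplus>\<^bsub>M\<^esub> \<ominus>\<^bsub>M\<^esub> (\<mu> b0 \<cdot> v b0))"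
        using s v[of b] b v0 \<mu>0 by (simp add: smult_l_minus M.a_ac)
      with s v[of b] b v0 \<mu>0 show ?thesis by (simp add: M.r_neg)
    qed
    then have "v b \<oplus>\<^bsub>M\<^esub> ?s \<in> ?N (carrier R)" using mem split[OF \<mu>] \<mu>0 by auto
    with \<mu>B show "\<exists>\<mu>\<in>B \<rightarrow> max_ideal R. v b \<oplus>\<^bsub>M\<^esub> (\<Oplus>\<^bsub>M\<^esub>i\<in>B. \<mu> i \<cdot> v i) \<in> ?N (carrier R)" by blast
  qed
  have first: "v b0 \<in> N"
  proof -
    from insert.prems(3)[of b0] obtain \<mu> where \<mu>: "\<mu> \<in> insert b0 B \<rightarrow> max_ideal R"
      and mem: "v b0 \<oplus>\<^bsub>M\<^esub> (\<Oplus>\<^bsub>M\<^esub>i\<in>insert b0 B. \<mu> i \<cdot> v i) \<in> N" by blast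
    have \<mu>0: "\<mu> b0 \<in> max_ideal R" using \<mu> by auto
    have "(\<Oplus>\<^bsub>M\<^esub>i\<in>B. \<mu> i \<cdot> v i) \<in> ?N (max_ideal R)"
    proof (rule submodule_finsum[OF N2], rule)
      fix b assume b: "b \<in> B"
      from other[OF b] obtain n r where nr: "n \<in> N" "r \<in> carrier R" "v b = n \<oplus>\<^bsub>M\<^esub> r \<cdot> v b0" by blast
      have \<mu>b: "\<mu> b \<in> max_ideal R" using \<mu> b by auto
      then have "\<mu> b \<cdot> v b = \<mu> b \<cdot> n \<oplus>\<^bsub>M\<^esub> (r \<otimes> \<mu> b) \<cdot> v b0"
        using nr NM[of n] v0 by (simp add: smult_r_distr smult_assoc1 R.m_comm[of r "\<mu> b"])
      moreover have "\<mu> b \<cdot> n \<in> N" using submoduleE(4)[OF N] \<mu>b nr(1) by auto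
      moreover have "r \<otimes> \<mu> b \<in> max_ideal R" using max_ideal_mult nr(2) \<mu>b by auto
      ultimately show "\<mu> b \<cdot> v b \<in> ?N (max_ideal R)" by blast
    qed
    then obtain n s where s: "n \<in> N" "s \<in> max_ideal R"
      "(\<Oplus>\<^bsub>M\<^esub>i\<in>B. \<mu> i \<cdot> v i) = n \<oplus>\<^bsub>M\<^esub> s \<cdot> v b0" by blast
    define t where "t = \<one> \<oplus> (\<mu> b0 \<oplus> s)"
    have tR: "t \<in> carrier R" using \<mu>0 s by (simp add: t_def)
    have "t \<notin> max_ideal R"
      unfolding t_def using notin_max_ideal_add one_notin_max_ideal max_ideal_add \<mu>0 s by auto
    then have "t \<in> Units R" using unit_if_notin_max_ideal tR by blast
    then obtain t' where t': "t' \<in> carrier R" "t' \<otimes> t = \<one>" by (auto simp: Units_def)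
    have "v b0 \<oplus>\<^bsub>M\<^esub> (\<mu> b0 \<cdot> v b0 \<oplus>\<^bsub>M\<^esub> (n \<oplus>\<^bsub>M\<^esub> s \<cdot> v b0)) = t \<cdot> v b0 \<oplus>\<^bsub>M\<^esub> n"
      using v0 \<mu>0 s NM[of n] by (simp add: t_def smult_l_distr M.a_ac)
    then have "t \<cdot> v b0 \<oplus>\<^bsub>M\<^esub> n \<in> N" using mem split[OF \<mu>] s by simp
    then have "t \<cdot> v b0 \<in> N" using mem_submodule_if_add_mem[OF N s(1)] tR v0 by auto
    then have "t' \<cdot> (t \<cdot> v b0) \<in> N" using submoduleE(4)[OF N] t' by auto
    then show ?thesis using t' tR v0 by (simp add: smult_assoc1[symmetric])
  qed
  show ?case
  proof (cases "b = b0")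
    case False
    then have "b \<in> B" using insert.prems by auto
    from other[OF this] obtain n r where nr: "n \<in> N" "r \<in> carrier R" "v b = n \<oplus>\<^bsub>M\<^esub> r \<cdot> v b0" by blast
    then show ?thesis using submoduleE(4,5)[OF N] first by auto
  qed (use first in auto)
qed auto

end

section \<open>Dimension counting at a prime\<close>

text \<open>The family generates the localization at \<open>P\<close>, with denominators cleared.\<close>

definition spans_at ::
    "('a, 'k) ring_scheme \<Rightarrow> ('a, 'b, 'm) module_scheme \<Rightarrow> 'a set \<Rightarrow> 'i set \<Rightarrow> ('i \<Rightarrow> 'b) \<Rightarrow> bool" where
  "spans_at R M P I e \<longleftrightarrow> (\<forall>y\<in>carrier M. \<exists>u\<in>carrier R - P. \<exists>c\<in>I \<rightarrow> carrier R.
     u \<odot>\<^bsub>M\<^esub> y = (\<Oplus>\<^bsub>M\<^esub>i\<in>I. c i \<odot>\<^bsub>M\<^esub> e i))"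

definition relations ::
    "('a, 'k) ring_scheme \<Rightarrow> ('a, 'b, 'm) module_scheme \<Rightarrow> 'i set \<Rightarrow> ('i \<Rightarrow> 'b) \<Rightarrow> ('i \<Rightarrow> 'a) set" where
  "relations R M I e = {c \<in> I \<rightarrow> carrier R. (\<Oplus>\<^bsub>M\<^esub>i\<in>I. c i \<odot>\<^bsub>M\<^esub> e i) = \<zero>\<^bsub>M\<^esub>}"

text \<open>The saturated submodules are the preimages of the subspaces of the vector space \<open>M\<^sub>P / P M\<^sub>P\<close> over the residue field
  at \<open>P\<close>. Working with them counts dimensions of this space without constructing it.\<close>

definition saturated_at ::
    "('a, 'k) ring_scheme \<Rightarrow> ('a, 'b, 'm) module_scheme \<Rightarrow> 'a set \<Rightarrow> 'b set \<Rightarrow> bool" where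
  "saturated_at R M P N \<longleftrightarrow> submodule N R M \<and> (\<forall>r\<in>P. \<forall>y\<in>carrier M. r \<odot>\<^bsub>M\<^esub> y \<in> N) \<and>
     (\<forall>u\<in>carrier R - P. \<forall>y\<in>carrier M. u \<odot>\<^bsub>M\<^esub> y \<in> N \<longrightarrow> y \<in> N)"

text \<open>Corresponds to the linear span of the image of \<open>A\<close> in \<open>M\<^sub>P / P M\<^sub>P\<close>.\<close>

definition closure_at ::
    "('a, 'k) ring_scheme \<Rightarrow> ('a, 'b, 'm) module_scheme \<Rightarrow> 'a set \<Rightarrow> 'b set \<Rightarrow> 'b set" where
  "closure_at R M P A = \<Inter>{N. saturated_at R M P N \<and> A \<subseteq> N}"

context module
begin

context
  fixes P assumes P: "primeideal P R"
begin

lemma saturated_at_closure: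
  assumes "A \<subseteq> carrier M"
  shows "saturated_at R M P (closure_at R M P A)"
proof -
  have sub: "submodule N R M" if "saturated_at R M P N" for N using that by (simp add: saturated_at_def)
  have PR: "r \<in> carrier R" if "r \<in> P" for r using ideal.Icarr primeideal.axioms(1)[OF P] that by metis
  have "saturated_at R M P (carrier M)"
    using carrier_is_submodule PR by (auto simp: saturated_at_def)
  with assms have "closure_at R M P A \<subseteq> carrier M" by (auto simp: closure_at_def)
  moreover have "submodule (closure_at R M P A) R M"
  proof (rule submodule_if_closed)
    show "closure_at R M P A \<subseteq> carrier M" by fact
    show "\<zero>\<^bsub>M\<^esub> \<in> closure_at R M P A"
      unfolding closure_at_def using submodule_zero[OF sub] by blast
    show "x \<oplus>\<^bsub>M\<^esub> y \<in> closure_at R M P A"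
      if "x \<in> closure_at R M P A" "y \<in> closure_at R M P A" for x y
      using that submoduleE(5)[OF sub] unfolding closure_at_def by blast
    show "a \<cdot> x \<in> closure_at R M P A"
      if "a \<in> carrier R" "x \<in> closure_at R M P A" for a x
      using that submoduleE(4)[OF sub] unfolding closure_at_def by blast
  qed
  moreover have "r \<cdot> y \<in> closure_at R M P A" if "r \<in> P" "y \<in> carrier M" for r y
    unfolding closure_at_def using that by (auto simp: saturated_at_def)
  moreover have "y \<in> closure_at R M P A"
    if "u \<in> carrier R - P" "y \<in> carrier M" "u \<cdot> y \<in> closure_at R M P A" for u y
    unfolding closure_at_def
  proof
    fix N assume "N \<in> {N. saturated_at R M P N \<and> A \<subseteq> N}"
    moreover from this that(3) have "u \<cdot> y \<in> N" by (auto simp: closure_at_def)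
    ultimately show "y \<in> N" using that(1,2) by (auto simp: saturated_at_def)
  qed
  ultimately show ?thesis by (simp add: saturated_at_def)
qed

lemma closure_at_superset: "A \<subseteq> closure_at R M P A"
  by (auto simp: closure_at_def)

lemma closure_at_least: "saturated_at R M P N \<Longrightarrow> A \<subseteq> N \<Longrightarrow> closure_at R M P A \<subseteq> N"
  by (auto simp: closure_at_def)

lemma closure_at_mono: "A \<subseteq> B \<Longrightarrow> closure_at R M P A \<subseteq> closure_at R M P B"
  by (auto simp: closure_at_def)

text \<open>The elements that have a multiple by some \<open>u \<notin> P\<close> of the form \<open>c + r x\<close> with \<open>c\<close> in the closure of \<open>A\<close> form a
  saturated submodule, so \<open>y\<close> is one of them. If \<open>r \<in> P\<close>, then \<open>y\<close> would be in the closure of \<open>A\<close>. Otherwise \<open>r x\<close>, and with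
  it \<open>x\<close>, is in the closure of \<open>A\<close> and \<open>y\<close>.\<close>

lemma closure_at_exchange:
  assumes A: "A \<subseteq> carrier M" and x: "x \<in> carrier M"
    and y: "y \<in> closure_at R M P (insert x A)" "y \<notin> closure_at R M P A"
  shows "x \<in> closure_at R M P (insert y A)"
proof -
  let ?C = "closure_at R M P A"
  have C: "saturated_at R M P ?C" by (rule saturated_at_closure[OF A])
  then have Csub: "submodule ?C R M" by (simp add: saturated_at_def)
  have CM: "c \<in> carrier M" if "c \<in> ?C" for c using submoduleE(1)[OF Csub] that by auto
  have PI: "ideal P R" using primeideal.axioms(1)[OF P] .
  have PR: "r \<in> carrier R" if "r \<in> P" for r using ideal.Icarr[OF PI that] .
  note prime = R.primeideal_complement_mult[OF P]
  note one = R.one_notin_primeideal[OF P]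
  define D where "D = {z \<in> carrier M. \<exists>u\<in>carrier R - P. \<exists>r\<in>carrier R. \<exists>c\<in>?C. u \<cdot> z = c \<oplus>\<^bsub>M\<^esub> r \<cdot> x}"
  have DI: "z \<in> D" if "z \<in> carrier M" "u \<in> carrier R - P" "r \<in> carrier R" "c \<in> ?C"
    "u \<cdot> z = c \<oplus>\<^bsub>M\<^esub> r \<cdot> x" for z u r c using that unfolding D_def by blast
  have CD: "?C \<subseteq> D"
  proof
    fix z assume z: "z \<in> ?C"
    show "z \<in> D" by (rule DI[OF CM[OF z] one R.zero_closed z]) (use CM[OF z] x in simp)
  qed
  have xD: "x \<in> D"
    by (rule DI[OF x one R.one_closed submodule_zero[OF Csub]]) (use x in simp)
  have "submodule D R M"
  proof (rule submodule_if_closed)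
    show "D \<subseteq> carrier M" by (auto simp: D_def)
    show "\<zero>\<^bsub>M\<^esub> \<in> D" using CD submodule_zero[OF Csub] by auto
    show "z \<oplus>\<^bsub>M\<^esub> z' \<in> D" if zz: "z \<in> D" "z' \<in> D" for z z'
    proof -
      from zz obtain u r c u' r' c' where *: "z \<in> carrier M" "z' \<in> carrier M"
        "u \<in> carrier R - P" "u' \<in> carrier R - P" "r \<in> carrier R" "r' \<in> carrier R" "c \<in> ?C" "c' \<in> ?C"
        "u \<cdot> z = c \<oplus>\<^bsub>M\<^esub> r \<cdot> x" "u' \<cdot> z' = c' \<oplus>\<^bsub>M\<^esub> r' \<cdot> x"
        unfolding D_def by blast
      have "(u \<otimes> u') \<cdot> (z \<oplus>\<^bsub>M\<^esub> z') = u' \<cdot> (u \<cdot> z) \<oplus>\<^bsub>M\<^esub> u \<cdot> (u' \<cdot> z')"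
        using *(1-4) by (simp add: smult_r_distr smult_assoc1[symmetric] R.m_comm)
      also have "\<dots> = (u' \<cdot> c \<oplus>\<^bsub>M\<^esub> u \<cdot> c') \<oplus>\<^bsub>M\<^esub> (u' \<otimes> r \<oplus> u \<otimes> r') \<cdot> x"
        unfolding *(9,10) using *(3-6) CM[OF *(7)] CM[OF *(8)] x
        by (simp add: smult_r_distr smult_l_distr smult_assoc1 M.a_ac)
      finally show ?thesis
        by (rule DI[rotated 4]) (use * prime[OF *(3,4)] submoduleE(4,5)[OF Csub] in auto)
    qed
    show "a \<cdot> z \<in> D" if az: "a \<in> carrier R" "z \<in> D" for a z
    proof -
      from az obtain u r c where *: "z \<in> carrier M" "u \<in> carrier R - P" "r \<in> carrier R" "c \<in> ?C"
        "u \<cdot> z = c \<oplus>\<^bsub>M\<^esub> r \<cdot> x" unfolding D_def by blast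
      have "u \<cdot> (a \<cdot> z) = a \<cdot> (u \<cdot> z)"
        using *(1-4) az(1) by (simp add: smult_assoc1[symmetric] R.m_comm)
      also have "\<dots> = a \<cdot> c \<oplus>\<^bsub>M\<^esub> (a \<otimes> r) \<cdot> x"
        unfolding *(5) using * CM[OF *(4)] x az by (simp add: smult_r_distr smult_assoc1)
      finally show ?thesis
        by (rule DI[rotated 4]) (use * az submoduleE(4)[OF Csub] in auto)
    qed
  qed
  moreover have "r \<cdot> z \<in> D" if "r \<in> P" "z \<in> carrier M" for r z
    using C CD that by (auto simp: saturated_at_def)
  moreover have "z \<in> D" if vz: "v \<in> carrier R - P" "z \<in> carrier M" "v \<cdot> z \<in> D" for v z
  proof -
    from vz obtain u r c where *: "u \<in> carrier R - P" "r \<in> carrier R" "c \<in> ?C"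
        "u \<cdot> (v \<cdot> z) = c \<oplus>\<^bsub>M\<^esub> r \<cdot> x" unfolding D_def by blast
    show ?thesis
      by (rule DI[OF vz(2) prime[OF *(1) vz(1)] *(2,3)]) (use * vz in \<open>simp add: smult_assoc1\<close>)
  qed
  ultimately have "saturated_at R M P D" by (auto simp: saturated_at_def)
  then have "closure_at R M P (insert x A) \<subseteq> D"
    by (rule closure_at_least) (use xD CD closure_at_superset[of A] in auto)
  with y have "y \<in> D" by auto
  then obtain u r c where *: "y \<in> carrier M" "u \<in> carrier R - P" "r \<in> carrier R" "c \<in> ?C"
    "u \<cdot> y = c \<oplus>\<^bsub>M\<^esub> r \<cdot> x" unfolding D_def by blast
  have rP: "r \<notin> P"
  proof
    assume "r \<in> P"
    then have "r \<cdot> x \<in> ?C" using C x by (auto simp: saturated_at_def)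
    then have "u \<cdot> y \<in> ?C" using * submoduleE(5)[OF Csub] by auto
    then have "y \<in> ?C" using C * by (auto simp: saturated_at_def)
    with y show False by simp
  qed
  let ?E = "closure_at R M P (insert y A)"
  have E: "saturated_at R M P ?E" by (rule saturated_at_closure) (use A * in auto)
  then have Esub: "submodule ?E R M" by (simp add: saturated_at_def)
  have "c \<in> ?E" using closure_at_mono[of A "insert y A"] * by auto
  moreover have "u \<cdot> y \<in> ?E" by (rule submoduleE(4)[OF Esub]) (use closure_at_superset[of "insert y A"] * in auto)
  then have "r \<cdot> x \<oplus>\<^bsub>M\<^esub> c \<in> ?E" using * CM x by (simp add: M.a_comm)
  ultimately have "r \<cdot> x \<in> ?E"
    by (rule mem_submodule_if_add_mem[OF Esub]) (rule smult_closed[OF *(3) x])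
  then show ?thesis using E rP * x by (auto simp: saturated_at_def)
qed

text \<open>Elements of \<open>X\<close> outside \<open>Y\<close> are exchanged for elements of \<open>Y\<close> one at a time, which preserves independence and
  cardinality.\<close>

lemma closure_at_steinitz:
  assumes "finite X" "finite Y" "X \<subseteq> carrier M" "Y \<subseteq> carrier M"
    and indep: "\<And>x. x \<in> X \<Longrightarrow> x \<notin> closure_at R M P (X - {x})"
    and span: "carrier M \<subseteq> closure_at R M P Y"
  shows "card X \<le> card Y"
  using assms(1,3) indep
proof (induction "card (X - Y)" arbitrary: X rule: less_induct)
  case less
  show ?case
  proof (cases "X \<subseteq> Y")
    case True
    then show ?thesis using assms(2) card_mono by blast
  next
    case False
    then obtain x where x: "x \<in> X" "x \<notin> Y" by auto
    let ?C = "closure_at R M P (X - {x})"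
    have XM: "X - {x} \<subseteq> carrier M" using less.prems by auto
    have "\<not> Y \<subseteq> ?C"
    proof
      assume "Y \<subseteq> ?C"
      with closure_at_least[OF saturated_at_closure[OF XM]] have "closure_at R M P Y \<subseteq> ?C" .
      with span less.prems x show False by blast
    qed
    then obtain y where y: "y \<in> Y" "y \<notin> ?C" by auto
    then have yX: "y \<notin> X - {x}" using closure_at_superset[of "X - {x}"] by auto
    have yM: "y \<in> carrier M" using y assms(4) by auto
    let ?X = "insert y (X - {x})"
    have "card ?X = Suc (card (X - {x}))"
      by (rule card_insert_disjoint) (use yX less.prems(1) in auto)
    also have "\<dots> = card X" using less.prems(1) x(1) by (rule card_Suc_Diff1)
    finally have "card X = card ?X" ..
    also have "card ?X \<le> card Y"
    proof (rule less.hyps)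
      have eq: "?X - Y = (X - Y) - {x}" using y(1) by auto
      show "card (?X - Y) < card (X - Y)"
        unfolding eq by (rule card_Diff1_less) (use x less.prems(1) in simp_all)
      show "finite ?X" "?X \<subseteq> carrier M" using less.prems yM by auto
      fix z assume z: "z \<in> ?X"
      show "z \<notin> closure_at R M P (?X - {z})"
      proof (cases "z = y")
        case True
        then have eq: "?X - {z} = X - {x}" using yX by auto
        show ?thesis unfolding eq unfolding True by (rule y(2))
      next
        case False
        then have zX: "z \<in> X" "z \<noteq> x" using z by auto
        then have eq: "?X - {z} = insert y (X - {x} - {z})" using False by auto
        have notin: "z \<notin> closure_at R M P (X - {x} - {z})"
          using less.prems(3)[OF zX(1)] closure_at_mono[of "X - {x} - {z}" "X - {z}"] by auto
        show ?thesis
        proof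
          assume "z \<in> closure_at R M P (?X - {z})"
          then have *: "z \<in> closure_at R M P (insert y (X - {x} - {z}))" unfolding eq .
          have "X - {x} - {z} \<subseteq> carrier M" using less.prems by auto
          from closure_at_exchange[OF this yM * notin]
          have "y \<in> closure_at R M P (insert z (X - {x} - {z}))" .
          moreover have eq': "insert z (X - {x} - {z}) = X - {x}" using zX by auto
          ultimately have "y \<in> ?C" unfolding eq' by simp
          then show False by (rule notE[OF y(2)])
        qed
      qed
    qed
    finally show ?thesis .
  qed
qed

text \<open>Since the relations have coefficients in \<open>P\<close>, the elements that have, up to a denominator, \<open>i\<close>-th coefficient in
  \<open>P\<close> form a proper subspace. It contains the other members of the family.\<close>

lemma independent_at:
  assumes I: "finite I" "e \<in> I \<rightarrow> carrier M" and span: "spans_at R M P I e"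
    and rel: "\<And>c i. c \<in> relations R M I e \<Longrightarrow> i \<in> I \<Longrightarrow> c i \<in> P" and i: "i \<in> I"
  shows "e i \<notin> closure_at R M P (e ` (I - {i}))"
proof -
  have PI: "ideal P R" using primeideal.axioms(1)[OF P] .
  have PR: "r \<in> carrier R" if "r \<in> P" for r using ideal.Icarr[OF PI that] .
  have Padd: "r \<oplus> s \<in> P" if "r \<in> P" "s \<in> P" for r s
    using additive_subgroup.a_closed[OF ideal.axioms(1)[OF PI]] that by auto
  have P0: "\<zero> \<in> P" using additive_subgroup.zero_closed[OF ideal.axioms(1)[OF PI]] .
  have Pmult: "r \<otimes> s \<in> P" if "r \<in> carrier R" "s \<in> P" for r s using ideal.I_l_closed[OF PI] that by auto
  note prime = R.primeideal_complement_mult[OF P]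
  note one = R.one_notin_primeideal[OF P]
  let ?s = "\<lambda>c. \<Oplus>\<^bsub>M\<^esub>i\<in>I. c i \<cdot> e i"
  define D where "D = {y \<in> carrier M. \<exists>u\<in>carrier R - P. \<exists>c\<in>I \<rightarrow> carrier R. c i \<in> P \<and> u \<cdot> y = ?s c}"
  have DI: "y \<in> D" if "y \<in> carrier M" "u \<in> carrier R - P" "c \<in> I \<rightarrow> carrier R" "c i \<in> P" "u \<cdot> y = ?s c"
    for y u c using that unfolding D_def by blast
  have "submodule D R M"
  proof (rule submodule_if_closed)
    show "D \<subseteq> carrier M" unfolding D_def by (rule Collect_restrict)
    show "\<zero>\<^bsub>M\<^esub> \<in> D"
      by (rule DI[of _ \<one> "\<lambda>_. \<zero>"]) (use one P0 comb_zero[of I "\<lambda>_. \<zero>" e] I in auto)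
    show "x \<oplus>\<^bsub>M\<^esub> y \<in> D" if xy: "x \<in> D" "y \<in> D" for x y
    proof -
      from xy obtain u c u' c' where *: "x \<in> carrier M" "y \<in> carrier M" "u \<in> carrier R - P" "u' \<in> carrier R - P"
        "c \<in> I \<rightarrow> carrier R" "c' \<in> I \<rightarrow> carrier R" "c i \<in> P" "c' i \<in> P" "u \<cdot> x = ?s c" "u' \<cdot> y = ?s c'"
        unfolding D_def by blast
      have "(u \<otimes> u') \<cdot> (x \<oplus>\<^bsub>M\<^esub> y) = u' \<cdot> (u \<cdot> x) \<oplus>\<^bsub>M\<^esub> u \<cdot> (u' \<cdot> y)"
        using *(1-4) by (simp add: smult_r_distr smult_assoc1[symmetric] R.m_comm)
      also have "\<dots> = ?s (\<lambda>i. u' \<otimes> c i) \<oplus>\<^bsub>M\<^esub> ?s (\<lambda>i. u \<otimes> c' i)"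
        unfolding *(9,10) using * comb_smult[OF I(1) _ _ I(2)] by simp
      also have "\<dots> = ?s (\<lambda>i. u' \<otimes> c i \<oplus> u \<otimes> c' i)"
        by (rule comb_add[symmetric]) (use * I in auto)
      finally show ?thesis
        by (rule DI[rotated 4]) (use * prime[OF *(3,4)] Padd Pmult in auto)
    qed
    show "a \<cdot> x \<in> D" if ax: "a \<in> carrier R" "x \<in> D" for a x
    proof -
      from ax obtain u c where *: "x \<in> carrier M" "u \<in> carrier R - P" "c \<in> I \<rightarrow> carrier R" "c i \<in> P" "u \<cdot> x = ?s c"
        unfolding D_def by blast
      have "u \<cdot> (a \<cdot> x) = a \<cdot> (u \<cdot> x)"
        using *(1-4) ax(1) by (simp add: smult_assoc1[symmetric] R.m_comm)
      also have "\<dots> = ?s (\<lambda>i. a \<otimes> c i)" unfolding *(5) using * ax comb_smult[OF I(1) _ _ I(2)] by simp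
      finally show ?thesis by (rule DI[rotated 4]) (use * ax Pmult in auto)
    qed
  qed
  moreover have "r \<cdot> y \<in> D" if r: "r \<in> P" and y: "y \<in> carrier M" for r y
  proof -
    from span y obtain u c where *: "u \<in> carrier R - P" "c \<in> I \<rightarrow> carrier R" "u \<cdot> y = ?s c"
      unfolding spans_at_def by blast
    have "u \<cdot> (r \<cdot> y) = r \<cdot> (u \<cdot> y)"
      using *(1,2) y PR[OF r] by (simp add: smult_assoc1[symmetric] R.m_comm)
    also have "\<dots> = ?s (\<lambda>i. r \<otimes> c i)" unfolding *(3) using * PR[OF r] comb_smult[OF I(1) _ _ I(2)] by simp
    finally show ?thesis
      by (rule DI[rotated 4]) (use * y r PR[OF r] ideal.I_r_closed[OF PI r] i in auto)
  qed
  moreover have "y \<in> D" if vy: "v \<in> carrier R - P" "y \<in> carrier M" "v \<cdot> y \<in> D" for v y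
  proof -
    from vy obtain u c where *: "u \<in> carrier R - P" "c \<in> I \<rightarrow> carrier R" "c i \<in> P" "u \<cdot> (v \<cdot> y) = ?s c"
      unfolding D_def by blast
    show ?thesis
      by (rule DI[OF vy(2) prime[OF *(1) vy(1)] *(2,3)]) (use * vy in \<open>simp add: smult_assoc1\<close>)
  qed
  ultimately have D: "saturated_at R M P D" by (auto simp: saturated_at_def)
  have "e ` (I - {i}) \<subseteq> D"
  proof (rule image_subsetI)
    fix j assume j: "j \<in> I - {i}"
    show "e j \<in> D"
      by (rule DI[of _ \<one> "\<lambda>k. if k = j then \<one> else \<zero>"]) (use j one P0 I comb_delta[of I j \<one> e] in auto)
  qed
  with closure_at_least[OF D] have "closure_at R M P (e ` (I - {i})) \<subseteq> D" .
  moreover have "e i \<notin> D"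
  proof
    assume "e i \<in> D"
    then obtain u c where *: "u \<in> carrier R - P" "c \<in> I \<rightarrow> carrier R" "c i \<in> P" "u \<cdot> e i = ?s c"
      unfolding D_def by blast
    let ?d = "\<lambda>j. (if j = i then u else \<zero>) \<ominus> c j"
    have eM: "e i \<in> carrier M" using I i by auto
    have "?s ?d = u \<cdot> e i \<ominus>\<^bsub>M\<^esub> ?s c"
      using comb_diff[OF I(1) _ *(2) I(2), of "\<lambda>j. if j = i then u else \<zero>"] comb_delta[OF I(1) i _ I(2), of u] *(1)
      by auto
    also have "\<dots> = \<zero>\<^bsub>M\<^esub>" using comb_closed[OF *(2) I(2)] by (simp add: *(4) M.minus_eq M.r_neg)
    finally have "?d \<in> relations R M I e" using * by (auto simp: relations_def)
    from rel[OF this i] have "u \<oplus> \<ominus> c i \<in> P" by (simp add: R.minus_eq)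
    from Padd[OF this *(3)] have "u \<in> P" using * PR[of "c i"] by (simp add: R.a_assoc R.l_neg)
    with * show False by auto
  qed
  ultimately show ?thesis by auto
qed

lemma card_le_if_relations_in_prime:
  assumes I: "finite I" "e \<in> I \<rightarrow> carrier M" "spans_at R M P I e"
    and rel: "\<And>c i. c \<in> relations R M I e \<Longrightarrow> i \<in> I \<Longrightarrow> c i \<in> P"
    and J: "finite J" "f \<in> J \<rightarrow> carrier M" "spans_at R M P J f"
  shows "card I \<le> card J"
proof -
  have ind: "e i \<notin> closure_at R M P (e ` (I - {i}))" if "i \<in> I" for i
    by (rule independent_at[OF I]) (use rel that in auto)
  have "inj_on e I"
  proof (rule inj_onI, rule ccontr)
    fix i j assume ij: "i \<in> I" "j \<in> I" "e i = e j" "i \<noteq> j"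
    then have "e i \<in> e ` (I - {i})" by auto
    with ind[OF ij(1)] closure_at_superset[of "e ` (I - {i})"] show False by blast
  qed
  then have "card I = card (e ` I)" by (simp add: card_image)
  also have "\<dots> \<le> card (f ` J)"
  proof (rule closure_at_steinitz)
    show "x \<notin> closure_at R M P (e ` I - {x})" if "x \<in> e ` I" for x
    proof -
      from that obtain i where i: "i \<in> I" "x = e i" by auto
      then have "e ` I - {x} = e ` (I - {i})" using \<open>inj_on e I\<close> by (auto simp: inj_on_def)
      with ind[OF i(1)] i show ?thesis by simp
    qed
    let ?C = "closure_at R M P (f ` J)"
    have sat: "saturated_at R M P ?C" by (rule saturated_at_closure) (use J in auto)
    then have sub: "submodule ?C R M" by (simp add: saturated_at_def)
    show "carrier M \<subseteq> ?C"
    proof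
      fix y assume y: "y \<in> carrier M"
      with J obtain u c where *: "u \<in> carrier R - P" "c \<in> J \<rightarrow> carrier R" "u \<cdot> y = (\<Oplus>\<^bsub>M\<^esub>i\<in>J. c i \<cdot> f i)"
        unfolding spans_at_def by blast
      have "(\<Oplus>\<^bsub>M\<^esub>i\<in>J. c i \<cdot> f i) \<in> ?C"
        by (rule submodule_comb[OF sub J(1) *(2)]) (use closure_at_superset[of "f ` J"] in auto)
      with * y sat show "y \<in> ?C" by (auto simp: saturated_at_def)
    qed
  qed (use I J in auto)
  also have "\<dots> \<le> card J" using J(1) by (rule card_image_le)
  finally show ?thesis .
qed

end

end

section \<open>Vanishing of relations\<close>

lemma regular_module_simps [simp]:
  "carrier (regular_module R) = carrier R" "smult (regular_module R) = monoid.mult R"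
  "zero (regular_module R) = zero R" "add (regular_module R) = add R"
  "finsum (regular_module R) = finsum R"
  by (auto simp: regular_module_def finsum_def finprod_def fun_eq_iff)

lemma (in cring) module_regular_module: "module R (regular_module R)"
proof (rule moduleI[OF is_cring])
  show "abelian_group (regular_module R)"
    by (rule abelian_groupI) (use l_neg in \<open>auto simp: a_ac\<close>)
qed (auto simp: l_distr r_distr m_assoc)

lemma (in cring) finsum_matrix_swap:
  assumes "finite I" "finite J" "c \<in> I \<rightarrow> carrier R" "d \<in> J \<rightarrow> carrier R"
    and "\<And>i j. i \<in> I \<Longrightarrow> j \<in> J \<Longrightarrow> A i j \<in> carrier R"
  shows "(\<Oplus>j\<in>J. (\<Oplus>i\<in>I. c i \<otimes> A i j) \<otimes> d j) = (\<Oplus>i\<in>I. c i \<otimes> (\<Oplus>j\<in>J. A i j \<otimes> d j))"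
  using module.comb_comb[OF module_regular_module, of I J c A d] assms by simp

text \<open>Says that the images of the family form a basis of \<open>M\<^sub>P\<close>, without localizing: a coefficient killed by an element
  outside \<open>P\<close> is one that vanishes in \<open>R\<^sub>P\<close>.\<close>

definition basis_at ::
    "('a, 'k) ring_scheme \<Rightarrow> ('a, 'b, 'm) module_scheme \<Rightarrow> 'a set \<Rightarrow> 'i set \<Rightarrow> ('i \<Rightarrow> 'b) \<Rightarrow> bool" where
  "basis_at R M P I e \<longleftrightarrow> finite I \<and> e \<in> I \<rightarrow> carrier M \<and> spans_at R M P I e \<and>
     (\<forall>c\<in>relations R M I e. \<forall>i\<in>I. \<exists>v\<in>carrier R - P. v \<otimes>\<^bsub>R\<^esub> c i = \<zero>\<^bsub>R\<^esub>)"

lemma (in module) spans_at_common_denominator: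
  assumes P: "primeideal P R" and "spans_at R M P J e" "finite J" "e \<in> J \<rightarrow> carrier M"
    and "finite B" "f \<in> B \<rightarrow> carrier M"
  obtains u A where "u \<in> carrier R - P" "\<And>b. b \<in> B \<Longrightarrow> A b \<in> J \<rightarrow> carrier R"
    "\<And>b. b \<in> B \<Longrightarrow> u \<cdot> f b = (\<Oplus>\<^bsub>M\<^esub>j\<in>J. A b j \<cdot> e j)"
proof -
  let ?Q = "\<lambda>b u. \<exists>a\<in>J \<rightarrow> carrier R. u \<cdot> f b = (\<Oplus>\<^bsub>M\<^esub>j\<in>J. a j \<cdot> e j)"
  have "\<exists>u\<in>carrier R - P. \<forall>b\<in>B. ?Q b u"
  proof (rule R.common_multiplier[OF P assms(5)])
    fix b assume "b \<in> B"
    then have "f b \<in> carrier M" using assms(6) by auto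
    then show "\<exists>u\<in>carrier R - P. ?Q b u" using assms(2) by (auto simp: spans_at_def)
  next
    fix b u v assume *: "b \<in> B" "u \<in> carrier R - P" "v \<in> carrier R - P" "?Q b u"
    then obtain a where a: "a \<in> J \<rightarrow> carrier R" "u \<cdot> f b = (\<Oplus>\<^bsub>M\<^esub>j\<in>J. a j \<cdot> e j)" by auto
    have "f b \<in> carrier M" using assms(6) * by auto
    then have "(v \<otimes> u) \<cdot> f b = v \<cdot> (\<Oplus>\<^bsub>M\<^esub>j\<in>J. a j \<cdot> e j)"
      using * a(2) by (simp add: smult_assoc1)
    also have "\<dots> = (\<Oplus>\<^bsub>M\<^esub>j\<in>J. (v \<otimes> a j) \<cdot> e j)"
      by (rule comb_smult[symmetric]) (use assms a * in auto)
    finally show "?Q b (v \<otimes> u)" by (intro bexI[of _ "\<lambda>j. v \<otimes> a j"]) (use a(1) *(3) in auto)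
  qed
  then obtain u where u: "u \<in> carrier R - P" "\<forall>b\<in>B. ?Q b u" by blast
  from u(2) have "\<exists>A. \<forall>b\<in>B. A b \<in> J \<rightarrow> carrier R \<and> u \<cdot> f b = (\<Oplus>\<^bsub>M\<^esub>j\<in>J. A b j \<cdot> e j)"
    by (intro bchoice) auto
  then obtain A where "\<forall>b\<in>B. A b \<in> J \<rightarrow> carrier R \<and> u \<cdot> f b = (\<Oplus>\<^bsub>M\<^esub>j\<in>J. A b j \<cdot> e j)" ..
  with u(1) that show ?thesis by auto
qed

text \<open>A nonzero relation has a multiple \<open>d\<close> whose annihilator is an associated prime \<open>P\<close> of the ring. Let the matrices
  \<open>A\<close> and \<open>C\<close> express the generators by a basis at \<open>P\<close> and vice versa. The rows of \<open>A C\<close> differ from those of a scalar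
  matrix \<open>v u\<close>, \<open>v u \<notin> P\<close>, by relations, whose entries lie in \<open>P\<close> and therefore kill \<open>d\<close>. So \<open>d A C = v u d\<close>. But \<open>d A\<close>
  is a relation of the basis, so it is killed by an element \<open>w \<notin> P\<close>, and \<open>w v u\<close> would annihilate \<open>d\<close>.\<close>

lemma (in noetherian_local_module) relations_trivial:
  fixes f :: "'i \<Rightarrow> 'c" and J :: "'j set"
  assumes B: "finite B" "f \<in> B \<rightarrow> carrier M"
    and span: "\<And>P. P \<in> associated_primes R (regular_module R) \<Longrightarrow> spans_at R M P B f"
    and rel: "\<And>P c b. P \<in> associated_primes R (regular_module R) \<Longrightarrow> c \<in> relations R M B f \<Longrightarrow> b \<in> B \<Longrightarrow> c b \<in> P"
    and basis: "\<And>P. P \<in> associated_primes R (regular_module R) \<Longrightarrow> \<exists>e. basis_at R M P J e"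
    and c: "c \<in> relations R M B f" and b: "b \<in> B"
  shows "c b = \<zero>"
proof (rule ccontr)
  assume nz: "c b \<noteq> \<zero>"
  have cR: "c \<in> B \<rightarrow> carrier R" and c0: "(\<Oplus>\<^bsub>M\<^esub>i\<in>B. c i \<cdot> f i) = \<zero>\<^bsub>M\<^esub>" using c by (auto simp: relations_def)
  from ex_multiple_with_prime_annihilator[OF B(1) cR] nz b obtain z b0 where z: "z \<in> carrier R" "b0 \<in> B"
    and ass: "annihilator R B (\<lambda>b. z \<otimes> c b) \<in> associated_primes R (regular_module R)"
    and ann: "annihilator R B (\<lambda>b. z \<otimes> c b) = annihilator R {b0} (\<lambda>b. z \<otimes> c b)" by blast
  define P where "P = annihilator R B (\<lambda>b. z \<otimes> c b)"
  define d where "d = (\<lambda>b. z \<otimes> c b)"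
  have P: "primeideal P R" using ass by (auto simp: P_def associated_primes_def)
  note prime = R.primeideal_complement_mult[OF P]
  have dR: "d \<in> B \<rightarrow> carrier R" using cR z by (auto simp: d_def)
  have d0: "(\<Oplus>\<^bsub>M\<^esub>i\<in>B. d i \<cdot> f i) = \<zero>\<^bsub>M\<^esub>"
    unfolding d_def using comb_smult[OF B(1) z(1) cR B(2)] c0 z by simp
  have Pd: "r \<otimes> d b = \<zero>" if "r \<in> P" "b \<in> B" for r b using that by (auto simp: P_def annihilator_def d_def)
  have notP: "r \<otimes> d b0 \<noteq> \<zero>" if "r \<in> carrier R - P" for r
    using that ann by (auto simp: P_def annihilator_def d_def)
  from basis[OF ass] obtain e where e: "finite J" "e \<in> J \<rightarrow> carrier M" "spans_at R M P J e"
    and erel: "\<And>c j. c \<in> relations R M J e \<Longrightarrow> j \<in> J \<Longrightarrow> \<exists>v\<in>carrier R - P. v \<otimes> c j = \<zero>"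
    by (auto simp: basis_at_def P_def)
  have Bspan: "spans_at R M P B f" using span[OF ass] by (simp add: P_def)
  obtain u A where u: "u \<in> carrier R - P" and A: "\<And>b. b \<in> B \<Longrightarrow> A b \<in> J \<rightarrow> carrier R"
    and uf: "\<And>b. b \<in> B \<Longrightarrow> u \<cdot> f b = (\<Oplus>\<^bsub>M\<^esub>j\<in>J. A b j \<cdot> e j)"
    by (rule spans_at_common_denominator[OF P e(3,1,2) B]) blast
  obtain v C where v: "v \<in> carrier R - P" and C: "\<And>j. j \<in> J \<Longrightarrow> C j \<in> B \<rightarrow> carrier R"
    and ve: "\<And>j. j \<in> J \<Longrightarrow> v \<cdot> e j = (\<Oplus>\<^bsub>M\<^esub>b\<in>B. C j b \<cdot> f b)"
    by (rule spans_at_common_denominator[OF P Bspan B e(1,2)]) blast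
  have AR: "A b j \<in> carrier R" if "b \<in> B" "j \<in> J" for b j using A[OF that(1)] that(2) by auto
  have CR: "C j b \<in> carrier R" if "b \<in> B" "j \<in> J" for b j using C[OF that(2)] that(1) by auto
  have fM: "f b \<in> carrier M" if "b \<in> B" for b using B that by auto
  have eM: "e j \<in> carrier M" if "j \<in> J" for j using e that by auto
  have uR: "u \<in> carrier R" and vR: "v \<in> carrier R" using u v by auto
  let ?AC = "\<lambda>b b'. \<Oplus>j\<in>J. A b j \<otimes> C j b'"
  have ACR: "?AC b b' \<in> carrier R" if "b \<in> B" "b' \<in> B" for b b'
    by (rule R.finsum_closed) (use AR CR that in auto)
  have eq: "d b \<otimes> ?AC b b' = d b \<otimes> (if b' = b then v \<otimes> u else \<zero>)" if bb: "b \<in> B" "b' \<in> B" for b b'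
  proof -
    have "(\<Oplus>\<^bsub>M\<^esub>b'\<in>B. ?AC b b' \<cdot> f b') = (\<Oplus>\<^bsub>M\<^esub>j\<in>J. A b j \<cdot> (\<Oplus>\<^bsub>M\<^esub>b'\<in>B. C j b' \<cdot> f b'))"
      by (rule comb_comb[symmetric]) (use e B A[OF bb(1)] CR in auto)
    also have "\<dots> = (\<Oplus>\<^bsub>M\<^esub>j\<in>J. A b j \<cdot> (v \<cdot> e j))"
      by (rule M.finsum_cong') (use ve[symmetric] AR bb vR eM in auto)
    also have "\<dots> = (\<Oplus>\<^bsub>M\<^esub>j\<in>J. (v \<otimes> A b j) \<cdot> e j)"
      by (rule M.finsum_cong') (use AR bb vR eM in \<open>auto simp: smult_assoc1[symmetric] R.m_comm\<close>)
    also have "\<dots> = v \<cdot> (u \<cdot> f b)"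
      unfolding uf[OF bb(1)] by (rule comb_smult) (use e vR A bb in auto)
    also have "\<dots> = (v \<otimes> u) \<cdot> f b" using uR vR fM bb by (simp add: smult_assoc1)
    finally have 1: "(\<Oplus>\<^bsub>M\<^esub>b'\<in>B. ?AC b b' \<cdot> f b') = (v \<otimes> u) \<cdot> f b" .
    let ?r = "\<lambda>b'. ?AC b b' \<ominus> (if b' = b then v \<otimes> u else \<zero>)"
    have "(\<Oplus>\<^bsub>M\<^esub>b'\<in>B. ?r b' \<cdot> f b')
      = (\<Oplus>\<^bsub>M\<^esub>b'\<in>B. ?AC b b' \<cdot> f b') \<ominus>\<^bsub>M\<^esub> (\<Oplus>\<^bsub>M\<^esub>b'\<in>B. (if b' = b then v \<otimes> u else \<zero>) \<cdot> f b')"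
      by (rule comb_diff) (use B ACR bb uR vR in auto)
    also have "\<dots> = \<zero>\<^bsub>M\<^esub>"
      unfolding 1 using comb_delta[OF B(1) bb(1) _ B(2), of "v \<otimes> u"] uR vR fM[OF bb(1)]
      by (simp add: M.minus_eq M.r_neg)
    finally have "?r \<in> relations R M B f" using ACR[OF bb(1)] uR vR by (auto simp: relations_def)
    from rel[OF ass this bb(2)] have "?r b' \<in> P" by (simp add: P_def)
    from Pd[OF this bb(1)] have rd: "?r b' \<otimes> d b = \<zero>" .
    have cancel: "x \<otimes> d b = y \<otimes> d b" if "(x \<ominus> y) \<otimes> d b = \<zero>" "x \<in> carrier R" "y \<in> carrier R" for x y
    proof -
      have db: "d b \<in> carrier R" using dR bb by auto
      have "x \<otimes> d b \<ominus> y \<otimes> d b = \<zero>" using that db by (simp add: R.minus_eq R.l_distr R.l_minus)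
      then show ?thesis using that db by simp
    qed
    have "?AC b b' \<otimes> d b = (if b' = b then v \<otimes> u else \<zero>) \<otimes> d b"
      by (rule cancel[OF rd ACR[OF bb]]) (use uR vR in auto)
    then show ?thesis using ACR[OF bb] uR vR dR bb by (subst (1 2) R.m_comm) auto
  qed
  let ?g = "\<lambda>j. \<Oplus>b\<in>B. d b \<otimes> A b j"
  have gR: "?g j \<in> carrier R" if "j \<in> J" for j by (rule R.finsum_closed) (use dR AR that in auto)
  have "(\<Oplus>\<^bsub>M\<^esub>j\<in>J. ?g j \<cdot> e j) = (\<Oplus>\<^bsub>M\<^esub>b\<in>B. d b \<cdot> (\<Oplus>\<^bsub>M\<^esub>j\<in>J. A b j \<cdot> e j))"
    by (rule comb_comb[symmetric]) (use e B dR AR in auto)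
  also have "\<dots> = (\<Oplus>\<^bsub>M\<^esub>b\<in>B. (u \<otimes> d b) \<cdot> f b)"
    by (rule M.finsum_cong') (use uf[symmetric] dR uR fM in \<open>auto simp: smult_assoc1[symmetric] R.m_comm Pi_iff\<close>)
  also have "\<dots> = u \<cdot> \<zero>\<^bsub>M\<^esub>" unfolding d0[symmetric] by (rule comb_smult) (use B uR dR in auto)
  finally have "?g \<in> relations R M J e" using gR uR by (auto simp: relations_def)
  from erel[OF this] have "\<exists>w\<in>carrier R - P. \<forall>j\<in>J. w \<otimes> ?g j = \<zero>"
  proof (intro common_multiplier[OF P e(1)])
    fix j u v assume "j \<in> J" "u \<in> carrier R - P" "v \<in> carrier R - P" "u \<otimes> ?g j = \<zero>"
    then show "(v \<otimes> u) \<otimes> ?g j = \<zero>" using gR[of j] by (simp add: R.m_assoc)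
  qed auto
  then obtain w where w: "w \<in> carrier R - P" "\<And>j. j \<in> J \<Longrightarrow> w \<otimes> ?g j = \<zero>" by auto
  have "(\<Oplus>j\<in>J. ?g j \<otimes> C j b0) = (\<Oplus>b\<in>B. d b \<otimes> ?AC b b0)"
    by (rule R.finsum_matrix_swap) (use e B dR AR CR z in auto)
  also have "\<dots> = (\<Oplus>b\<in>B. if b0 = b then d b \<otimes> (v \<otimes> u) else \<zero>)"
    by (rule R.finsum_cong') (use eq z dR uR vR in \<open>auto simp: Pi_iff\<close>)
  also have "\<dots> = d b0 \<otimes> (v \<otimes> u)"
    by (rule R.add.finprod_singleton) (use z B dR uR vR in auto)
  finally have "w \<otimes> (d b0 \<otimes> (v \<otimes> u)) = w \<otimes> (\<Oplus>j\<in>J. ?g j \<otimes> C j b0)" by simp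
  also have "\<dots> = (\<Oplus>j\<in>J. w \<otimes> (?g j \<otimes> C j b0))"
    by (rule R.finsum_rdistr) (use e w gR CR z in auto)
  also have "\<dots> = \<zero>"
  proof (rule R.add.finprod_one_eqI)
    fix j assume j: "j \<in> J"
    have "w \<otimes> (?g j \<otimes> C j b0) = (w \<otimes> ?g j) \<otimes> C j b0"
      using w(1) gR[OF j] CR[OF z(2) j] by (simp add: R.m_assoc)
    then show "w \<otimes> (?g j \<otimes> C j b0) = \<zero>\<^bsub>R\<^esub>" using w(2)[OF j] CR[OF z(2) j] by simp
  qed
  finally have "(w \<otimes> (v \<otimes> u)) \<otimes> d b0 = \<zero>" using w(1) uR vR dR z(2) by (simp add: R.m_ac Pi_iff)
  with notP[OF prime[OF w(1) prime[OF v u]]] show False by simp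
qed

section \<open>Bases at an associated prime from the rank\<close>

context module
begin

context
  fixes P assumes P: "primeideal P R"
begin

lemma fraction_self: "m \<in> carrier M \<Longrightarrow> s \<in> carrier R - P \<Longrightarrow> (m, s) \<in> fraction R P M m s"
  using R.one_notin_primeideal[OF P] by (auto simp: fraction_def)

lemma fraction_eq_iff:
  assumes "m \<in> carrier M" "s \<in> carrier R - P" "n \<in> carrier M" "t \<in> carrier R - P"
  shows "fraction R P M m s = fraction R P M n t \<longleftrightarrow>
    (\<exists>u\<in>carrier R - P. u \<cdot> (t \<cdot> m) = u \<cdot> (s \<cdot> n))" (is "_ \<longleftrightarrow> ?E m s n t")
proof
  assume "fraction R P M m s = fraction R P M n t"
  with fraction_self[OF assms(3,4)] have "(n, t) \<in> fraction R P M m s" by simp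
  then show "?E m s n t" by (auto simp: fraction_def)
next
  have trans: "?E m s n t" if mn: "m \<in> carrier M" "s \<in> carrier R - P" "k \<in> carrier M" "r \<in> carrier R - P"
    "n \<in> carrier M" "t \<in> carrier R - P" "?E m s k r" "?E k r n t" for m s k r n t
  proof -
    from mn obtain u v where u: "u \<in> carrier R - P" "u \<cdot> (r \<cdot> m) = u \<cdot> (s \<cdot> k)"
      and v: "v \<in> carrier R - P" "v \<cdot> (t \<cdot> k) = v \<cdot> (r \<cdot> n)" by blast
    have R: "s \<in> carrier R" "r \<in> carrier R" "t \<in> carrier R" "u \<in> carrier R" "v \<in> carrier R"
      using mn u v by auto
    have "(u \<otimes> v \<otimes> r) \<cdot> (t \<cdot> m) = (v \<otimes> t) \<cdot> (u \<cdot> (r \<cdot> m))"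
      using R mn by (simp add: smult_assoc1[symmetric] R.m_ac)
    also have "\<dots> = (u \<otimes> s) \<cdot> (v \<cdot> (t \<cdot> k))"
      unfolding u(2) using R mn by (simp add: smult_assoc1[symmetric] R.m_ac)
    also have "\<dots> = (u \<otimes> v \<otimes> r) \<cdot> (s \<cdot> n)"
      unfolding v(2) using R mn by (simp add: smult_assoc1[symmetric] R.m_ac)
    finally show ?thesis
      by (intro bexI[of _ "u \<otimes> v \<otimes> r"] R.primeideal_complement_mult[OF P]) (use u v mn in auto)
  qed
  have sym: "?E n t m s" if "?E m s n t" for m s n t using that by metis
  assume E: "?E m s n t"
  show "fraction R P M m s = fraction R P M n t"
    unfolding fraction_def using trans[of m s n t] trans[of n t m s] E sym[OF E] assms by blast
qed

lemma fraction_members: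
  assumes "(n, t) \<in> fraction R P M m s"
  shows "n \<in> carrier M" "t \<in> carrier R - P" "\<exists>u\<in>carrier R - P. u \<cdot> (t \<cdot> m) = u \<cdot> (s \<cdot> n)"
  using assms by (auto simp: fraction_def)

lemma UN_fractions_const:
  assumes "(a0, s0) \<in> X" "(m0, t0) \<in> Y"
    and "\<And>a s m t. (a, s) \<in> X \<Longrightarrow> (m, t) \<in> Y \<Longrightarrow> F a s m t = C"
  shows "(\<Union>(a, s)\<in>X. \<Union>(m, t)\<in>Y. F a s m t) = C"
  using assms by fastforce

lemma loc_smult_fraction:
  assumes a: "a \<in> carrier R" "s \<in> carrier R - P" and m: "m \<in> carrier M" "t \<in> carrier R - P"
  shows "fraction R P (regular_module R) a s \<odot>\<^bsub>loc_module R P M\<^esub> fraction R P M m t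
    = fraction R P M (a \<cdot> m) (s \<otimes> t)"
proof -
  interpret Reg: module R "regular_module R" by (rule R.module_regular_module)
  have "(\<Union>(b, s')\<in>fraction R P (regular_module R) a s. \<Union>(n, t')\<in>fraction R P M m t.
      fraction R P M (b \<cdot> n) (s' \<otimes> t')) = fraction R P M (a \<cdot> m) (s \<otimes> t)"
  proof (rule UN_fractions_const)
    show "(a, s) \<in> fraction R P (regular_module R) a s" using Reg.fraction_self[OF P] a by simp
    show "(m, t) \<in> fraction R P M m t" by (rule fraction_self[OF m])
    fix b s' n t' assume b: "(b, s') \<in> fraction R P (regular_module R) a s" and n: "(n, t') \<in> fraction R P M m t"
    from Reg.fraction_members[OF P b] obtain u where u: "u \<in> carrier R - P" "u \<otimes> (s' \<otimes> a) = u \<otimes> (s \<otimes> b)"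
      and bs: "b \<in> carrier R" "s' \<in> carrier R - P" by auto
    from fraction_members[OF n] obtain v where v: "v \<in> carrier R - P" "v \<cdot> (t' \<cdot> m) = v \<cdot> (t \<cdot> n)"
      and nt: "n \<in> carrier M" "t' \<in> carrier R - P" by auto
    have R: "s \<in> carrier R" "t \<in> carrier R" "s' \<in> carrier R" "t' \<in> carrier R" "u \<in> carrier R" "v \<in> carrier R"
      using a m bs nt u v by auto
    have "(u \<otimes> v) \<cdot> ((s \<otimes> t) \<cdot> (b \<cdot> n)) = (u \<otimes> (s \<otimes> b)) \<cdot> (v \<cdot> (t \<cdot> n))"
      using R bs nt by (simp add: smult_assoc1[symmetric] R.m_ac)
    also have "\<dots> = (u \<otimes> v) \<cdot> ((s' \<otimes> t') \<cdot> (a \<cdot> m))"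
      unfolding u(2)[symmetric] v(2)[symmetric] using R a m by (simp add: smult_assoc1[symmetric] R.m_ac)
    finally show "fraction R P M (b \<cdot> n) (s' \<otimes> t') = fraction R P M (a \<cdot> m) (s \<otimes> t)"
      by (subst fraction_eq_iff) (use R.primeideal_complement_mult[OF P] u v a m bs nt in auto)
  qed
  then show ?thesis by (simp add: loc_module_def)
qed

lemma loc_add_fraction:
  assumes m: "m \<in> carrier M" "s \<in> carrier R - P" and n: "n \<in> carrier M" "t \<in> carrier R - P"
  shows "fraction R P M m s \<oplus>\<^bsub>loc_module R P M\<^esub> fraction R P M n t
    = fraction R P M (t \<cdot> m \<oplus>\<^bsub>M\<^esub> s \<cdot> n) (s \<otimes> t)"
proof -
  have "(\<Union>(m', s')\<in>fraction R P M m s. \<Union>(n', t')\<in>fraction R P M n t.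
      fraction R P M (t' \<cdot> m' \<oplus>\<^bsub>M\<^esub> s' \<cdot> n') (s' \<otimes> t'))
    = fraction R P M (t \<cdot> m \<oplus>\<^bsub>M\<^esub> s \<cdot> n) (s \<otimes> t)"
  proof (rule UN_fractions_const)
    show "(m, s) \<in> fraction R P M m s" by (rule fraction_self[OF m])
    show "(n, t) \<in> fraction R P M n t" by (rule fraction_self[OF n])
    fix m' s' n' t' assume m': "(m', s') \<in> fraction R P M m s" and n': "(n', t') \<in> fraction R P M n t"
    from fraction_members[OF m'] obtain u where u: "u \<in> carrier R - P" "u \<cdot> (s' \<cdot> m) = u \<cdot> (s \<cdot> m')"
      and ms: "m' \<in> carrier M" "s' \<in> carrier R - P" by auto
    from fraction_members[OF n'] obtain v where v: "v \<in> carrier R - P" "v \<cdot> (t' \<cdot> n) = v \<cdot> (t \<cdot> n')"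
      and nt: "n' \<in> carrier M" "t' \<in> carrier R - P" by auto
    have R: "s \<in> carrier R" "t \<in> carrier R" "s' \<in> carrier R" "t' \<in> carrier R" "u \<in> carrier R" "v \<in> carrier R"
      using m n ms nt u v by auto
    have "(u \<otimes> v) \<cdot> ((s \<otimes> t) \<cdot> (t' \<cdot> m' \<oplus>\<^bsub>M\<^esub> s' \<cdot> n'))
      = (v \<otimes> t \<otimes> t') \<cdot> (u \<cdot> (s \<cdot> m')) \<oplus>\<^bsub>M\<^esub> (u \<otimes> s \<otimes> s') \<cdot> (v \<cdot> (t \<cdot> n'))"
      using R ms nt by (simp add: smult_r_distr smult_assoc1[symmetric] R.m_ac)
    also have "\<dots> = (u \<otimes> v) \<cdot> ((s' \<otimes> t') \<cdot> (t \<cdot> m \<oplus>\<^bsub>M\<^esub> s \<cdot> n))"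
      unfolding u(2)[symmetric] v(2)[symmetric]
      using R m n by (simp add: smult_r_distr smult_assoc1[symmetric] R.m_ac)
    finally show "fraction R P M (t' \<cdot> m' \<oplus>\<^bsub>M\<^esub> s' \<cdot> n') (s' \<otimes> t')
      = fraction R P M (t \<cdot> m \<oplus>\<^bsub>M\<^esub> s \<cdot> n) (s \<otimes> t)"
      by (subst fraction_eq_iff) (use R.primeideal_complement_mult[OF P] u v m n ms nt in auto)
  qed
  then show ?thesis by (simp add: loc_module_def)
qed

end

text \<open>The family consists of the numerators \<open>e\<^sub>i\<close> of the preimages \<open>e\<^sub>i / s\<^sub>i\<close> of the unit vectors, so \<open>e\<^sub>i / 1\<close> is sent to
  \<open>s\<^sub>i\<close> times a unit vector and coefficients can be read off coordinatewise.\<close>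

lemma basis_at_if_loc_free:
  assumes P: "primeideal P R"
    and iso: "mod_isomorphic (loc_ring R P) (loc_module R P M) (free_module (loc_ring R P) {..<r::nat})"
  shows "\<exists>e. basis_at R M P {..<r} e"
proof -
  interpret Reg: module R "regular_module R" by (rule R.module_regular_module)
  let ?L = "loc_ring R P" and ?F = "fraction R P (regular_module R)" and ?G = "fraction R P M"
  let ?N = "free_module ?L {..<r}"
  note one = R.one_notin_primeideal[OF P] and prime = R.primeideal_complement_mult[OF P]
  have L_car: "carrier ?L = {?F a s | a s. a \<in> carrier R \<and> s \<in> carrier R - P}"
    by (simp add: loc_ring_def loc_module_def Let_def)
  have L_mult: "?F a s \<otimes>\<^bsub>?L\<^esub> ?F b t = ?F (a \<otimes> b) (s \<otimes> t)"
    if "a \<in> carrier R" "s \<in> carrier R - P" "b \<in> carrier R" "t \<in> carrier R - P" for a s b t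
    using Reg.loc_smult_fraction[OF P, of a s b t] that by (simp add: loc_ring_def Let_def)
  have L_add: "?F a s \<oplus>\<^bsub>?L\<^esub> ?F b t = ?F (t \<otimes> a \<oplus> s \<otimes> b) (s \<otimes> t)"
    if "a \<in> carrier R" "s \<in> carrier R - P" "b \<in> carrier R" "t \<in> carrier R - P" for a s b t
    using Reg.loc_add_fraction[OF P, of a s b t] that by (simp add: loc_ring_def Let_def)
  have L_zero: "\<zero>\<^bsub>?L\<^esub> = ?F \<zero> \<one>" and L_one: "\<one>\<^bsub>?L\<^esub> = ?F \<one> \<one>"
    by (simp_all add: loc_ring_def loc_module_def Let_def)
  have F_eq: "?F a s = ?F b t \<longleftrightarrow> (\<exists>u\<in>carrier R - P. u \<otimes> (t \<otimes> a) = u \<otimes> (s \<otimes> b))"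
    if "a \<in> carrier R" "s \<in> carrier R - P" "b \<in> carrier R" "t \<in> carrier R - P" for a s b t
    using Reg.fraction_eq_iff[OF P, of a s b t] that by simp
  have G_car: "?G m s \<in> carrier (loc_module R P M)" if "m \<in> carrier M" "s \<in> carrier R - P" for m s
    using that by (auto simp: loc_module_def)
  from iso obtain h where h: "h \<in> mod_hom ?L (loc_module R P M) ?N"
    and bij: "bij_betw h (carrier (loc_module R P M)) (carrier ?N)" by (auto simp: mod_isomorphic_def)
  \<comment> \<open>\<open>H y\<close> is the coordinate vector of \<open>y / 1\<close>.\<close>
  define H where "H y = h (?G y \<one>)" for y
  have H_car: "H y \<in> carrier ?N" if "y \<in> carrier M" for y
    unfolding H_def by (rule mod_homD(1)[OF h G_car[OF that one]])
  have H_frac: "\<exists>a s. a \<in> carrier R \<and> s \<in> carrier R - P \<and> H y j = ?F a s" if "y \<in> carrier M" for y j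
  proof -
    have "range (H y) \<subseteq> carrier ?L" using H_car[OF that] by (simp add: free_module_def)
    then have "H y j \<in> carrier ?L" by auto
    then show ?thesis using L_car by auto
  qed
  have H_out: "H y j = \<zero>\<^bsub>?L\<^esub>" if "y \<in> carrier M" "j \<ge> r" for y j
    using H_car[OF that(1)] that(2) by (auto simp: free_module_def)
  have H_add: "H (y \<oplus>\<^bsub>M\<^esub> z) j = H y j \<oplus>\<^bsub>?L\<^esub> H z j" if "y \<in> carrier M" "z \<in> carrier M" for y z j
  proof -
    have "?G (y \<oplus>\<^bsub>M\<^esub> z) \<one> = ?G y \<one> \<oplus>\<^bsub>loc_module R P M\<^esub> ?G z \<one>"
      using loc_add_fraction[OF P that(1) one that(2) one] that by simp
    then show ?thesis
      unfolding H_def using mod_homD(2)[OF h G_car[OF that(1) one] G_car[OF that(2) one]]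
      by (simp add: free_module_def)
  qed
  have h_smult: "h (?G (a \<cdot> y) t) j = ?F a \<one> \<otimes>\<^bsub>?L\<^esub> h (?G y t) j"
    if "a \<in> carrier R" "y \<in> carrier M" "t \<in> carrier R - P" for a y t j
  proof -
    have "?G (a \<cdot> y) t = ?F a \<one> \<odot>\<^bsub>loc_module R P M\<^esub> ?G y t"
      using loc_smult_fraction[OF P that(1) one that(2,3)] that by simp
    moreover have "?F a \<one> \<in> carrier ?L" using that one L_car by auto
    ultimately show ?thesis
      using mod_homD(3)[OF h _ G_car[OF that(2,3)]] by (simp add: free_module_def)
  qed
  have H_smult: "H (a \<cdot> y) j = ?F a \<one> \<otimes>\<^bsub>?L\<^esub> H y j" if "a \<in> carrier R" "y \<in> carrier M" for a y j
    unfolding H_def by (rule h_smult[OF that one])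
  have H_inj: "\<exists>u\<in>carrier R - P. u \<cdot> y = u \<cdot> z"
    if "y \<in> carrier M" "z \<in> carrier M" "H y = H z" for y z
  proof -
    have "?G y \<one> = ?G z \<one>"
      using bij that G_car[OF _ one] unfolding H_def bij_betw_def inj_on_def by auto
    then show ?thesis using fraction_eq_iff[OF P that(1) one that(2) one] that by simp
  qed
  have "\<exists>e s. e \<in> carrier M \<and> s \<in> carrier R - P \<and> h (?G e s) = (\<lambda>j. if j = i then ?F \<one> \<one> else ?F \<zero> \<one>)"
    if i: "i < r" for i
  proof -
    let ?\<delta> = "\<lambda>j. if j = i then ?F \<one> \<one> else ?F \<zero> \<one>"
    have "?F \<one> \<one> \<in> carrier ?L" "?F \<zero> \<one> \<in> carrier ?L" using one L_car by auto
    moreover have "finite {j. ?\<delta> j \<noteq> ?F \<zero> \<one>}" by (rule finite_subset[of _ "{i}"]) auto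
    ultimately have "?\<delta> \<in> carrier ?N" using i by (auto simp: free_module_def L_zero)
    then obtain X where "X \<in> carrier (loc_module R P M)" "h X = ?\<delta>"
      using bij unfolding bij_betw_def by (metis (no_types, lifting) imageE)
    then show ?thesis by (auto simp: loc_module_def)
  qed
  then obtain e s where e: "\<And>i. i < r \<Longrightarrow> e i \<in> carrier M" and s: "\<And>i. i < r \<Longrightarrow> s i \<in> carrier R - P"
    and hes: "\<And>i. i < r \<Longrightarrow> h (?G (e i) (s i)) = (\<lambda>j. if j = i then ?F \<one> \<one> else ?F \<zero> \<one>)"
    by metis
  have He: "H (e i) j = (if j = i then ?F (s i) \<one> else ?F \<zero> \<one>)" if i: "i < r" for i j
  proof -
    have "?G (e i) \<one> = ?G (s i \<cdot> e i) (s i)"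
      by (subst fraction_eq_iff[OF P]) (use e[OF i] s[OF i] one in auto)
    then have "H (e i) j = ?F (s i) \<one> \<otimes>\<^bsub>?L\<^esub> (if j = i then ?F \<one> \<one> else ?F \<zero> \<one>)"
      unfolding H_def using h_smult[of "s i" "e i" "s i" j] s[OF i] e[OF i] hes[OF i] by simp
    then show ?thesis using L_mult s[OF i] one by auto
  qed
  have eM: "e \<in> S \<rightarrow> carrier M" if "S \<subseteq> {..<r}" for S using e that by auto
  have H0: "H \<zero>\<^bsub>M\<^esub> j = ?F \<zero> \<one>" for j
  proof -
    from H_frac[OF M.zero_closed, of j] obtain a t where a: "a \<in> carrier R" "t \<in> carrier R - P" "H \<zero>\<^bsub>M\<^esub> j = ?F a t" by auto
    have "H \<zero>\<^bsub>M\<^esub> j = ?F (\<zero> \<otimes> a) (\<one> \<otimes> t)"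
      using H_smult[of \<zero> "\<zero>\<^bsub>M\<^esub>" j] a one L_mult[of \<zero> \<one> a t] by simp
    also have "\<dots> = ?F \<zero> \<one>" using a one by (subst F_eq) auto
    finally show ?thesis .
  qed
  have H_comb: "H (\<Oplus>\<^bsub>M\<^esub>i\<in>S. c i \<cdot> e i) j = (if j \<in> S then ?F (c j \<otimes> s j) \<one> else ?F \<zero> \<one>)"
    if "finite S" "S \<subseteq> {..<r}" "c \<in> S \<rightarrow> carrier R" for S c j
    using that
  proof (induction S rule: finite_induct)
    case empty
    show ?case by (simp add: H0)
  next
    case (insert i S)
    have i: "i < r" and ci: "c i \<in> carrier R" and cS: "c \<in> S \<rightarrow> carrier R" using insert.prems by auto
    have si: "s i \<in> carrier R" using s[OF i] by auto
    have comb: "(\<Oplus>\<^bsub>M\<^esub>i\<in>insert i S. c i \<cdot> e i) = c i \<cdot> e i \<oplus>\<^bsub>M\<^esub> (\<Oplus>\<^bsub>M\<^esub>i\<in>S. c i \<cdot> e i)"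
      by (rule comb_insert) (use insert eM[of "insert i S"] in auto)
    have cl: "(\<Oplus>\<^bsub>M\<^esub>i\<in>S. c i \<cdot> e i) \<in> carrier M" by (rule comb_closed[OF cS eM]) (use insert.prems in auto)
    have "H (c i \<cdot> e i) j = (if j = i then ?F (c i \<otimes> s i) \<one> else ?F \<zero> \<one>)"
      using H_smult[OF ci e[OF i], of j] He[OF i, of j] L_mult[OF ci one si one] L_mult[OF ci one R.zero_closed one] ci
      by simp
    then have "H (\<Oplus>\<^bsub>M\<^esub>i\<in>insert i S. c i \<cdot> e i) j
      = (if j = i then ?F (c i \<otimes> s i) \<one> else ?F \<zero> \<one>) \<oplus>\<^bsub>?L\<^esub> (if j \<in> S then ?F (c j \<otimes> s j) \<one> else ?F \<zero> \<one>)"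
      unfolding comb using H_add[OF smult_closed[OF ci e[OF i]] cl, of j] insert.IH[OF _ cS] insert.prems by simp
    moreover have "c j \<otimes> s j \<in> carrier R" if "j \<in> insert i S" using that s insert.prems by auto
    ultimately show ?case using insert.hyps ci si one by (auto simp: L_add)
  qed
  have span: "spans_at R M P {..<r} e"
    unfolding spans_at_def
  proof
    fix y assume y: "y \<in> carrier M"
    let ?Q = "\<lambda>j u. \<exists>c\<in>carrier R. H (u \<cdot> y) j = ?F (c \<otimes> s j) \<one>"
    have "\<exists>u\<in>carrier R - P. \<forall>j\<in>{..<r}. ?Q j u"
    proof (rule R.common_multiplier[OF P])
      fix j assume "j \<in> {..<r}"
      then have sj: "s j \<in> carrier R - P" using s by auto
      from H_frac[OF y, of j] obtain a t where a: "a \<in> carrier R" "t \<in> carrier R - P" "H y j = ?F a t" by auto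
      have "H ((t \<otimes> s j) \<cdot> y) j = ?F (t \<otimes> s j \<otimes> a) (\<one> \<otimes> t)"
        using H_smult[OF _ y, of "t \<otimes> s j" j] L_mult[OF _ one a(1,2), of "t \<otimes> s j"] a sj by simp
      also have "\<dots> = ?F (a \<otimes> s j) \<one>"
        by (subst F_eq) (use a sj one prime in \<open>auto simp: R.m_ac intro!: bexI[of _ \<one>]\<close>)
      finally show "\<exists>u\<in>carrier R - P. ?Q j u" using a prime[OF a(2) sj] by blast
    next
      fix j u v assume *: "j \<in> {..<r}" "u \<in> carrier R - P" "v \<in> carrier R - P" "?Q j u"
      then obtain c where c: "c \<in> carrier R" "H (u \<cdot> y) j = ?F (c \<otimes> s j) \<one>" by auto
      have sj: "s j \<in> carrier R - P" using s * by auto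
      have "H ((v \<otimes> u) \<cdot> y) j = ?F v \<one> \<otimes>\<^bsub>?L\<^esub> ?F (c \<otimes> s j) \<one>"
        using H_smult[of v "u \<cdot> y" j] * c y by (simp add: smult_assoc1)
      also have "\<dots> = ?F ((v \<otimes> c) \<otimes> s j) \<one>"
        using L_mult[of v \<one> "c \<otimes> s j" \<one>] * c sj one by (simp add: R.m_assoc)
      finally show "?Q j (v \<otimes> u)" using * c by blast
    qed auto
    then obtain u where u: "u \<in> carrier R - P" "\<forall>j\<in>{..<r}. ?Q j u" by blast
    then obtain c where c: "\<And>j. j < r \<Longrightarrow> c j \<in> carrier R \<and> H (u \<cdot> y) j = ?F (c j \<otimes> s j) \<one>"
      by (metis lessThan_iff)
    have cR: "c \<in> {..<r} \<rightarrow> carrier R" using c by auto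
    let ?z = "\<Oplus>\<^bsub>M\<^esub>i\<in>{..<r}. c i \<cdot> e i"
    have z: "?z \<in> carrier M" by (rule comb_closed[OF cR eM]) auto
    have uy: "u \<cdot> y \<in> carrier M" using u y by auto
    have "H (u \<cdot> y) = H ?z"
    proof
      fix j
      show "H (u \<cdot> y) j = H ?z j"
        using H_comb[OF _ _ cR, of j] c[of j] H_out[OF uy, of j] L_zero by (cases "j < r") auto
    qed
    from H_inj[OF uy z this] obtain v where v: "v \<in> carrier R - P" "v \<cdot> (u \<cdot> y) = v \<cdot> ?z" by auto
    have "(v \<otimes> u) \<cdot> y = (\<Oplus>\<^bsub>M\<^esub>i\<in>{..<r}. (v \<otimes> c i) \<cdot> e i)"
      using v u y comb_smult[of "{..<r}" v c e] cR eM[of "{..<r}"] by (simp add: smult_assoc1)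
    moreover have "(\<lambda>i. v \<otimes> c i) \<in> {..<r} \<rightarrow> carrier R" using cR v by auto
    ultimately show "\<exists>u\<in>carrier R - P. \<exists>c\<in>{..<r} \<rightarrow> carrier R. u \<cdot> y = (\<Oplus>\<^bsub>M\<^esub>i\<in>{..<r}. c i \<cdot> e i)"
      by (intro bexI[of _ "v \<otimes> u"] bexI[of _ "\<lambda>i. v \<otimes> c i"] prime[OF v(1) u(1)])
  qed
  have "\<exists>v\<in>carrier R - P. v \<otimes> c i = \<zero>" if c: "c \<in> relations R M {..<r} e" and i: "i < r" for c i
  proof -
    have cR: "c \<in> {..<r} \<rightarrow> carrier R" using c by (auto simp: relations_def)
    then have ci: "c i \<in> carrier R" using i by auto
    have si: "s i \<in> carrier R - P" using s[OF i] .
    have "?F (c i \<otimes> s i) \<one> = ?F \<zero> \<one>"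
      using H_comb[OF _ _ cR, of i] c i H0[of i] by (auto simp: relations_def)
    then obtain u where "u \<in> carrier R - P" "u \<otimes> (\<one> \<otimes> (c i \<otimes> s i)) = u \<otimes> (\<one> \<otimes> \<zero>)"
      using F_eq[of "c i \<otimes> s i" \<one> \<zero> \<one>] ci si one by auto
    then have "(u \<otimes> s i) \<otimes> c i = \<zero>" "u \<otimes> s i \<in> carrier R - P"
      using ci si prime by (auto simp: R.m_ac)
    then show ?thesis by blast
  qed
  moreover have "e \<in> {..<r} \<rightarrow> carrier M" by (rule eM) simp
  ultimately have "basis_at R M P {..<r} e" using span by (simp add: basis_at_def)
  then show ?thesis by (intro exI[of _ e])
qed

end

section \<open>Extending homomorphisms from the first syzygy\<close>

text \<open>Extends \<^const>\<open>lincomb\<close> to arbitrary values \<open>v\<close> on the basis vectors, as needed for functionals with values in the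
  ring.\<close>

definition free_lift ::
    "('a, 'k) ring_scheme \<Rightarrow> ('a, 'b, 'm) module_scheme \<Rightarrow> ('s \<Rightarrow> 'b) \<Rightarrow> ('s \<Rightarrow> 'a) \<Rightarrow> 'b" where
  "free_lift R N v f = (\<Oplus>\<^bsub>N\<^esub>x\<in>{x. f x \<noteq> \<zero>\<^bsub>R\<^esub>}. f x \<odot>\<^bsub>N\<^esub> v x)"

definition unit_vector :: "('a, 'k) ring_scheme \<Rightarrow> 's \<Rightarrow> 's \<Rightarrow> 'a" where
  "unit_vector R x = (\<lambda>y. if y = x then \<one>\<^bsub>R\<^esub> else \<zero>\<^bsub>R\<^esub>)"

lemma lincomb_eq_free_lift: "lincomb R N = free_lift R N (\<lambda>x. x)"
  by (simp add: lincomb_def free_lift_def fun_eq_iff)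

lemma free_module_carrierD:
  assumes "f \<in> carrier (free_module R S)"
  shows "f x \<in> carrier R" "{x. f x \<noteq> \<zero>\<^bsub>R\<^esub>} \<subseteq> S" "finite {x. f x \<noteq> \<zero>\<^bsub>R\<^esub>}"
    and "y \<notin> S \<Longrightarrow> f y = \<zero>\<^bsub>R\<^esub>"
  using assms by (auto simp: free_module_def)

lemma (in cring) module_free_module: "module R (free_module R S)"
proof -
  let ?F = "free_module R S"
  have carI: "f \<in> carrier ?F"
    if "\<And>x. f x \<in> carrier R" "\<And>x. x \<notin> S \<Longrightarrow> f x = \<zero>" "finite A" "{x. f x \<noteq> \<zero>} \<subseteq> A" for f A
    using that finite_subset by (auto simp: free_module_def)
  have add: "(\<lambda>x. f x \<oplus> g x) \<in> carrier ?F" if "f \<in> carrier ?F" "g \<in> carrier ?F" for f g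
    by (rule carI[of _ "{x. f x \<noteq> \<zero>} \<union> {x. g x \<noteq> \<zero>}"])
      (use free_module_carrierD[OF that(1)] free_module_carrierD[OF that(2)] in auto)
  have smult: "(\<lambda>x. r \<otimes> f x) \<in> carrier ?F" if "r \<in> carrier R" "f \<in> carrier ?F" for r f
    by (rule carI[of _ "{x. f x \<noteq> \<zero>}"]) (use that(1) free_module_carrierD[OF that(2)] in auto)
  have car: "f x \<in> carrier R" if "f \<in> carrier ?F" for f x using free_module_carrierD[OF that] by auto
  have ops: "\<zero>\<^bsub>?F\<^esub> = (\<lambda>x. \<zero>)" "f \<oplus>\<^bsub>?F\<^esub> g = (\<lambda>x. f x \<oplus> g x)" "r \<odot>\<^bsub>?F\<^esub> f = (\<lambda>x. r \<otimes> f x)" for f g r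
    by (auto simp: free_module_def)
  have "abelian_group ?F"
  proof (rule abelian_groupI)
    show "\<zero>\<^bsub>?F\<^esub> \<in> carrier ?F" unfolding ops by (rule carI[of _ "{}"]) auto
    fix f assume f: "f \<in> carrier ?F"
    show "\<exists>g\<in>carrier ?F. g \<oplus>\<^bsub>?F\<^esub> f = \<zero>\<^bsub>?F\<^esub>"
    proof (rule bexI[of _ "\<lambda>x. \<ominus> f x"])
      show "(\<lambda>x. \<ominus> f x) \<in> carrier ?F"
        by (rule carI[of _ "{x. f x \<noteq> \<zero>}"]) (use free_module_carrierD[OF f] in auto)
      show "(\<lambda>x. \<ominus> f x) \<oplus>\<^bsub>?F\<^esub> f = \<zero>\<^bsub>?F\<^esub>" using car[OF f] by (simp add: ops l_neg)
    qed
  qed (use add car in \<open>auto simp: ops a_ac\<close>)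
  then show ?thesis
    by (rule moduleI[OF is_cring]) (use smult car in \<open>auto simp: ops l_distr r_distr m_assoc\<close>)
qed

lemma (in module) free_lift_eq_sum:
  assumes f: "f \<in> carrier (free_module R S)" and v: "v \<in> S \<rightarrow> carrier M"
    and A: "finite A" "A \<subseteq> S" "{x. f x \<noteq> \<zero>} \<subseteq> A"
  shows "free_lift R M v f = (\<Oplus>\<^bsub>M\<^esub>x\<in>A. f x \<cdot> v x)"
  unfolding free_lift_def
  by (rule M.add.finprod_mono_neutral_cong_left)
    (use A v free_module_carrierD[OF f] in \<open>auto simp: Pi_iff subset_iff\<close>)

lemma (in module) free_lift_hom:
  assumes v: "v \<in> S \<rightarrow> carrier M"
  shows "free_lift R M v \<in> mod_hom R (free_module R S) M"
proof (rule mod_homI)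
  let ?F = "free_module R S" and ?s = "\<lambda>f. {x. f x \<noteq> \<zero>}"
  interpret F: module R ?F by (rule R.module_free_module)
  fix f assume f: "f \<in> carrier ?F"
  note fD = free_module_carrierD[OF f]
  have vf: "v \<in> ?s f \<rightarrow> carrier M" using v fD by auto
  show "free_lift R M v f \<in> carrier M"
    unfolding free_lift_def by (rule comb_closed[OF _ vf]) (use fD in auto)
  { fix g assume g: "g \<in> carrier ?F"
    note gD = free_module_carrierD[OF g]
    let ?A = "?s f \<union> ?s g"
    have A: "finite ?A" "?A \<subseteq> S" using fD gD by auto
    have vA: "v \<in> ?A \<rightarrow> carrier M" using v A by auto
    have fg: "f \<oplus>\<^bsub>?F\<^esub> g = (\<lambda>x. f x \<oplus> g x)" by (simp add: free_module_def)
    have "free_lift R M v (f \<oplus>\<^bsub>?F\<^esub> g) = (\<Oplus>\<^bsub>M\<^esub>x\<in>?A. (f x \<oplus> g x) \<cdot> v x)"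
      unfolding fg by (rule free_lift_eq_sum[OF F.M.a_closed[OF f g, unfolded fg] v A]) (use fD gD in auto)
    also have "\<dots> = (\<Oplus>\<^bsub>M\<^esub>x\<in>?A. f x \<cdot> v x) \<oplus>\<^bsub>M\<^esub> (\<Oplus>\<^bsub>M\<^esub>x\<in>?A. g x \<cdot> v x)"
      by (rule comb_add[OF _ _ vA]) (use fD gD in auto)
    also have "\<dots> = free_lift R M v f \<oplus>\<^bsub>M\<^esub> free_lift R M v g"
      using free_lift_eq_sum[OF f v A] free_lift_eq_sum[OF g v A] by auto
    finally show "free_lift R M v (f \<oplus>\<^bsub>?F\<^esub> g) = free_lift R M v f \<oplus>\<^bsub>M\<^esub> free_lift R M v g" . }
  fix r assume r: "r \<in> carrier R"
  have rf: "r \<odot>\<^bsub>?F\<^esub> f = (\<lambda>x. r \<otimes> f x)" by (simp add: free_module_def)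
  have "free_lift R M v (r \<odot>\<^bsub>?F\<^esub> f) = (\<Oplus>\<^bsub>M\<^esub>x\<in>?s f. (r \<otimes> f x) \<cdot> v x)"
    unfolding rf by (rule free_lift_eq_sum[OF F.smult_closed[OF r f, unfolded rf] v fD(3,2)]) (use r in auto)
  also have "\<dots> = r \<cdot> free_lift R M v f"
    unfolding free_lift_def by (rule comb_smult) (use fD r vf in auto)
  finally show "free_lift R M v (r \<odot>\<^bsub>?F\<^esub> f) = r \<cdot> free_lift R M v f" .
qed

lemma (in cring) unit_vector_closed: "x \<in> S \<Longrightarrow> unit_vector R x \<in> carrier (free_module R S)"
  by (auto simp: free_module_def unit_vector_def intro: finite_subset[of _ "{x}"])

lemma (in module) free_lift_unit_vector:
  assumes "v \<in> S \<rightarrow> carrier M" "x \<in> S"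
  shows "free_lift R M v (unit_vector R x) = v x"
proof -
  have "free_lift R M v (unit_vector R x) = (\<Oplus>\<^bsub>M\<^esub>y\<in>{x}. unit_vector R x y \<cdot> v y)"
    by (rule free_lift_eq_sum[OF R.unit_vector_closed[OF assms(2)] assms(1)])
      (use assms in \<open>auto simp: unit_vector_def\<close>)
  also have "\<dots> = v x" using assms by (subst M.finsum_insert) (auto simp: unit_vector_def Pi_iff)
  finally show ?thesis .
qed

lemma (in module) lincomb_hom: "S \<subseteq> carrier M \<Longrightarrow> lincomb R M \<in> mod_hom R (free_module R S) M"
  unfolding lincomb_eq_free_lift by (rule free_lift_hom) auto

lemma (in module) lincomb_unit_vector: "S \<subseteq> carrier M \<Longrightarrow> x \<in> S \<Longrightarrow> lincomb R M (unit_vector R x) = x"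
  unfolding lincomb_eq_free_lift by (rule free_lift_unit_vector) auto

lemma (in module) lincomb_mem_submodule:
  assumes "submodule K R M" "f \<in> carrier (free_module R K)"
  shows "lincomb R M f \<in> K"
  unfolding lincomb_def
  by (rule submodule_comb[OF assms(1)]) (use free_module_carrierD[OF assms(2)] in auto)

lemma a_kernel_submodule:
  assumes "module R M" "module R N" "h \<in> mod_hom R M N"
  shows "submodule (a_kernel M N h) R M"
proof -
  interpret M: module R M by fact
  interpret N: module R N by fact
  show ?thesis
    by (rule M.submodule_if_closed)
      (use mod_homD[OF assms(3)] mod_hom_zero[OF assms] in \<open>auto simp: a_kernel_def'\<close>)
qed

lemma restrict_mem_hom_module:
  assumes "module R M" "h \<in> mod_hom R M N"
  shows "restrict h (carrier M) \<in> carrier (hom_module R M N)"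
proof -
  interpret M: module R M by fact
  have "restrict h (carrier M) \<in> mod_hom R M N"
    by (rule mod_homI) (use mod_homD[OF assms(2)] in auto)
  then show ?thesis by (simp add: hom_module_def)
qed

text \<open>Composed with \<open>F\<^sub>1 \<rightarrow> F\<^sub>0\<close>, the homomorphism \<open>\<kappa>\<close> on the kernel of \<open>F\<^sub>0 \<rightarrow> M\<close> becomes a cocycle. If this is
  the coboundary of \<open>\<psi>\<close>, then \<open>\<psi>\<close> extends \<open>\<kappa>\<close>, since \<open>F\<^sub>1\<close> maps onto that kernel.\<close>

lemma extend_from_syzygy_if_Ext1_trivial:
  fixes M :: "('a, 'b, 'm) module_scheme"
  assumes M: "module R M" and N: "module R N"
    and triv: "carrier (Ext1 R M N) = {\<zero>\<^bsub>Ext1 R M N\<^esub>}"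
    and \<kappa>: "\<kappa> \<in> mod_hom R ((res0 R M)\<lparr>carrier := a_kernel (res0 R M) M (lincomb R M)\<rparr>) N"
  obtains \<psi> where "\<psi> \<in> mod_hom R (res0 R M) N" "\<And>\<rho>. \<rho> \<in> a_kernel (res0 R M) M (lincomb R M) \<Longrightarrow> \<psi> \<rho> = \<kappa> \<rho>"
proof -
  interpret M: module R M by fact
  interpret N: module R N by fact
  let ?F0 = "res0 R M" and ?F1 = "res1 R M" and ?F2 = "res2 R M"
  let ?K = "a_kernel ?F0 M (lincomb R M)"
  let ?K1 = "a_kernel ?F1 ?F0 (lincomb R ?F0)"
  interpret F0: module R ?F0 unfolding res0_def by (rule M.R.module_free_module)
  interpret F1: module R ?F1 unfolding res1_def by (rule M.R.module_free_module)
  interpret F2: module R ?F2 unfolding res2_def by (rule M.R.module_free_module)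
  have d0: "lincomb R M \<in> mod_hom R ?F0 M" unfolding res0_def by (rule M.lincomb_hom) simp
  have K: "submodule ?K R ?F0" by (rule a_kernel_submodule[OF F0.module_axioms M d0])
  have KF0: "?K \<subseteq> carrier ?F0" by (rule F0.submoduleE(1)[OF K])
  have d1: "lincomb R ?F0 \<in> mod_hom R ?F1 ?F0" unfolding res1_def by (rule F0.lincomb_hom[OF KF0])
  have d1K: "lincomb R ?F0 x \<in> ?K" if "x \<in> carrier ?F1" for x
    by (rule F0.lincomb_mem_submodule[OF K]) (use that in \<open>simp add: res1_def\<close>)
  have K1: "submodule ?K1 R ?F1" by (rule a_kernel_submodule[OF F1.module_axioms F0.module_axioms d1])
  have d2K1: "lincomb R ?F1 x \<in> ?K1" if "x \<in> carrier ?F2" for x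
    by (rule F1.lincomb_mem_submodule[OF K1]) (use that in \<open>simp add: res2_def\<close>)
  have \<kappa>0: "\<kappa> \<zero>\<^bsub>?F0\<^esub> = \<zero>\<^bsub>N\<^esub>"
    using mod_hom_zero[OF submodule.submodule_is_module[OF K F0.module_axioms] N \<kappa>] by simp
  let ?H = "hom_module R ?F1 N"
  define Z where "Z = {\<phi> \<in> carrier ?H. \<forall>x\<in>carrier ?F2. \<phi> (lincomb R ?F1 x) = \<zero>\<^bsub>N\<^esub>}"
  define C where "C = {restrict (\<psi> \<circ> lincomb R ?F0) (carrier ?F1) | \<psi>. \<psi> \<in> carrier (hom_module R ?F0 N)}"
  have Ext: "Ext1 R M N = quotient_module (?H\<lparr>carrier := Z\<rparr>) C"
    by (simp add: Ext1_def Let_def Z_def C_def)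
  define \<phi> where "\<phi> = restrict (\<kappa> \<circ> lincomb R ?F0) (carrier ?F1)"
  have "\<kappa> \<circ> lincomb R ?F0 \<in> mod_hom R ?F1 N"
    by (rule mod_homI) (use mod_homD[OF \<kappa>] mod_homD[OF d1] d1K in auto)
  then have \<phi>H: "\<phi> \<in> carrier ?H"
    unfolding \<phi>_def by (rule restrict_mem_hom_module[OF F1.module_axioms])
  moreover have "\<phi> (lincomb R ?F1 x) = \<zero>\<^bsub>N\<^esub>" if "x \<in> carrier ?F2" for x
    using d2K1[OF that] \<kappa>0 by (auto simp: \<phi>_def a_kernel_def')
  ultimately have "\<phi> \<in> Z" by (simp add: Z_def)
  then have "r_coset (add_monoid (?H\<lparr>carrier := Z\<rparr>)) C \<phi> \<in> carrier (Ext1 R M N)"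
    by (auto simp: Ext quotient_module_def A_RCOSETS_def RCOSETS_def)
  then have "r_coset (add_monoid (?H\<lparr>carrier := Z\<rparr>)) C \<phi> = C"
    unfolding triv by (simp add: Ext quotient_module_def)
  then have coset: "c \<oplus>\<^bsub>?H\<^esub> \<phi> \<in> C" if "c \<in> C" for c
    using that by (auto simp: r_coset_def)
  \<comment> \<open>The zero map is a coboundary, so the coset of \<open>\<phi>\<close> contains \<open>\<phi>\<close>.\<close>
  have "(\<lambda>_. \<zero>\<^bsub>N\<^esub>) \<in> mod_hom R ?F0 N" by (rule mod_homI) auto
  from restrict_mem_hom_module[OF F0.module_axioms this]
  have "restrict (\<lambda>_. \<zero>\<^bsub>N\<^esub>) (carrier ?F0) \<in> carrier (hom_module R ?F0 N)" .
  then have "restrict (restrict (\<lambda>_. \<zero>\<^bsub>N\<^esub>) (carrier ?F0) \<circ> lincomb R ?F0) (carrier ?F1) \<in> C"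
    unfolding C_def by blast
  from coset[OF this] have "restrict (restrict (\<lambda>_. \<zero>\<^bsub>N\<^esub>) (carrier ?F0) \<circ> lincomb R ?F0) (carrier ?F1) \<oplus>\<^bsub>?H\<^esub> \<phi> \<in> C" .
  moreover have "restrict (restrict (\<lambda>_. \<zero>\<^bsub>N\<^esub>) (carrier ?F0) \<circ> lincomb R ?F0) (carrier ?F1) \<oplus>\<^bsub>?H\<^esub> \<phi> = \<phi>"
  proof
    fix x
    show "(restrict (restrict (\<lambda>_. \<zero>\<^bsub>N\<^esub>) (carrier ?F0) \<circ> lincomb R ?F0) (carrier ?F1) \<oplus>\<^bsub>?H\<^esub> \<phi>) x = \<phi> x"
      using \<phi>H mod_homD(1)[OF d1] mod_homD(1)[of \<phi> R ?F1 N x]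
      by (cases "x \<in> carrier ?F1") (auto simp: hom_module_def extensional_def)
  qed
  ultimately have "\<phi> \<in> C" by simp
  then obtain \<psi> where \<psi>: "\<psi> \<in> carrier (hom_module R ?F0 N)" "\<phi> = restrict (\<psi> \<circ> lincomb R ?F0) (carrier ?F1)"
    unfolding C_def by blast
  show ?thesis
  proof (rule that)
    show "\<psi> \<in> mod_hom R ?F0 N" using \<psi>(1) by (simp add: hom_module_def)
    fix \<rho> assume \<rho>: "\<rho> \<in> ?K"
    have u: "unit_vector R \<rho> \<in> carrier ?F1" unfolding res1_def by (rule M.R.unit_vector_closed[OF \<rho>])
    have "lincomb R ?F0 (unit_vector R \<rho>) = \<rho>" by (rule F0.lincomb_unit_vector[OF KF0 \<rho>])
    moreover have "\<phi> (unit_vector R \<rho>) = \<psi> (lincomb R ?F0 (unit_vector R \<rho>))" using u by (simp add: \<psi>(2))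
    moreover have "\<phi> (unit_vector R \<rho>) = \<kappa> (lincomb R ?F0 (unit_vector R \<rho>))" using u by (simp add: \<phi>_def)
    ultimately show "\<psi> \<rho> = \<kappa> \<rho>" by simp
  qed
qed

section \<open>Endomorphisms from rigidity\<close>

definition generates ::
    "('a, 'k) ring_scheme \<Rightarrow> ('a, 'b, 'm) module_scheme \<Rightarrow> 'b set \<Rightarrow> bool" where
  "generates R M B \<longleftrightarrow> finite B \<and> B \<subseteq> carrier M \<and>
     (\<forall>y\<in>carrier M. \<exists>c\<in>B \<rightarrow> carrier R. y = (\<Oplus>\<^bsub>M\<^esub>b\<in>B. c b \<odot>\<^bsub>M\<^esub> b))"

lemma (in module) eq_if_minus_eq_zero:
  assumes "x \<in> carrier M" "y \<in> carrier M" "x \<ominus>\<^bsub>M\<^esub> y = \<zero>\<^bsub>M\<^esub>"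
  shows "x = y"
proof -
  have "x = (x \<ominus>\<^bsub>M\<^esub> y) \<oplus>\<^bsub>M\<^esub> y" using assms(1,2) by (simp add: M.minus_eq M.a_assoc M.l_neg)
  with assms show ?thesis by simp
qed

lemma (in module) generatesI:
  assumes "finite B" "B \<subseteq> carrier M" and "submodule_span R M X = carrier M"
    and "\<And>x. x \<in> X \<Longrightarrow> \<exists>c\<in>B \<rightarrow> carrier R. x = (\<Oplus>\<^bsub>M\<^esub>b\<in>B. c b \<cdot> b)"
  shows "generates R M B"
proof -
  let ?S = "{\<Oplus>\<^bsub>M\<^esub>b\<in>B. c b \<cdot> b | c. c \<in> B \<rightarrow> carrier R}"
  have "submodule ?S R M" by (rule combs_submodule) (use assms in auto)
  moreover have "X \<subseteq> ?S" using assms(4) by auto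
  ultimately have "carrier M \<subseteq> ?S" using assms(3) by (auto simp: submodule_span_def)
  then show ?thesis using assms(1,2) by (auto simp: generates_def)
qed

lemma (in module) generates_if_finitely_generated:
  assumes "finitely_generated R M"
  obtains B where "generates R M B"
proof -
  from assms obtain X where X: "X \<subseteq> carrier M" "finite X" "submodule_span R M X = carrier M"
    by (auto simp: finitely_generated_def)
  have "generates R M X"
  proof (rule generatesI[OF X(2,1,3)])
    fix x assume x: "x \<in> X"
    have "(\<Oplus>\<^bsub>M\<^esub>b\<in>X. (if b = x then \<one> else \<zero>) \<cdot> b) = \<one> \<cdot> x"
      by (rule comb_delta[OF X(2) x]) (use X(1) in auto)
    then have "x = (\<Oplus>\<^bsub>M\<^esub>b\<in>X. (if b = x then \<one> else \<zero>) \<cdot> b)" using x X(1) by auto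
    then show "\<exists>c\<in>X \<rightarrow> carrier R. x = (\<Oplus>\<^bsub>M\<^esub>b\<in>X. c b \<cdot> b)"
      by (intro bexI[of _ "\<lambda>b. if b = x then \<one> else \<zero>"]) auto
  qed
  with that show ?thesis .
qed

lemma (in module) generates_Diff:
  assumes B: "generates R M B" and c: "c \<in> relations R M B (\<lambda>b. b)" and b: "b \<in> B" "c b \<in> Units R"
  shows "generates R M (B - {b})"
proof -
  have fin: "finite B" "B \<subseteq> carrier M" using B by (auto simp: generates_def)
  have cR: "c \<in> B \<rightarrow> carrier R" and c0: "(\<Oplus>\<^bsub>M\<^esub>i\<in>B. c i \<cdot> i) = \<zero>\<^bsub>M\<^esub>" using c by (auto simp: relations_def)
  have bM: "b \<in> carrier M" using b fin by auto
  from b obtain u where u: "u \<in> carrier R" "u \<otimes> c b = \<one>" by (auto simp: Units_def)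
  let ?S = "{\<Oplus>\<^bsub>M\<^esub>i\<in>B - {b}. c i \<cdot> i | c. c \<in> B - {b} \<rightarrow> carrier R}"
  have S: "submodule ?S R M" by (rule combs_submodule) (use fin in auto)
  let ?y = "\<Oplus>\<^bsub>M\<^esub>i\<in>B - {b}. c i \<cdot> i"
  have y: "?y \<in> ?S" using cR by blast
  have yM: "?y \<in> carrier M" using y submoduleE(1)[OF S] by blast
  have "c b \<cdot> b \<oplus>\<^bsub>M\<^esub> ?y = \<zero>\<^bsub>M\<^esub>"
    unfolding c0[symmetric] by (rule comb_remove[symmetric, OF fin(1) b(1) cR]) (use fin in auto)
  then have "c b \<cdot> b \<oplus>\<^bsub>M\<^esub> ?y \<in> ?S" using submodule_zero[OF S] by simp
  then have "c b \<cdot> b \<in> ?S"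
    by (rule mem_submodule_if_add_mem[OF S y]) (use bM cR b(1) in auto)
  then have "u \<cdot> (c b \<cdot> b) \<in> ?S" by (rule submoduleE(4)[OF S u(1)])
  then have bS: "b \<in> ?S" using u bM cR b(1) by (simp add: smult_assoc1[symmetric] Pi_iff)
  have iS: "i \<in> ?S" if "i \<in> B" for i
  proof (cases "i = b")
    case False
    have "(\<Oplus>\<^bsub>M\<^esub>k\<in>B - {b}. (if k = i then \<one> else \<zero>) \<cdot> k) = \<one> \<cdot> i"
      by (rule comb_delta) (use fin that False in auto)
    then have "i = (\<Oplus>\<^bsub>M\<^esub>k\<in>B - {b}. (if k = i then \<one> else \<zero>) \<cdot> k)" using fin that by auto
    then show ?thesis by (intro CollectI exI[of _ "\<lambda>k. if k = i then \<one> else \<zero>"]) auto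
  qed (use bS in simp)
  have "y \<in> ?S" if "y \<in> carrier M" for y
  proof -
    from B that obtain d where d: "d \<in> B \<rightarrow> carrier R" "y = (\<Oplus>\<^bsub>M\<^esub>b\<in>B. d b \<cdot> b)" by (auto simp: generates_def)
    show ?thesis unfolding d(2) by (rule submodule_comb[OF S fin(1) d(1)]) (use iS in blast)
  qed
  then show ?thesis using fin unfolding generates_def by blast
qed

text \<open>In a generating set of least cardinality, a relation with a unit coefficient would make a generator superfluous.\<close>

lemma (in noetherian_local_module) ex_minimal_generators:
  assumes "finitely_generated R M"
  obtains B where "generates R M B" "\<And>c b. c \<in> relations R M B (\<lambda>b. b) \<Longrightarrow> b \<in> B \<Longrightarrow> c b \<in> max_ideal R"
proof -
  obtain B0 where "generates R M B0" using generates_if_finitely_generated[OF assms] .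
  then obtain B where B: "generates R M B" and min: "\<And>B'. generates R M B' \<Longrightarrow> card B \<le> card B'"
    using ex_has_least_nat[of "generates R M" B0 card] by blast
  show ?thesis
  proof (rule that[OF B])
    fix c b assume c: "c \<in> relations R M B (\<lambda>b. b)" and b: "b \<in> B"
    show "c b \<in> max_ideal R"
    proof (rule ccontr)
      assume "c b \<notin> max_ideal R"
      then have "c b \<in> Units R" using unit_if_notin_max_ideal[of "c b"] c b by (auto simp: relations_def)
      from min[OF generates_Diff[OF B c b this]] have "card B \<le> card (B - {b})" .
      moreover have "card (B - {b}) < card B"
        by (rule card_Diff1_less) (use B b in \<open>auto simp: generates_def\<close>)
      ultimately show False by simp
    qed
  qed
qed

text \<open>As \<open>\<gamma>\<close> is linear modulo the maximal ideal \<open>\<mm>\<close>, its linear extension \<open>g\<close> to the free module \<open>F\<^sub>0\<close> on \<open>M\<close> maps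
  the kernel of \<open>F\<^sub>0 \<rightarrow> M\<close> into \<open>\<mm>\<close>. So \<open>\<tau> \<circ> g\<close> is defined on this kernel, and by rigidity it extends to a map \<open>\<psi>\<close>
  on \<open>F\<^sub>0\<close>. Then \<open>g \<tau>(a) - a \<psi>\<close> vanishes on the kernel because \<open>r \<tau>(a) = \<tau>(r a) = a \<tau>(r)\<close>, so it descends
  to \<open>M\<close>.\<close>

lemma (in noetherian_local_module) lift_functional_mod_max_ideal:
  assumes rigid: "rigid R M"
    and \<tau>: "\<And>r. r \<in> max_ideal R \<Longrightarrow> \<tau> r \<in> carrier M"
      "\<And>r s. r \<in> max_ideal R \<Longrightarrow> s \<in> max_ideal R \<Longrightarrow> \<tau> (r \<oplus> s) = \<tau> r \<oplus>\<^bsub>M\<^esub> \<tau> s"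
      "\<And>r s. r \<in> carrier R \<Longrightarrow> s \<in> max_ideal R \<Longrightarrow> \<tau> (r \<otimes> s) = r \<cdot> \<tau> s"
    and a: "a \<in> max_ideal R"
    and \<gamma>: "\<gamma> \<in> carrier M \<rightarrow> carrier R"
      "\<And>y z. y \<in> carrier M \<Longrightarrow> z \<in> carrier M \<Longrightarrow> \<gamma> y \<oplus> \<gamma> z \<ominus> \<gamma> (y \<oplus>\<^bsub>M\<^esub> z) \<in> max_ideal R"
      "\<And>r y. r \<in> carrier R \<Longrightarrow> y \<in> carrier M \<Longrightarrow> r \<otimes> \<gamma> y \<ominus> \<gamma> (r \<cdot> y) \<in> max_ideal R"
  shows "\<exists>\<phi>\<in>mod_hom R M M. \<forall>y\<in>carrier M. \<exists>z\<in>carrier M. \<phi> y = \<gamma> y \<cdot> \<tau> a \<oplus>\<^bsub>M\<^esub> a \<cdot> z"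
proof -
  let ?F = "res0 R M" and ?K = "a_kernel (res0 R M) M (lincomb R M)"
  interpret Reg: module R "regular_module R" by (rule R.module_regular_module)
  interpret F: module R ?F unfolding res0_def by (rule R.module_free_module)
  have M: "module R M" by unfold_locales
  have aR: "a \<in> carrier R" using a by simp
  have xM: "\<tau> a \<in> carrier M" using \<tau>(1) a .
  have \<gamma>R: "\<gamma> y \<in> carrier R" if "y \<in> carrier M" for y using \<gamma>(1) that by auto
  define g where "g = free_lift R (regular_module R) \<gamma>"
  have g: "g \<in> mod_hom R ?F (regular_module R)"
    unfolding g_def res0_def by (rule Reg.free_lift_hom) (use \<gamma> in auto)
  have gR: "g \<rho> \<in> carrier R" if "\<rho> \<in> carrier ?F" for \<rho> using mod_homD(1)[OF g that] by simp
  have g_add: "g (\<rho> \<oplus>\<^bsub>?F\<^esub> \<sigma>) = g \<rho> \<oplus> g \<sigma>" if "\<rho> \<in> carrier ?F" "\<sigma> \<in> carrier ?F" for \<rho> \<sigma>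
    using mod_homD(2)[OF g that] by simp
  have g_smult: "g (r \<odot>\<^bsub>?F\<^esub> \<rho>) = r \<otimes> g \<rho>" if "r \<in> carrier R" "\<rho> \<in> carrier ?F" for r \<rho>
    using mod_homD(3)[OF g that] by simp
  have d0: "lincomb R M \<in> mod_hom R ?F M" unfolding res0_def by (rule lincomb_hom) simp
  have K: "submodule ?K R ?F" by (rule a_kernel_submodule[OF F.module_axioms M d0])
  have KF: "\<rho> \<in> carrier ?F" if "\<rho> \<in> ?K" for \<rho> using F.submoduleE(1)[OF K] that by auto
  have telescope: "x \<ominus> z \<in> max_ideal R"
    if "x \<ominus> y \<in> max_ideal R" "y \<ominus> z \<in> max_ideal R" "x \<in> carrier R" "y \<in> carrier R" "z \<in> carrier R" for x y z
  proof -
    have "x \<ominus> z = (x \<ominus> y) \<oplus> (y \<ominus> z)"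
      using that(3-5) by (simp add: R.minus_eq R.a_assoc[symmetric]) (simp add: R.a_assoc R.l_neg)
    then show ?thesis using max_ideal_add that by simp
  qed
  have \<gamma>0: "\<gamma> \<zero>\<^bsub>M\<^esub> \<in> max_ideal R"
  proof -
    have "\<ominus> \<gamma> \<zero>\<^bsub>M\<^esub> \<in> max_ideal R" using \<gamma>(3)[of \<zero> "\<zero>\<^bsub>M\<^esub>"] \<gamma>R[of "\<zero>\<^bsub>M\<^esub>"] by (simp add: R.minus_eq)
    from max_ideal_minus[OF this] show ?thesis using \<gamma>R by simp
  qed
  have sums: "(\<Oplus>y\<in>A. c y \<otimes> \<gamma> y) \<ominus> \<gamma> (\<Oplus>\<^bsub>M\<^esub>y\<in>A. c y \<cdot> y) \<in> max_ideal R"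
    if "finite A" "A \<subseteq> carrier M" "c \<in> A \<rightarrow> carrier R" for A c
    using that
  proof (induction A rule: finite_induct)
    case empty
    show ?case using max_ideal_minus[OF \<gamma>0] \<gamma>0 by (simp add: R.minus_eq)
  next
    case (insert y A)
    let ?s = "\<Oplus>y\<in>A. c y \<otimes> \<gamma> y" and ?t = "\<Oplus>\<^bsub>M\<^esub>y\<in>A. c y \<cdot> y"
    have yM: "y \<in> carrier M" and cy: "c y \<in> carrier R" and AM: "A \<subseteq> carrier M" and cA: "c \<in> A \<rightarrow> carrier R"
      using insert.prems by auto
    have s: "(\<Oplus>y\<in>insert y A. c y \<otimes> \<gamma> y) = c y \<otimes> \<gamma> y \<oplus> ?s"
      by (rule R.finsum_insert) (use insert \<gamma>R in \<open>auto simp: Pi_iff subset_iff\<close>)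
    have t: "(\<Oplus>\<^bsub>M\<^esub>y\<in>insert y A. c y \<cdot> y) = c y \<cdot> y \<oplus>\<^bsub>M\<^esub> ?t"
      by (rule comb_insert) (use insert in auto)
    have sR: "?s \<in> carrier R" by (rule R.finsum_closed) (use cA AM \<gamma>R in \<open>auto simp: Pi_iff subset_iff\<close>)
    have tM: "?t \<in> carrier M" by (rule comb_closed[OF cA]) (use AM in auto)
    have IH: "?s \<ominus> \<gamma> ?t \<in> max_ideal R" by (rule insert.IH[OF AM cA])
    have 1: "(c y \<otimes> \<gamma> y \<oplus> ?s) \<ominus> (\<gamma> (c y \<cdot> y) \<oplus> \<gamma> ?t) \<in> max_ideal R"
    proof -
      have "(c y \<otimes> \<gamma> y \<oplus> ?s) \<ominus> (\<gamma> (c y \<cdot> y) \<oplus> \<gamma> ?t) = (c y \<otimes> \<gamma> y \<ominus> \<gamma> (c y \<cdot> y)) \<oplus> (?s \<ominus> \<gamma> ?t)"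
        using cy yM sR tM \<gamma>R by (simp add: R.minus_eq R.minus_add R.a_ac)
      then show ?thesis using max_ideal_add[OF \<gamma>(3)[OF cy yM] IH] by simp
    qed
    show ?case
      unfolding s t
      by (rule telescope[OF 1 \<gamma>(2)]) (use cy yM tM sR \<gamma>R in auto)
  qed
  have gK: "g \<rho> \<in> max_ideal R" if \<rho>: "\<rho> \<in> ?K" for \<rho>
  proof -
    let ?A = "{y. \<rho> y \<noteq> \<zero>}"
    have \<rho>F: "\<rho> \<in> carrier (free_module R (carrier M))" using KF[OF \<rho>] by (simp add: res0_def)
    note D = free_module_carrierD[OF \<rho>F]
    have "g \<rho> = (\<Oplus>y\<in>?A. \<rho> y \<otimes> \<gamma> y)" by (simp add: g_def free_lift_def)
    moreover have "(\<Oplus>\<^bsub>M\<^esub>y\<in>?A. \<rho> y \<cdot> y) = \<zero>\<^bsub>M\<^esub>" using \<rho> by (simp add: a_kernel_def' lincomb_def)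
    ultimately have "g \<rho> \<ominus> \<gamma> \<zero>\<^bsub>M\<^esub> \<in> max_ideal R" using sums[OF D(3,2), of \<rho>] D(1) by simp
    from telescope[OF this, of \<zero>] show ?thesis using gR[OF KF[OF \<rho>]] \<gamma>0 by (simp add: R.minus_eq)
  qed
  have "(\<lambda>\<rho>. \<tau> (g \<rho>)) \<in> mod_hom R (?F\<lparr>carrier := ?K\<rparr>) M"
  proof (rule mod_homI)
    fix \<rho> assume "\<rho> \<in> carrier (?F\<lparr>carrier := ?K\<rparr>)"
    then have \<rho>: "\<rho> \<in> ?K" by simp
    then show "\<tau> (g \<rho>) \<in> carrier M" using gK \<tau>(1) by auto
    { fix \<sigma> assume "\<sigma> \<in> carrier (?F\<lparr>carrier := ?K\<rparr>)"
      then have \<sigma>: "\<sigma> \<in> ?K" by simp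
      show "\<tau> (g (\<rho> \<oplus>\<^bsub>?F\<lparr>carrier := ?K\<rparr>\<^esub> \<sigma>)) = \<tau> (g \<rho>) \<oplus>\<^bsub>M\<^esub> \<tau> (g \<sigma>)"
        using g_add[OF KF[OF \<rho>] KF[OF \<sigma>]] \<tau>(2)[OF gK[OF \<rho>] gK[OF \<sigma>]] by simp }
    fix r assume r: "r \<in> carrier R"
    show "\<tau> (g (r \<odot>\<^bsub>?F\<lparr>carrier := ?K\<rparr>\<^esub> \<rho>)) = r \<cdot> \<tau> (g \<rho>)"
      using g_smult[OF r KF[OF \<rho>]] \<tau>(3)[OF r gK[OF \<rho>]] by simp
  qed
  from extend_from_syzygy_if_Ext1_trivial[OF M M _ this] rigid obtain \<psi> where
    \<psi>: "\<psi> \<in> mod_hom R ?F M" "\<And>\<rho>. \<rho> \<in> ?K \<Longrightarrow> \<psi> \<rho> = \<tau> (g \<rho>)" unfolding rigid_def by blast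
  define \<Phi> where "\<Phi> = (\<lambda>\<rho>. g \<rho> \<cdot> \<tau> a \<ominus>\<^bsub>M\<^esub> a \<cdot> \<psi> \<rho>)"
  note \<psi>D = mod_homD[OF \<psi>(1)]
  have \<Phi>: "\<Phi> \<in> mod_hom R ?F M"
  proof (rule mod_homI)
    fix \<rho> assume \<rho>: "\<rho> \<in> carrier ?F"
    show "\<Phi> \<rho> \<in> carrier M" using gR[OF \<rho>] \<psi>D(1)[OF \<rho>] xM aR by (simp add: \<Phi>_def)
    { fix \<sigma> assume \<sigma>: "\<sigma> \<in> carrier ?F"
      show "\<Phi> (\<rho> \<oplus>\<^bsub>?F\<^esub> \<sigma>) = \<Phi> \<rho> \<oplus>\<^bsub>M\<^esub> \<Phi> \<sigma>"
        using gR[OF \<rho>] gR[OF \<sigma>] \<psi>D(1)[OF \<rho>] \<psi>D(1)[OF \<sigma>] xM aR g_add[OF \<rho> \<sigma>] \<psi>D(2)[OF \<rho> \<sigma>]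
        by (simp add: \<Phi>_def smult_l_distr smult_r_distr M.minus_eq M.minus_add M.a_ac) }
    fix r assume r: "r \<in> carrier R"
    have "a \<cdot> (r \<cdot> \<psi> \<rho>) = r \<cdot> (a \<cdot> \<psi> \<rho>)"
      using r aR \<psi>D(1)[OF \<rho>] by (simp add: smult_assoc1[symmetric] R.m_comm)
    then show "\<Phi> (r \<odot>\<^bsub>?F\<^esub> \<rho>) = r \<cdot> \<Phi> \<rho>"
      using gR[OF \<rho>] \<psi>D(1)[OF \<rho>] xM aR r g_smult[OF r \<rho>] \<psi>D(3)[OF r \<rho>]
      by (simp add: \<Phi>_def smult_assoc1 smult_r_distr M.minus_eq smult_r_minus)
  qed
  have \<Phi>0: "\<Phi> \<rho> = \<zero>\<^bsub>M\<^esub>" if \<rho>: "\<rho> \<in> ?K" for \<rho>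
  proof -
    have "g \<rho> \<cdot> \<tau> a = \<tau> (g \<rho> \<otimes> a)" using \<tau>(3)[OF _ a] gR KF \<rho> by simp
    also have "\<dots> = a \<cdot> \<tau> (g \<rho>)" using \<tau>(3)[OF aR gK[OF \<rho>]] R.m_comm[OF aR gR[OF KF[OF \<rho>]]] by simp
    finally show ?thesis using \<psi>(2)[OF \<rho>] \<tau>(1)[OF gK[OF \<rho>]] aR by (simp add: \<Phi>_def M.minus_eq M.r_neg)
  qed
  have \<Phi>_eq: "\<Phi> \<rho> = \<Phi> \<sigma>" if "\<rho> \<in> carrier ?F" "\<sigma> \<in> carrier ?F" "lincomb R M \<rho> = lincomb R M \<sigma>" for \<rho> \<sigma>
  proof -
    have "\<rho> \<ominus>\<^bsub>?F\<^esub> \<sigma> \<in> ?K"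
      using that mod_hom_minus[OF F.module_axioms M d0 that(1,2)] mod_homD(1)[OF d0 that(2)]
      by (simp add: a_kernel_def' M.minus_eq M.r_neg)
    from \<Phi>0[OF this] have "\<Phi> \<rho> \<ominus>\<^bsub>M\<^esub> \<Phi> \<sigma> = \<zero>\<^bsub>M\<^esub>"
      using mod_hom_minus[OF F.module_axioms M \<Phi> that(1,2)] by simp
    then show ?thesis by (rule eq_if_minus_eq_zero[OF mod_homD(1)[OF \<Phi> that(1)] mod_homD(1)[OF \<Phi> that(2)]])
  qed
  have \<delta>: "unit_vector R y \<in> carrier ?F" "lincomb R M (unit_vector R y) = y" if "y \<in> carrier M" for y
    unfolding res0_def using R.unit_vector_closed[OF that] lincomb_unit_vector[OF _ that] by auto
  define \<phi> where "\<phi> y = \<Phi> (unit_vector R y)" for y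
  have "\<phi> \<in> mod_hom R M M"
  proof (rule mod_homI)
    fix y assume y: "y \<in> carrier M"
    show "\<phi> y \<in> carrier M" unfolding \<phi>_def by (rule mod_homD(1)[OF \<Phi> \<delta>(1)[OF y]])
    { fix z assume z: "z \<in> carrier M"
      have "\<phi> (y \<oplus>\<^bsub>M\<^esub> z) = \<Phi> (unit_vector R y \<oplus>\<^bsub>?F\<^esub> unit_vector R z)"
        unfolding \<phi>_def by (rule \<Phi>_eq) (use \<delta> y z mod_homD(2)[OF d0] in auto)
      then show "\<phi> (y \<oplus>\<^bsub>M\<^esub> z) = \<phi> y \<oplus>\<^bsub>M\<^esub> \<phi> z"
        using mod_homD(2)[OF \<Phi> \<delta>(1)[OF y] \<delta>(1)[OF z]] by (simp add: \<phi>_def) }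
    fix r assume r: "r \<in> carrier R"
    have "\<phi> (r \<cdot> y) = \<Phi> (r \<odot>\<^bsub>?F\<^esub> unit_vector R y)"
      unfolding \<phi>_def by (rule \<Phi>_eq) (use \<delta> y r mod_homD(3)[OF d0] in auto)
    then show "\<phi> (r \<cdot> y) = r \<cdot> \<phi> y"
      using mod_homD(3)[OF \<Phi> r \<delta>(1)[OF y]] by (simp add: \<phi>_def)
  qed
  moreover have "\<exists>z\<in>carrier M. \<phi> y = \<gamma> y \<cdot> \<tau> a \<oplus>\<^bsub>M\<^esub> a \<cdot> z" if y: "y \<in> carrier M" for y
  proof (rule bexI)
    let ?z = "\<psi> (unit_vector R y)"
    have z: "?z \<in> carrier M" by (rule \<psi>D(1)[OF \<delta>(1)[OF y]])
    have "g (unit_vector R y) = \<gamma> y"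
      unfolding g_def by (rule Reg.free_lift_unit_vector) (use \<gamma> y in auto)
    then show "\<phi> y = \<gamma> y \<cdot> \<tau> a \<oplus>\<^bsub>M\<^esub> a \<cdot> (\<ominus>\<^bsub>M\<^esub> ?z)"
      using z aR by (simp add: \<phi>_def \<Phi>_def M.minus_eq smult_r_minus)
    show "\<ominus>\<^bsub>M\<^esub> ?z \<in> carrier M" using z by simp
  qed
  ultimately show ?thesis by blast
qed

section \<open>Iterating an endomorphism modulo powers of a ring element\<close>

lemma (in module) smult_image_submodule:
  assumes "r \<in> carrier R"
  shows "submodule ((\<lambda>z. r \<cdot> z) ` carrier M) R M"
proof (rule submodule_if_closed)
  show "\<zero>\<^bsub>M\<^esub> \<in> (\<lambda>z. r \<cdot> z) ` carrier M" using assms by (auto intro!: image_eqI[of _ _ "\<zero>\<^bsub>M\<^esub>"])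
  fix x y assume "x \<in> (\<lambda>z. r \<cdot> z) ` carrier M" "y \<in> (\<lambda>z. r \<cdot> z) ` carrier M"
  then obtain z z' where "z \<in> carrier M" "z' \<in> carrier M" "x = r \<cdot> z" "y = r \<cdot> z'" by auto
  then show "x \<oplus>\<^bsub>M\<^esub> y \<in> (\<lambda>z. r \<cdot> z) ` carrier M"
    using assms by (auto simp: smult_r_distr intro!: image_eqI[of _ _ "z \<oplus>\<^bsub>M\<^esub> z'"])
next
  fix s x assume s: "s \<in> carrier R" and "x \<in> (\<lambda>z. r \<cdot> z) ` carrier M"
  then obtain z where "z \<in> carrier M" "x = r \<cdot> z" by auto
  then show "s \<cdot> x \<in> (\<lambda>z. r \<cdot> z) ` carrier M"
    using assms s by (intro image_eqI[of _ _ "s \<cdot> z"]) (auto simp: smult_assoc1[symmetric] R.m_comm)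
qed (use assms in auto)

lemma mod_hom_funpow:
  assumes "\<phi> \<in> mod_hom R M M"
  shows "(\<phi> ^^ s) \<in> mod_hom R M M"
proof (induction s)
  case 0
  show ?case by (rule mod_homI) auto
next
  case (Suc s)
  show ?case by (rule mod_homI) (use mod_homD[OF Suc] mod_homD[OF assms] in auto)
qed

lemma (in module) funpow_fixes_mod:
  assumes \<phi>: "\<phi> \<in> mod_hom R M M" and x: "x \<in> carrier M" and a: "a \<in> carrier R"
    and fix_x: "\<exists>z\<in>carrier M. \<phi> x = x \<oplus>\<^bsub>M\<^esub> a \<cdot> z"
  shows "\<exists>z\<in>carrier M. (\<phi> ^^ s) x = x \<oplus>\<^bsub>M\<^esub> a \<cdot> z"
proof (induction s)
  case 0
  show ?case using x a by (intro bexI[of _ "\<zero>\<^bsub>M\<^esub>"]) auto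
next
  case (Suc s)
  note D = mod_homD[OF \<phi>]
  from Suc obtain z where z: "z \<in> carrier M" "(\<phi> ^^ s) x = x \<oplus>\<^bsub>M\<^esub> a \<cdot> z" by auto
  from fix_x obtain y where y: "y \<in> carrier M" "\<phi> x = x \<oplus>\<^bsub>M\<^esub> a \<cdot> y" by auto
  have "(\<phi> ^^ Suc s) x = \<phi> x \<oplus>\<^bsub>M\<^esub> a \<cdot> \<phi> z" using z D x a by simp
  also have "\<dots> = x \<oplus>\<^bsub>M\<^esub> a \<cdot> (y \<oplus>\<^bsub>M\<^esub> \<phi> z)"
    unfolding y(2) using y z D x a by (simp add: smult_r_distr M.a_assoc)
  finally show ?case using y z D by (intro bexI[of _ "y \<oplus>\<^bsub>M\<^esub> \<phi> z"]) auto
qed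

text \<open>Modulo \<open>a\<close>, the map \<open>\<phi>\<close> is a projection to the cyclic submodule generated by \<open>x\<close>. Applying \<open>\<phi>\<close> to
  \<open>\<rho> \<phi>\<^sup>s x + a\<^sup>s\<^sup>+\<^sup>1 z\<close> turns the error term into \<open>a\<^sup>s\<^sup>+\<^sup>1 \<phi> z\<close> with \<open>\<phi> z \<in> R x + a M\<close>, and here \<open>x\<close> may be replaced by
  \<open>\<phi>\<^sup>s\<^sup>+\<^sup>1 x\<close>, which agrees with \<open>x\<close> modulo \<open>a\<close>.\<close>

lemma (in module) funpow_image_cyclic_mod_power:
  assumes \<phi>: "\<phi> \<in> mod_hom R M M" and x: "x \<in> carrier M" and a: "a \<in> carrier R"
    and fix_x: "\<exists>z\<in>carrier M. \<phi> x = x \<oplus>\<^bsub>M\<^esub> a \<cdot> z"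
    and cyclic: "\<And>y. y \<in> carrier M \<Longrightarrow> \<exists>\<rho>\<in>carrier R. \<exists>z\<in>carrier M. \<phi> y = \<rho> \<cdot> x \<oplus>\<^bsub>M\<^esub> a \<cdot> z"
    and y: "y \<in> carrier M"
  shows "\<exists>\<rho>\<in>carrier R. \<exists>z\<in>carrier M.
    (\<phi> ^^ Suc s) y = \<rho> \<cdot> (\<phi> ^^ s) x \<oplus>\<^bsub>M\<^esub> (a [^]\<^bsub>R\<^esub> Suc s) \<cdot> z"
proof (induction s)
  case 0
  show ?case using cyclic[OF y] a by simp
next
  case (Suc s)
  note D = mod_homD[OF \<phi>] and Ds = mod_homD[OF mod_hom_funpow[OF \<phi>]]
  let ?w = "\<lambda>s. (\<phi> ^^ s) x" and ?p = "a [^]\<^bsub>R\<^esub> Suc s"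
  have p: "?p \<in> carrier R" "a [^]\<^bsub>R\<^esub> Suc (Suc s) = ?p \<otimes> a" using a by auto
  have w: "?w s \<in> carrier M" for s using Ds(1)[OF x] .
  from Suc obtain \<rho> z where *: "\<rho> \<in> carrier R" "z \<in> carrier M"
    "(\<phi> ^^ Suc s) y = \<rho> \<cdot> ?w s \<oplus>\<^bsub>M\<^esub> ?p \<cdot> z" by blast
  from cyclic[OF *(2)] obtain \<sigma> z' where z': "\<sigma> \<in> carrier R" "z' \<in> carrier M"
    "\<phi> z = \<sigma> \<cdot> x \<oplus>\<^bsub>M\<^esub> a \<cdot> z'" by blast
  from funpow_fixes_mod[OF \<phi> x a fix_x, of "Suc s"] obtain y' where
    y': "y' \<in> carrier M" "?w (Suc s) = x \<oplus>\<^bsub>M\<^esub> a \<cdot> y'" by blast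
  have xw: "x = ?w (Suc s) \<oplus>\<^bsub>M\<^esub> a \<cdot> (\<ominus>\<^bsub>M\<^esub> y')"
    unfolding y'(2) using y' x a by (simp add: smult_r_minus M.a_assoc M.r_neg)
  have "(\<phi> ^^ Suc (Suc s)) y = \<phi> (\<rho> \<cdot> ?w s \<oplus>\<^bsub>M\<^esub> ?p \<cdot> z)" using *(3) by simp
  also have "\<dots> = \<rho> \<cdot> ?w (Suc s) \<oplus>\<^bsub>M\<^esub> ?p \<cdot> \<phi> z"
    using *(1,2) p(1) w D by simp
  also have "\<phi> z = \<sigma> \<cdot> (?w (Suc s) \<oplus>\<^bsub>M\<^esub> a \<cdot> (\<ominus>\<^bsub>M\<^esub> y')) \<oplus>\<^bsub>M\<^esub> a \<cdot> z'"
    using z'(3) xw by simp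
  also have "\<dots> = \<sigma> \<cdot> ?w (Suc s) \<oplus>\<^bsub>M\<^esub> a \<cdot> (\<sigma> \<cdot> (\<ominus>\<^bsub>M\<^esub> y') \<oplus>\<^bsub>M\<^esub> z')"
    using z'(1,2) y'(1) w[of "Suc s"] a
    by (simp add: smult_r_distr smult_assoc1[symmetric] R.m_comm M.a_assoc del: funpow.simps)
  also have "\<rho> \<cdot> ?w (Suc s) \<oplus>\<^bsub>M\<^esub> ?p \<cdot> \<dots>
    = (\<rho> \<oplus> ?p \<otimes> \<sigma>) \<cdot> ?w (Suc s) \<oplus>\<^bsub>M\<^esub> (?p \<otimes> a) \<cdot> (\<sigma> \<cdot> (\<ominus>\<^bsub>M\<^esub> y') \<oplus>\<^bsub>M\<^esub> z')"
    using *(1) z'(1,2) y'(1) w[of "Suc s"] a p(1)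
    by (simp add: smult_r_distr smult_l_distr smult_assoc1 M.a_assoc del: funpow.simps nat_pow_Suc)
  finally have "(\<phi> ^^ Suc (Suc s)) y = (\<rho> \<oplus> ?p \<otimes> \<sigma>) \<cdot> ?w (Suc s)
    \<oplus>\<^bsub>M\<^esub> (a [^]\<^bsub>R\<^esub> Suc (Suc s)) \<cdot> (\<sigma> \<cdot> (\<ominus>\<^bsub>M\<^esub> y') \<oplus>\<^bsub>M\<^esub> z')" unfolding p(2) .
  then show ?case
    using *(1) z'(1,2) y'(1) p(1)
    by (intro bexI[of _ "\<rho> \<oplus> ?p \<otimes> \<sigma>"] bexI[of _ "\<sigma> \<cdot> (\<ominus>\<^bsub>M\<^esub> y') \<oplus>\<^bsub>M\<^esub> z'"]) (auto simp del: nat_pow_Suc)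
qed

text \<open>The setting extracted from a Burch embedding of a rigid module. Think of \<open>\<tau>\<close> as multiplication by an element \<open>t\<close> of the
  overmodule with \<open>\<mm> t \<subseteq> M\<close>, and of \<open>N\<close> as \<open>\<mm> M\<close>.\<close>

locale burch_data = noetherian_local_module R M for R (structure) and M (structure) +
  fixes \<tau> a B N
  assumes rigid: "rigid R M"
    and tau_closed: "r \<in> max_ideal R \<Longrightarrow> \<tau> r \<in> carrier M"
    and tau_add: "r \<in> max_ideal R \<Longrightarrow> s \<in> max_ideal R \<Longrightarrow> \<tau> (r \<oplus> s) = \<tau> r \<oplus>\<^bsub>M\<^esub> \<tau> s"
    and tau_smult: "q \<in> carrier R \<Longrightarrow> s \<in> max_ideal R \<Longrightarrow> \<tau> (q \<otimes> s) = q \<cdot> \<tau> s"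
    and a: "a \<in> max_ideal R"
    and B: "generates R M B"
    and rel: "c \<in> relations R M B (\<lambda>b. b) \<Longrightarrow> b \<in> B \<Longrightarrow> c b \<in> max_ideal R"
    and N: "submodule N R M"
    and mN: "r \<in> max_ideal R \<Longrightarrow> y \<in> carrier M \<Longrightarrow> r \<cdot> y \<in> N"
    and xN: "\<tau> a \<notin> N"
begin

abbreviation x where "x \<equiv> \<tau> a"

lemma aR: "a \<in> carrier R" using a by simp

lemma xM: "x \<in> carrier M" using tau_closed[OF a] .

lemma B_fin: "finite B" and BM: "b \<in> B \<Longrightarrow> b \<in> carrier M"
  using B by (auto simp: generates_def)

lemma mem_max_ideal_if_smult_x:
  assumes "r \<in> carrier R" "r \<cdot> x \<in> N"
  shows "r \<in> max_ideal R"
proof (rule ccontr)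
  assume "r \<notin> max_ideal R"
  with assms(1) obtain u where u: "u \<in> carrier R" "u \<otimes> r = \<one>"
    using unit_if_notin_max_ideal by (auto simp: Units_def)
  have "u \<cdot> (r \<cdot> x) \<in> N" by (rule submoduleE(4)[OF N u(1) assms(2)])
  then show False using u assms(1) xM xN by (simp add: smult_assoc1[symmetric])
qed

lemma ex_unit_coefficient:
  assumes "\<xi> \<in> B \<rightarrow> carrier R" "x = (\<Oplus>\<^bsub>M\<^esub>b\<in>B. \<xi> b \<cdot> b)"
  obtains b where "b \<in> B" "\<xi> b \<in> Units R"
proof -
  have "\<exists>b\<in>B. \<xi> b \<notin> max_ideal R"
  proof (rule ccontr)
    assume "\<not> ?thesis"
    then have "(\<Oplus>\<^bsub>M\<^esub>b\<in>B. \<xi> b \<cdot> b) \<in> N" by (intro submodule_finsum[OF N]) (use mN BM in auto)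
    with assms(2) xN show False by simp
  qed
  then obtain b where "b \<in> B" "\<xi> b \<notin> max_ideal R" ..
  then show ?thesis using that unit_if_notin_max_ideal[of "\<xi> b"] assms(1) by auto
qed

text \<open>The coefficients of \<open>y + z\<close> and \<open>r y\<close> differ from the expected ones by relations. So the coefficient at \<open>b\<close> is linear
  modulo the maximal ideal, and rigidity lifts it.\<close>

lemma ex_dual_endomorphisms:
  "\<exists>\<gamma> \<phi>. (\<forall>y\<in>carrier M. \<gamma> y \<in> B \<rightarrow> carrier R \<and> y = (\<Oplus>\<^bsub>M\<^esub>b\<in>B. \<gamma> y b \<cdot> b)) \<and>
    (\<forall>b\<in>B. \<phi> b \<in> mod_hom R M M \<and>
      (\<forall>y\<in>carrier M. \<exists>z\<in>carrier M. \<phi> b y = \<gamma> y b \<cdot> x \<oplus>\<^bsub>M\<^esub> a \<cdot> z))"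
proof -
  have "\<forall>y\<in>carrier M. \<exists>c. c \<in> B \<rightarrow> carrier R \<and> y = (\<Oplus>\<^bsub>M\<^esub>b\<in>B. c b \<cdot> b)"
    using B unfolding generates_def by blast
  from bchoice[OF this] obtain \<gamma> where
    \<gamma>_all: "\<forall>y\<in>carrier M. \<gamma> y \<in> B \<rightarrow> carrier R \<and> y = (\<Oplus>\<^bsub>M\<^esub>b\<in>B. \<gamma> y b \<cdot> b)" ..
  have \<gamma>: "\<gamma> y \<in> B \<rightarrow> carrier R" "(\<Oplus>\<^bsub>M\<^esub>b\<in>B. \<gamma> y b \<cdot> b) = y" if "y \<in> carrier M" for y
    using bspec[OF \<gamma>_all that] by simp_all
  have BM': "(\<lambda>b. b) \<in> B \<rightarrow> carrier M" using BM by auto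
  have "\<exists>\<phi>\<in>mod_hom R M M. \<forall>y\<in>carrier M. \<exists>z\<in>carrier M. \<phi> y = \<gamma> y b \<cdot> x \<oplus>\<^bsub>M\<^esub> a \<cdot> z" if b: "b \<in> B" for b
  proof (rule lift_functional_mod_max_ideal[OF rigid tau_closed tau_add tau_smult a])
    show "(\<lambda>y. \<gamma> y b) \<in> carrier M \<rightarrow> carrier R" using \<gamma>(1) b by auto
    fix y assume y: "y \<in> carrier M"
    { fix z assume z: "z \<in> carrier M"
      have yz: "y \<oplus>\<^bsub>M\<^esub> z \<in> carrier M" using y z by simp
      have "(\<Oplus>\<^bsub>M\<^esub>b\<in>B. (\<gamma> y b \<oplus> \<gamma> z b \<ominus> \<gamma> (y \<oplus>\<^bsub>M\<^esub> z) b) \<cdot> b)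
        = (\<Oplus>\<^bsub>M\<^esub>b\<in>B. (\<gamma> y b \<oplus> \<gamma> z b) \<cdot> b) \<ominus>\<^bsub>M\<^esub> (y \<oplus>\<^bsub>M\<^esub> z)"
        using comb_diff[OF B_fin _ \<gamma>(1)[OF yz] BM', of "\<lambda>b. \<gamma> y b \<oplus> \<gamma> z b"] \<gamma>(1)[OF y] \<gamma>(1)[OF z] \<gamma>(2)[OF yz]
        by (simp add: Pi_iff)
      also have "\<dots> = \<zero>\<^bsub>M\<^esub>"
        using comb_add[OF \<gamma>(1)[OF y] \<gamma>(1)[OF z] BM'] \<gamma>(2)[OF y] \<gamma>(2)[OF z] yz by (simp add: M.minus_eq M.r_neg)
      finally have "(\<lambda>b. \<gamma> y b \<oplus> \<gamma> z b \<ominus> \<gamma> (y \<oplus>\<^bsub>M\<^esub> z) b) \<in> relations R M B (\<lambda>b. b)"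
        using \<gamma>(1)[OF y] \<gamma>(1)[OF z] \<gamma>(1)[OF yz] by (auto simp: relations_def)
      from rel[OF this b] show "\<gamma> y b \<oplus> \<gamma> z b \<ominus> \<gamma> (y \<oplus>\<^bsub>M\<^esub> z) b \<in> max_ideal R" . }
    fix r assume r: "r \<in> carrier R"
    have ry: "r \<cdot> y \<in> carrier M" using r y by simp
    have "(\<Oplus>\<^bsub>M\<^esub>b\<in>B. (r \<otimes> \<gamma> y b \<ominus> \<gamma> (r \<cdot> y) b) \<cdot> b)
      = (\<Oplus>\<^bsub>M\<^esub>b\<in>B. (r \<otimes> \<gamma> y b) \<cdot> b) \<ominus>\<^bsub>M\<^esub> (r \<cdot> y)"
      using comb_diff[OF B_fin _ \<gamma>(1)[OF ry] BM', of "\<lambda>b. r \<otimes> \<gamma> y b"] \<gamma>(1)[OF y] \<gamma>(2)[OF ry] r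
      by (simp add: Pi_iff)
    also have "\<dots> = \<zero>\<^bsub>M\<^esub>"
      using comb_smult[OF B_fin r \<gamma>(1)[OF y] BM'] \<gamma>(2)[OF y] ry by (simp add: M.minus_eq M.r_neg)
    finally have "(\<lambda>b. r \<otimes> \<gamma> y b \<ominus> \<gamma> (r \<cdot> y) b) \<in> relations R M B (\<lambda>b. b)"
      using \<gamma>(1)[OF y] \<gamma>(1)[OF ry] r by (auto simp: relations_def)
    from rel[OF this b] show "r \<otimes> \<gamma> y b \<ominus> \<gamma> (r \<cdot> y) b \<in> max_ideal R" .
  qed
  then have "\<exists>\<phi>. \<forall>b\<in>B. \<phi> b \<in> mod_hom R M M \<and>
      (\<forall>y\<in>carrier M. \<exists>z\<in>carrier M. \<phi> b y = \<gamma> y b \<cdot> x \<oplus>\<^bsub>M\<^esub> a \<cdot> z)"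
    by (intro bchoice) blast
  then obtain \<phi> where \<phi>: "\<forall>b\<in>B. \<phi> b \<in> mod_hom R M M \<and>
      (\<forall>y\<in>carrier M. \<exists>z\<in>carrier M. \<phi> b y = \<gamma> y b \<cdot> x \<oplus>\<^bsub>M\<^esub> a \<cdot> z)" ..
  with \<gamma>_all show ?thesis by (intro exI[of _ \<gamma>] exI[of _ \<phi>] conjI)
qed

text \<open>Scaling one of the dual endomorphisms \<open>\<phi>\<^sub>b\<close> gives a projection \<open>\<pi>\<close> to \<open>x\<close> modulo \<open>a\<close>. The composites
  \<open>F\<^sub>b = \<pi>\<^sup>s\<^sup>+\<^sup>1 \<circ> \<phi>\<^sub>b\<close> map the generators to multiples of \<open>w = \<pi>\<^sup>s x\<close> modulo \<open>a\<^sup>s\<^sup>+\<^sup>1\<close>, with coefficient matrix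
  congruent to the identity modulo the maximal ideal. Applied to a relation \<open>c\<close>, they show
  by Nakayama that all \<open>c\<^sub>b w\<close> vanish modulo \<open>a\<^sup>s\<^sup>+\<^sup>1\<close>.\<close>

lemma ex_near_x_killed_by_relations:
  "\<exists>w\<in>carrier M. (\<exists>z\<in>carrier M. w = x \<oplus>\<^bsub>M\<^esub> a \<cdot> z) \<and>
    (\<forall>c\<in>relations R M B (\<lambda>b. b). \<forall>b\<in>B. c b \<cdot> w \<in> (\<lambda>z. (a [^]\<^bsub>R\<^esub> Suc s) \<cdot> z) ` carrier M)"
proof -
  obtain \<gamma> \<phi> where 1: "\<forall>y\<in>carrier M. \<gamma> y \<in> B \<rightarrow> carrier R \<and> y = (\<Oplus>\<^bsub>M\<^esub>b\<in>B. \<gamma> y b \<cdot> b)"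
    and 2: "\<forall>b\<in>B. \<phi> b \<in> mod_hom R M M \<and>
      (\<forall>y\<in>carrier M. \<exists>z\<in>carrier M. \<phi> b y = \<gamma> y b \<cdot> x \<oplus>\<^bsub>M\<^esub> a \<cdot> z)"
    using ex_dual_endomorphisms by (elim exE conjE)
  have \<gamma>: "\<gamma> y \<in> B \<rightarrow> carrier R" "y = (\<Oplus>\<^bsub>M\<^esub>b\<in>B. \<gamma> y b \<cdot> b)" if "y \<in> carrier M" for y
    using bspec[OF 1 that] by simp_all
  have \<phi>: "\<phi> b \<in> mod_hom R M M"
    "\<And>y. y \<in> carrier M \<Longrightarrow> \<exists>z\<in>carrier M. \<phi> b y = \<gamma> y b \<cdot> x \<oplus>\<^bsub>M\<^esub> a \<cdot> z" if "b \<in> B" for b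
    using bspec[OF 2 that] by simp_all
  have M: "module R M" by unfold_locales
  have BM': "(\<lambda>b. b) \<in> B \<rightarrow> carrier M" using BM by auto
  have \<gamma>R: "\<gamma> y b \<in> carrier R" if "y \<in> carrier M" "b \<in> B" for y b using \<gamma>(1) that by auto
  obtain k where k: "k \<in> B" "\<gamma> x k \<in> Units R" by (rule ex_unit_coefficient[OF \<gamma>(1)[OF xM] \<gamma>(2)[OF xM]])
  then obtain u where u: "u \<in> carrier R" "u \<otimes> \<gamma> x k = \<one>" by (auto simp: Units_def)
  \<comment> \<open>The factor \<open>u\<close> normalizes the coefficient of \<open>x\<close> in \<open>\<phi>\<^sub>k x\<close> to \<open>1\<close>.\<close>
  define \<pi> where "\<pi> = (\<lambda>y. u \<cdot> \<phi> k y)"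
  note \<phi>k = mod_homD[OF \<phi>(1)[OF k(1)]]
  have \<pi>: "\<pi> \<in> mod_hom R M M"
  proof (rule mod_homI)
    fix r y assume "r \<in> carrier R" "y \<in> carrier M"
    then show "\<pi> (r \<cdot> y) = r \<cdot> \<pi> y"
      using u \<phi>k by (simp add: \<pi>_def smult_assoc1[symmetric] R.m_comm)
  qed (use u \<phi>k in \<open>auto simp: \<pi>_def smult_r_distr\<close>)
  have \<pi>_form: "\<exists>z\<in>carrier M. \<pi> y = (u \<otimes> \<gamma> y k) \<cdot> x \<oplus>\<^bsub>M\<^esub> a \<cdot> z" if y: "y \<in> carrier M" for y
  proof -
    from \<phi>(2)[OF k(1) y] obtain z where z: "z \<in> carrier M" "\<phi> k y = \<gamma> y k \<cdot> x \<oplus>\<^bsub>M\<^esub> a \<cdot> z" by auto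
    have "\<pi> y = (u \<otimes> \<gamma> y k) \<cdot> x \<oplus>\<^bsub>M\<^esub> a \<cdot> (u \<cdot> z)"
      using z u \<gamma>R[OF y k(1)] xM aR
      by (simp add: \<pi>_def smult_r_distr smult_assoc1[symmetric] R.m_comm)
    then show ?thesis using u z by (intro bexI[of _ "u \<cdot> z"]) auto
  qed
  have fix_x: "\<exists>z\<in>carrier M. \<pi> x = x \<oplus>\<^bsub>M\<^esub> a \<cdot> z"
    using \<pi>_form[OF xM] u xM by simp
  have cyclic: "\<exists>\<rho>\<in>carrier R. \<exists>z\<in>carrier M. \<pi> y = \<rho> \<cdot> x \<oplus>\<^bsub>M\<^esub> a \<cdot> z" if "y \<in> carrier M" for y
    using \<pi>_form[OF that] \<gamma>R[OF that k(1)] u by (intro bexI[of _ "u \<otimes> \<gamma> y k"]) auto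
  define w where "w = (\<pi> ^^ s) x"
  define p where "p = a [^]\<^bsub>R\<^esub> Suc s"
  have pR: "p \<in> carrier R" using aR by (simp add: p_def)
  let ?N = "(\<lambda>z. p \<cdot> z) ` carrier M"
  have pN: "submodule ?N R M" by (rule smult_image_submodule[OF pR])
  have p_mem: "p \<cdot> z \<in> ?N" if "z \<in> carrier M" for z using that by auto
  have aN: "a \<cdot> z \<in> N" if "z \<in> carrier M" for z using mN[OF a that] .
  have pmN: "p \<cdot> z \<in> N" if "z \<in> carrier M" for z
    using mN[of p z] max_ideal_mult[of "a [^]\<^bsub>R\<^esub> s" a] a aR that by (simp add: p_def)
  have wM: "w \<in> carrier M" unfolding w_def by (rule mod_homD(1)[OF mod_hom_funpow[OF \<pi>] xM])
  obtain zw where zw: "zw \<in> carrier M" "w = x \<oplus>\<^bsub>M\<^esub> a \<cdot> zw"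
    using funpow_fixes_mod[OF \<pi> xM aR fix_x, of s] unfolding w_def by auto
  obtain zw' where zw': "zw' \<in> carrier M" "(\<pi> ^^ Suc s) x = x \<oplus>\<^bsub>M\<^esub> a \<cdot> zw'"
    using funpow_fixes_mod[OF \<pi> xM aR fix_x, of "Suc s"] by auto
  define F where "F b y = (\<pi> ^^ Suc s) (\<phi> b y)" for b y
  have F: "F b \<in> mod_hom R M M" if b: "b \<in> B" for b
    unfolding F_def
    by (rule mod_homI) (use mod_homD[OF \<phi>(1)[OF b]] mod_homD[OF mod_hom_funpow[OF \<pi>, of "Suc s"]] in \<open>auto simp del: funpow.simps\<close>)
  have F_form: "\<exists>\<alpha>\<in>carrier R. \<exists>z\<in>carrier M. F b y = \<alpha> \<cdot> w \<oplus>\<^bsub>M\<^esub> p \<cdot> z \<and> \<alpha> \<ominus> \<gamma> y b \<in> max_ideal R"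
    if b: "b \<in> B" and y: "y \<in> carrier M" for b y
  proof -
    \<comment> \<open>Two expressions for \<open>F b y\<close> modulo \<open>\<mm> M\<close>, namely \<open>\<alpha> x\<close> and \<open>\<gamma> y b x\<close>, are compared.\<close>
    have "\<phi> b y \<in> carrier M" by (rule mod_homD(1)[OF \<phi>(1)[OF b] y])
    from funpow_image_cyclic_mod_power[OF \<pi> xM aR fix_x cyclic this, of s]
    obtain \<alpha> z where \<alpha>: "\<alpha> \<in> carrier R" "z \<in> carrier M" "F b y = \<alpha> \<cdot> w \<oplus>\<^bsub>M\<^esub> p \<cdot> z"
      unfolding w_def p_def F_def by blast
    from \<phi>(2)[OF b y] obtain z' where z': "z' \<in> carrier M" "\<phi> b y = \<gamma> y b \<cdot> x \<oplus>\<^bsub>M\<^esub> a \<cdot> z'" by auto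
    note D = mod_homD[OF mod_hom_funpow[OF \<pi>, of "Suc s"]]
    let ?g = "\<gamma> y b"
    have g: "?g \<in> carrier R" using \<gamma>R[OF y b] .
    let ?q = "?g \<cdot> zw' \<oplus>\<^bsub>M\<^esub> (\<pi> ^^ Suc s) z'"
    have q: "?q \<in> carrier M" using g zw'(1) D(1)[OF z'(1)] by simp
    have "F b y = ?g \<cdot> (\<pi> ^^ Suc s) x \<oplus>\<^bsub>M\<^esub> a \<cdot> (\<pi> ^^ Suc s) z'"
      unfolding F_def z'(2) using D z' g xM aR by (simp del: funpow.simps)
    also have "\<dots> = ?g \<cdot> x \<oplus>\<^bsub>M\<^esub> a \<cdot> ?q"
      unfolding zw'(2) using zw'(1) D(1)[OF z'(1)] g xM aR
      by (simp add: smult_r_distr smult_assoc1[symmetric] R.m_comm M.a_assoc del: funpow.simps)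
    finally have F1: "F b y = ?g \<cdot> x \<oplus>\<^bsub>M\<^esub> a \<cdot> ?q" .
    have F2: "F b y = \<alpha> \<cdot> x \<oplus>\<^bsub>M\<^esub> (a \<cdot> (\<alpha> \<cdot> zw) \<oplus>\<^bsub>M\<^esub> p \<cdot> z)"
      unfolding \<alpha>(3) zw(2) using \<alpha>(1,2) zw(1) xM aR pR
      by (simp add: smult_r_distr smult_assoc1[symmetric] R.m_comm M.a_assoc)
    let ?e = "a \<cdot> (\<alpha> \<cdot> zw) \<oplus>\<^bsub>M\<^esub> p \<cdot> z"
    have e: "?e \<in> N" by (rule submoduleE(5)[OF N aN pmN]) (use \<alpha> zw in auto)
    have eM: "?e \<in> carrier M" using \<alpha>(1,2) zw(1) aR pR by simp
    have "(\<alpha> \<ominus> ?g) \<cdot> x = \<alpha> \<cdot> x \<ominus>\<^bsub>M\<^esub> ?g \<cdot> x"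
      using \<alpha>(1) g xM by (simp add: R.minus_eq M.minus_eq smult_l_distr smult_l_minus)
    moreover have "\<alpha> \<cdot> x = F b y \<ominus>\<^bsub>M\<^esub> ?e"
      unfolding F2 using \<alpha>(1) xM eM by (simp add: M.minus_eq M.a_assoc M.r_neg del: M.add.inv_mult_group M.minus_add)
    moreover have "?g \<cdot> x = F b y \<ominus>\<^bsub>M\<^esub> a \<cdot> ?q"
      unfolding F1 using g xM aR q by (simp add: M.minus_eq M.a_assoc M.r_neg del: funpow.simps)
    moreover have "(f \<ominus>\<^bsub>M\<^esub> e) \<ominus>\<^bsub>M\<^esub> (f \<ominus>\<^bsub>M\<^esub> q) = q \<ominus>\<^bsub>M\<^esub> e"
      if fe: "f \<in> carrier M" "e \<in> carrier M" "q \<in> carrier M" for f e q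
    proof -
      have "(f \<ominus>\<^bsub>M\<^esub> e) \<ominus>\<^bsub>M\<^esub> (f \<ominus>\<^bsub>M\<^esub> q) = (f \<oplus>\<^bsub>M\<^esub> \<ominus>\<^bsub>M\<^esub> f) \<oplus>\<^bsub>M\<^esub> (q \<oplus>\<^bsub>M\<^esub> \<ominus>\<^bsub>M\<^esub> e)"
        using fe by (simp add: M.minus_eq M.minus_add M.a_ac)
      then show ?thesis using fe by (simp add: M.r_neg M.minus_eq)
    qed
    moreover have "F b y \<in> carrier M" by (rule mod_homD(1)[OF F[OF b] y])
    moreover have "a \<cdot> ?q \<in> carrier M" using aR q by (rule smult_closed)
    ultimately have "(\<alpha> \<ominus> ?g) \<cdot> x = a \<cdot> ?q \<ominus>\<^bsub>M\<^esub> ?e" using eM by presburger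
    also have "\<dots> \<in> N" by (rule submodule_diff[OF N aN[OF q] e])
    finally have "\<alpha> \<ominus> ?g \<in> max_ideal R" by (rule mem_max_ideal_if_smult_x[rotated]) (use \<alpha> g in auto)
    with \<alpha> show ?thesis by blast
  qed
  have \<gamma>_delta: "\<gamma> b' b \<ominus> (if b' = b then \<one> else \<zero>) \<in> max_ideal R" if bb: "b \<in> B" "b' \<in> B" for b b'
  proof -
    have b'M: "b' \<in> carrier M" using BM bb by auto
    have "(\<Oplus>\<^bsub>M\<^esub>b\<in>B. (if b = b' then \<one> else \<zero>) \<cdot> b) = b'"
      using comb_delta[OF B_fin bb(2) R.one_closed BM'] b'M by simp
    then have "(\<Oplus>\<^bsub>M\<^esub>b\<in>B. (\<gamma> b' b \<ominus> (if b = b' then \<one> else \<zero>)) \<cdot> b) = b' \<ominus>\<^bsub>M\<^esub> b'"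
      using comb_diff[OF B_fin \<gamma>(1)[OF b'M] _ BM', of "\<lambda>b. if b = b' then \<one> else \<zero>"] \<gamma>(2)[OF b'M] by simp
    then have "(\<lambda>b. \<gamma> b' b \<ominus> (if b = b' then \<one> else \<zero>)) \<in> relations R M B (\<lambda>b. b)"
      using \<gamma>(1)[OF b'M] b'M by (auto simp: relations_def M.minus_eq M.r_neg)
    from rel[OF this bb(1)] show ?thesis by (simp add: eq_commute)
  qed
  have main: "c b \<cdot> w \<in> ?N" if c: "c \<in> relations R M B (\<lambda>b. b)" and b: "b \<in> B" for c b
  proof -
    have cR: "c \<in> B \<rightarrow> carrier R" and c0: "(\<Oplus>\<^bsub>M\<^esub>i\<in>B. c i \<cdot> i) = \<zero>\<^bsub>M\<^esub>" using c by (auto simp: relations_def)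
    define v where "v = (\<lambda>b. c b \<cdot> w)"
    have vM: "v \<in> B \<rightarrow> carrier M" using cR wM by (auto simp: v_def)
    have "v b \<in> ?N"
    proof (rule nakayama[OF pN B_fin vM _ b])
      fix b assume b: "b \<in> B"
      have "\<forall>b'\<in>B. \<exists>\<alpha>. \<alpha> \<in> carrier R \<and> \<alpha> \<ominus> \<gamma> b' b \<in> max_ideal R \<and> (\<exists>z\<in>carrier M. F b b' = \<alpha> \<cdot> w \<oplus>\<^bsub>M\<^esub> p \<cdot> z)"
        using F_form[OF b BM] by blast
      then obtain \<alpha> where \<alpha>: "\<And>b'. b' \<in> B \<Longrightarrow> \<alpha> b' \<in> carrier R" "\<And>b'. b' \<in> B \<Longrightarrow> \<alpha> b' \<ominus> \<gamma> b' b \<in> max_ideal R"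
        "\<And>b'. b' \<in> B \<Longrightarrow> \<exists>z\<in>carrier M. F b b' = \<alpha> b' \<cdot> w \<oplus>\<^bsub>M\<^esub> p \<cdot> z"
        using bchoice[of B] by (metis (no_types, lifting))
      define \<mu> where "\<mu> b' = \<alpha> b' \<ominus> (if b' = b then \<one> else \<zero>)" for b'
      have \<mu>: "\<mu> \<in> B \<rightarrow> max_ideal R"
      proof
        fix b' assume b': "b' \<in> B"
        let ?d = "if b' = b then \<one> else \<zero>" and ?g = "\<gamma> b' b"
        have "\<mu> b' = (\<alpha> b' \<ominus> ?g) \<oplus> (?g \<ominus> ?d)"
        proof -
          have "(\<alpha> b' \<ominus> ?g) \<oplus> (?g \<ominus> d) = \<alpha> b' \<ominus> d" if "d \<in> carrier R" for d
            using that \<alpha>(1)[OF b'] \<gamma>R[OF BM[OF b'] b]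
            by (simp add: R.minus_eq R.a_assoc[symmetric]) (simp add: R.a_assoc R.l_neg)
          then show ?thesis by (simp add: \<mu>_def)
        qed
        then show "\<mu> b' \<in> max_ideal R" using max_ideal_add[OF \<alpha>(2)[OF b'] \<gamma>_delta[OF b b']] by simp
      qed
      have \<alpha>_eq: "\<alpha> b' = (if b' = b then \<one> else \<zero>) \<oplus> \<mu> b'" if b': "b' \<in> B" for b'
        using \<alpha>(1)[OF b'] by (auto simp: \<mu>_def R.minus_eq R.a_lcomm R.r_neg)
      have "(\<Oplus>\<^bsub>M\<^esub>b'\<in>B. \<alpha> b' \<cdot> v b') = (\<Oplus>\<^bsub>M\<^esub>b'\<in>B. ((if b' = b then \<one> else \<zero>) \<oplus> \<mu> b') \<cdot> v b')"
        by (rule comb_cong[OF \<alpha>_eq _ vM]) (use \<mu> in \<open>auto simp: Pi_iff\<close>)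
      also have "\<dots> = (\<Oplus>\<^bsub>M\<^esub>b'\<in>B. (if b' = b then \<one> else \<zero>) \<cdot> v b') \<oplus>\<^bsub>M\<^esub> (\<Oplus>\<^bsub>M\<^esub>b'\<in>B. \<mu> b' \<cdot> v b')"
        by (rule comb_add[OF _ _ vM]) (use \<mu> in \<open>auto simp: Pi_iff\<close>)
      also have "(\<Oplus>\<^bsub>M\<^esub>b'\<in>B. (if b' = b then \<one> else \<zero>) \<cdot> v b') = v b"
        using comb_delta[OF B_fin b R.one_closed vM] vM b by (auto simp: Pi_iff)
      finally have \<alpha>v: "(\<Oplus>\<^bsub>M\<^esub>b'\<in>B. \<alpha> b' \<cdot> v b') = v b \<oplus>\<^bsub>M\<^esub> (\<Oplus>\<^bsub>M\<^esub>b'\<in>B. \<mu> b' \<cdot> v b')" .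
      define n where "n b' = c b' \<cdot> F b b' \<ominus>\<^bsub>M\<^esub> \<alpha> b' \<cdot> v b'" for b'
      have FM: "F b b' \<in> carrier M" if "b' \<in> B" for b' using mod_homD(1)[OF F[OF b] BM[OF that]] .
      have nN: "n b' \<in> ?N" if b': "b' \<in> B" for b'
      proof -
        from \<alpha>(3)[OF b'] obtain z where z: "z \<in> carrier M" "F b b' = \<alpha> b' \<cdot> w \<oplus>\<^bsub>M\<^esub> p \<cdot> z" by auto
        have cb: "c b' \<in> carrier R" using cR b' by auto
        have eq1: "c b' \<cdot> F b b' = \<alpha> b' \<cdot> v b' \<oplus>\<^bsub>M\<^esub> p \<cdot> (c b' \<cdot> z)"
          unfolding z(2) v_def using z(1) cb \<alpha>(1)[OF b'] wM pR
          by (simp add: smult_r_distr smult_assoc1[symmetric] R.m_comm)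
        have "n b' = p \<cdot> (c b' \<cdot> z)"
        proof -
          have "(y \<oplus>\<^bsub>M\<^esub> y') \<ominus>\<^bsub>M\<^esub> y = y'" if "y \<in> carrier M" "y' \<in> carrier M" for y y'
            using that M.a_comm[of y y'] by (simp add: M.minus_eq M.a_assoc M.r_neg)
          then show ?thesis
            unfolding n_def eq1 using z(1) cb \<alpha>(1)[OF b'] vM b' pR by (simp add: Pi_iff)
        qed
        then show ?thesis using z(1) cb by auto
      qed
      have nM: "n b' \<in> carrier M" if "b' \<in> B" for b' using nN[OF that] submoduleE(1)[OF pN] by blast
      have "\<zero>\<^bsub>M\<^esub> = F b (\<Oplus>\<^bsub>M\<^esub>i\<in>B. c i \<cdot> i)" using mod_hom_zero[OF M M F[OF b]] c0 by simp
      also have "\<dots> = (\<Oplus>\<^bsub>M\<^esub>b'\<in>B. c b' \<cdot> F b b')" by (rule mod_hom_comb[OF M M F[OF b] B_fin cR BM'])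
      also have "\<dots> = (\<Oplus>\<^bsub>M\<^esub>b'\<in>B. \<alpha> b' \<cdot> v b' \<oplus>\<^bsub>M\<^esub> n b')"
      proof (rule M.finsum_cong')
        fix b' assume b': "b' \<in> B"
        have "c b' \<cdot> F b b' \<in> carrier M" "\<alpha> b' \<cdot> v b' \<in> carrier M"
          using cR FM[OF b'] \<alpha>(1)[OF b'] vM b' by (auto simp: Pi_iff)
        moreover have "y = y' \<oplus>\<^bsub>M\<^esub> (y \<ominus>\<^bsub>M\<^esub> y')" if "y \<in> carrier M" "y' \<in> carrier M" for y y'
          using that M.a_comm[of y' "y \<ominus>\<^bsub>M\<^esub> y'"] by (simp add: M.minus_eq M.a_assoc M.l_neg)
        ultimately show "c b' \<cdot> F b b' = \<alpha> b' \<cdot> v b' \<oplus>\<^bsub>M\<^esub> n b'"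
          unfolding n_def by blast
      qed (use nM \<alpha>(1) vM in \<open>auto simp: Pi_iff\<close>)
      also have "\<dots> = (\<Oplus>\<^bsub>M\<^esub>b'\<in>B. \<alpha> b' \<cdot> v b') \<oplus>\<^bsub>M\<^esub> (\<Oplus>\<^bsub>M\<^esub>b'\<in>B. n b')"
        by (rule M.finsum_addf) (use nM \<alpha>(1) vM in \<open>auto simp: Pi_iff\<close>)
      finally have sum: "(\<Oplus>\<^bsub>M\<^esub>b'\<in>B. \<alpha> b' \<cdot> v b') \<oplus>\<^bsub>M\<^esub> (\<Oplus>\<^bsub>M\<^esub>b'\<in>B. n b') \<in> ?N"
        using submodule_zero[OF pN] by simp
      have "(\<Oplus>\<^bsub>M\<^esub>b'\<in>B. n b') \<in> ?N" by (rule submodule_finsum[OF pN]) (use nN in blast)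
      from this sum have "(\<Oplus>\<^bsub>M\<^esub>b'\<in>B. \<alpha> b' \<cdot> v b') \<in> ?N"
        by (rule mem_submodule_if_add_mem[OF pN]) (rule comb_closed, use \<alpha>(1) vM in auto)
      then show "\<exists>\<mu>\<in>B \<rightarrow> max_ideal R. v b \<oplus>\<^bsub>M\<^esub> (\<Oplus>\<^bsub>M\<^esub>i\<in>B. \<mu> i \<cdot> v i) \<in> ?N"
        unfolding \<alpha>v using \<mu> by (intro bexI[of _ \<mu>])
    qed
    then show ?thesis by (simp only: v_def)
  qed
  show ?thesis
    by (rule bexI[OF _ wM]) (use zw main in \<open>auto simp: p_def simp del: nat_pow_Suc\<close>)
qed

end

section \<open>From the killed relations to freeness\<close>

context burch_data
begin

text \<open>The ascending submodules \<open>U\<^sub>k = {v. a\<^sup>k v \<in> d M}\<close> stabilize; let \<open>U\<^sub>k\<^sub>+\<^sub>1 = U\<^sub>k\<close>. If \<open>d w = a\<^sup>k\<^sup>+\<^sup>1 v\<close>, then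
  \<open>a\<^sup>k v = d u\<close> for some \<open>u\<close>, so \<open>d w = d a u\<close> and \<open>w = a u\<close>. But \<open>w\<close> is congruent to \<open>x\<close> modulo \<open>a\<close>, and \<open>x \<notin> a M\<close>. This
  is the Artin-Rees argument for the principal ideal of \<open>a\<close>.\<close>

lemma not_all_multiples_in_powers:
  assumes d: "d \<in> carrier R" "\<And>v. v \<in> carrier M \<Longrightarrow> d \<cdot> v = \<zero>\<^bsub>M\<^esub> \<Longrightarrow> v = \<zero>\<^bsub>M\<^esub>"
    and w: "\<And>s. w s \<in> carrier M" "\<And>s. \<exists>z\<in>carrier M. w s = x \<oplus>\<^bsub>M\<^esub> a \<cdot> z"
    and dw: "\<And>s::nat. d \<cdot> w s \<in> (\<lambda>z. (a [^]\<^bsub>R\<^esub> Suc s) \<cdot> z) ` carrier M"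
  shows False
proof -
  have aR: "a \<in> carrier R" by (rule aR)
  let ?D = "(\<lambda>z. d \<cdot> z) ` carrier M"
  have D: "submodule ?D R M" by (rule smult_image_submodule[OF d(1)])
  define U where "U k = {v \<in> carrier M. (a [^]\<^bsub>R\<^esub> k) \<cdot> v \<in> ?D}" for k :: nat
  have U: "submodule (U k) R M" for k
  proof (rule submodule_if_closed)
    fix r v assume r: "r \<in> carrier R" and v: "v \<in> U k"
    then have vM: "v \<in> carrier M" by (simp add: U_def)
    have "(a [^]\<^bsub>R\<^esub> k) \<cdot> (r \<cdot> v) = r \<cdot> ((a [^]\<^bsub>R\<^esub> k) \<cdot> v)"
      using r vM aR by (simp add: smult_assoc1[symmetric] R.m_comm)
    also have "\<dots> \<in> ?D" by (rule submoduleE(4)[OF D r]) (use v in \<open>simp add: U_def\<close>)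
    finally show "r \<cdot> v \<in> U k" using r vM by (simp add: U_def)
  next
    fix v v' assume v: "v \<in> U k" "v' \<in> U k"
    then have vM: "v \<in> carrier M" "v' \<in> carrier M" by (auto simp: U_def)
    have "(a [^]\<^bsub>R\<^esub> k) \<cdot> (v \<oplus>\<^bsub>M\<^esub> v') = (a [^]\<^bsub>R\<^esub> k) \<cdot> v \<oplus>\<^bsub>M\<^esub> (a [^]\<^bsub>R\<^esub> k) \<cdot> v'"
      using vM aR by (simp add: smult_r_distr)
    also have "\<dots> \<in> ?D" by (rule submoduleE(5)[OF D]) (use v in \<open>simp_all add: U_def\<close>)
    finally show "v \<oplus>\<^bsub>M\<^esub> v' \<in> U k" using vM by (simp add: U_def)
  qed (use submodule_zero[OF D] aR in \<open>auto simp: U_def\<close>)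
  have U_mono: "U k \<subseteq> U (Suc k)" for k
  proof
    fix v assume v: "v \<in> U k"
    then have vM: "v \<in> carrier M" by (simp add: U_def)
    have "(a [^]\<^bsub>R\<^esub> Suc k) \<cdot> v = a \<cdot> ((a [^]\<^bsub>R\<^esub> k) \<cdot> v)"
      using vM aR by (simp add: smult_assoc1[symmetric] R.m_comm)
    also have "\<dots> \<in> ?D" by (rule submoduleE(4)[OF D aR]) (use v in \<open>simp add: U_def\<close>)
    finally show "v \<in> U (Suc k)" using vM by (simp add: U_def)
  qed
  have "\<exists>k. \<forall>l\<ge>k. U l \<inter> {\<Oplus>\<^bsub>M\<^esub>b\<in>B. c b \<cdot> b | c. c \<in> B \<rightarrow> carrier R} \<subseteq> U k"
    by (rule submodule_chain_stabilizes_on_span[where N = U and B = B]) (use U U_mono B_fin BM in blast)+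
  then obtain k where "U (Suc k) \<inter> {\<Oplus>\<^bsub>M\<^esub>b\<in>B. c b \<cdot> b | c. c \<in> B \<rightarrow> carrier R} \<subseteq> U k"
    using le_Suc_eq by blast
  moreover have "v \<in> {\<Oplus>\<^bsub>M\<^esub>b\<in>B. c b \<cdot> b | c. c \<in> B \<rightarrow> carrier R}" if "v \<in> carrier M" for v
    using B that unfolding generates_def by blast
  ultimately have stable: "v \<in> U k" if "v \<in> U (Suc k)" for v using that unfolding U_def by blast
  from dw[of k] obtain v where v: "v \<in> carrier M" "d \<cdot> w k = (a [^]\<^bsub>R\<^esub> Suc k) \<cdot> v" by blast
  have "v \<in> U (Suc k)"
    unfolding U_def using v(1) v(2)[symmetric] w(1)[of k] by (simp del: nat_pow_Suc)
  from stable[OF this] obtain u where u: "u \<in> carrier M" "(a [^]\<^bsub>R\<^esub> k) \<cdot> v = d \<cdot> u" by (auto simp: U_def)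
  have "d \<cdot> w k = a \<cdot> ((a [^]\<^bsub>R\<^esub> k) \<cdot> v)"
    unfolding v(2) using v(1) aR by (simp add: smult_assoc1[symmetric] R.m_comm)
  also have "\<dots> = d \<cdot> (a \<cdot> u)"
    unfolding u(2) using u(1) aR d(1) by (simp add: smult_assoc1[symmetric] R.m_comm)
  finally have eq: "d \<cdot> w k = d \<cdot> (a \<cdot> u)" .
  have auM: "a \<cdot> u \<in> carrier M" using aR u(1) by (rule smult_closed)
  have "d \<cdot> (w k \<ominus>\<^bsub>M\<^esub> a \<cdot> u) = d \<cdot> w k \<ominus>\<^bsub>M\<^esub> d \<cdot> (a \<cdot> u)"
    using d(1) w(1)[of k] auM by (simp add: M.minus_eq smult_r_distr smult_r_minus)
  also have "\<dots> = \<zero>\<^bsub>M\<^esub>" unfolding eq using d(1) auM by (simp add: M.minus_eq M.r_neg)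
  finally have "w k \<ominus>\<^bsub>M\<^esub> a \<cdot> u = \<zero>\<^bsub>M\<^esub>" by (rule d(2)[rotated]) (use w(1) auM in simp)
  then have "w k = a \<cdot> u" by (rule eq_if_minus_eq_zero[OF w(1) auM])
  then have "w k \<in> N" using mN[OF a u(1)] by simp
  moreover obtain z where z: "z \<in> carrier M" "w k = x \<oplus>\<^bsub>M\<^esub> a \<cdot> z" using w(2) by blast
  ultimately have "x \<oplus>\<^bsub>M\<^esub> a \<cdot> z \<in> N" by simp
  from mem_submodule_if_add_mem[OF N mN[OF a z(1)] this xM] xN show False by simp
qed

text \<open>The ideal \<open>J\<close> of the elements that send \<open>w\<^sub>s\<close> into \<open>a\<^sup>s\<^sup>+\<^sup>1 M\<close> for all \<open>s\<close> contains the coefficients of the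
  relations. It contains no nonzerodivisor on \<open>M\<close>, hence none of the ring, since \<open>M\<close> is torsion-free.\<close>

lemma relations_in_associated_prime:
  assumes tf: "torsion_free R M"
  shows "\<exists>P\<in>associated_primes R (regular_module R). \<forall>c\<in>relations R M B (\<lambda>b. b). \<forall>b\<in>B. c b \<in> P"
proof -
  have "\<exists>w. \<forall>s::nat. w s \<in> carrier M \<and> (\<exists>z\<in>carrier M. w s = x \<oplus>\<^bsub>M\<^esub> a \<cdot> z) \<and>
    (\<forall>c\<in>relations R M B (\<lambda>b. b). \<forall>b\<in>B. c b \<cdot> w s \<in> (\<lambda>z. (a [^]\<^bsub>R\<^esub> Suc s) \<cdot> z) ` carrier M)"
    by (rule choice, rule allI) (use ex_near_x_killed_by_relations in \<open>simp only: Bex_def\<close>)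
  then obtain w where w_all: "\<forall>s::nat. w s \<in> carrier M \<and> (\<exists>z\<in>carrier M. w s = x \<oplus>\<^bsub>M\<^esub> a \<cdot> z) \<and>
    (\<forall>c\<in>relations R M B (\<lambda>b. b). \<forall>b\<in>B. c b \<cdot> w s \<in> (\<lambda>z. (a [^]\<^bsub>R\<^esub> Suc s) \<cdot> z) ` carrier M)" ..
  have w: "w s \<in> carrier M" "\<exists>z\<in>carrier M. w s = x \<oplus>\<^bsub>M\<^esub> a \<cdot> z" for s using w_all by blast+
  let ?A = "\<lambda>s. (\<lambda>z. (a [^]\<^bsub>R\<^esub> Suc s) \<cdot> z) ` carrier M"
  have A: "submodule (?A s) R M" for s :: nat by (rule smult_image_submodule) (use aR in simp)
  define J where "J = {d \<in> carrier R. \<forall>s. d \<cdot> w s \<in> ?A s}"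
  have J: "ideal J R"
  proof (rule R.ideal_if_closed)
    show "\<zero> \<in> J" unfolding J_def using submodule_zero[OF A] w(1) by (simp del: nat_pow_Suc)
    fix d e assume "d \<in> J" "e \<in> J"
    then show "d \<oplus> e \<in> J"
      unfolding J_def using submoduleE(5)[OF A] w(1) by (simp add: smult_l_distr del: nat_pow_Suc)
  next
    fix r d assume "r \<in> carrier R" "d \<in> J"
    then show "r \<otimes> d \<in> J"
      unfolding J_def using submoduleE(4)[OF A] w(1) by (simp add: smult_assoc1 del: nat_pow_Suc)
  qed (auto simp: J_def)
  have "\<exists>z\<in>carrier R - {\<zero>}. d \<otimes> z = \<zero>" if d: "d \<in> J" for d
  proof (rule ccontr)
    have dR: "d \<in> carrier R" using d by (simp add: J_def)
    assume "\<not> ?thesis"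
    then have "non_zero_divisor_on R (regular_module R) d" using dR by (auto simp: non_zero_divisor_on_def)
    with tf have "non_zero_divisor_on R M d" by (simp add: torsion_free_def)
    then show False
      by (intro not_all_multiples_in_powers[of d w]) (use dR w d in \<open>auto simp: non_zero_divisor_on_def J_def simp del: nat_pow_Suc\<close>)
  qed
  from zero_divisor_ideal_le_associated_prime[OF J this]
  obtain P where P: "P \<in> associated_primes R (regular_module R)" "J \<subseteq> P" by blast
  have "c b \<in> J" if c: "c \<in> relations R M B (\<lambda>b. b)" and b: "b \<in> B" for c b
  proof -
    have "c b \<in> carrier R" using c b by (auto simp: relations_def)
    moreover have "c b \<cdot> w s \<in> ?A s" for s using w_all c b by blast
    ultimately show ?thesis by (simp add: J_def)
  qed
  with P show ?thesis by blast
qed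

lemma spans_at_B:
  assumes "primeideal P R"
  shows "spans_at R M P B (\<lambda>b. b)"
  unfolding spans_at_def
proof
  note one = R.one_notin_primeideal[OF assms]
  fix y assume y: "y \<in> carrier M"
  with B obtain c where "c \<in> B \<rightarrow> carrier R" "y = (\<Oplus>\<^bsub>M\<^esub>b\<in>B. c b \<cdot> b)" unfolding generates_def by blast
  with y one show "\<exists>u\<in>carrier R - P. \<exists>c\<in>B \<rightarrow> carrier R. u \<cdot> y = (\<Oplus>\<^bsub>M\<^esub>b\<in>B. c b \<cdot> b)"
    by (intro bexI[of _ \<one>] bexI[of _ c]) auto
qed

text \<open>If \<open>y = \<Sum>\<^sub>i d\<^sub>i i\<close>, then subtracting \<open>d\<^sub>b\<close> times the relation from \<open>c\<^sub>b y\<close> eliminates \<open>b\<close>, and \<open>c\<^sub>b\<close> is a valid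
  denominator.\<close>

lemma spans_at_B_Diff:
  assumes P: "primeideal P R" and c: "c \<in> relations R M B (\<lambda>b. b)" and b: "b \<in> B" "c b \<notin> P"
  shows "spans_at R M P (B - {b}) (\<lambda>b. b)"
  unfolding spans_at_def
proof
  have BM': "(\<lambda>b. b) \<in> B \<rightarrow> carrier M" using BM by auto
  have cR: "c \<in> B \<rightarrow> carrier R" and c0: "(\<Oplus>\<^bsub>M\<^esub>i\<in>B. c i \<cdot> i) = \<zero>\<^bsub>M\<^esub>" using c by (auto simp: relations_def)
  have cb: "c b \<in> carrier R" using cR b by auto
  fix y assume y: "y \<in> carrier M"
  with B obtain d where d: "d \<in> B \<rightarrow> carrier R" "y = (\<Oplus>\<^bsub>M\<^esub>b\<in>B. d b \<cdot> b)" unfolding generates_def by blast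
  have db: "d b \<in> carrier R" using d b by auto
  let ?e = "\<lambda>i. c b \<otimes> d i \<ominus> d b \<otimes> c i"
  have eR: "?e \<in> B \<rightarrow> carrier R" using cR d cb db by auto
  have "(\<Oplus>\<^bsub>M\<^esub>i\<in>B. ?e i \<cdot> i) = (\<Oplus>\<^bsub>M\<^esub>i\<in>B. (c b \<otimes> d i) \<cdot> i) \<ominus>\<^bsub>M\<^esub> (\<Oplus>\<^bsub>M\<^esub>i\<in>B. (d b \<otimes> c i) \<cdot> i)"
    by (rule comb_diff[OF B_fin _ _ BM']) (use cR d cb db in auto)
  also have "\<dots> = c b \<cdot> y"
    using comb_smult[OF B_fin cb d(1) BM'] comb_smult[OF B_fin db cR BM'] c0 d(2)[symmetric] cb db y
    by (simp add: M.minus_eq)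
  finally have "c b \<cdot> y = ?e b \<cdot> b \<oplus>\<^bsub>M\<^esub> (\<Oplus>\<^bsub>M\<^esub>i\<in>B - {b}. ?e i \<cdot> i)"
    using comb_remove[OF B_fin b(1) eR BM'] by simp
  moreover have "?e b = \<zero>" using cb db by (simp add: R.m_comm[of "c b"] R.minus_eq R.r_neg)
  moreover have "(\<Oplus>\<^bsub>M\<^esub>i\<in>B - {b}. ?e i \<cdot> i) \<in> carrier M" by (rule comb_closed) (use eR BM in auto)
  ultimately have "c b \<cdot> y = (\<Oplus>\<^bsub>M\<^esub>i\<in>B - {b}. ?e i \<cdot> i)" using BM[OF b(1)] by simp
  moreover have "?e \<in> B - {b} \<rightarrow> carrier R" using eR by auto
  ultimately show "\<exists>u\<in>carrier R - P. \<exists>c\<in>B - {b} \<rightarrow> carrier R. u \<cdot> y = (\<Oplus>\<^bsub>M\<^esub>b\<in>B - {b}. c b \<cdot> b)"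
    using cb b(2) by (intro bexI[of _ "c b"] bexI[of _ ?e]) simp_all
qed

text \<open>At one associated prime \<open>B\<close> is a minimal generating system, so \<open>B\<close> has at most as many elements as the rank. If
  a relation had a coefficient outside another associated prime, one generator would be superfluous there, and the rank
  would be smaller.\<close>

lemma relations_zero:
  assumes tf: "torsion_free R M" and rank: "has_rank R M"
    and c: "c \<in> relations R M B (\<lambda>b. b)" and b: "b \<in> B"
  shows "c b = \<zero>"
proof -
  have BM': "(\<lambda>b. b) \<in> B \<rightarrow> carrier M" using BM by auto
  have prime: "primeideal P R" if "P \<in> associated_primes R (regular_module R)" for P
    using that by (simp add: associated_primes_def)
  from rank obtain r :: nat where r: "\<forall>P\<in>associated_primes R (regular_module R).
    mod_isomorphic (loc_ring R P) (loc_module R P M) (free_module (loc_ring R P) {..<r})" unfolding has_rank_def ..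
  have basis: "\<exists>e. basis_at R M P {..<r} e" if "P \<in> associated_primes R (regular_module R)" for P
    using basis_at_if_loc_free[OF prime[OF that] bspec[OF r that]] .
  obtain P0 where P0: "P0 \<in> associated_primes R (regular_module R)"
    "\<And>c b. c \<in> relations R M B (\<lambda>b. b) \<Longrightarrow> b \<in> B \<Longrightarrow> c b \<in> P0"
    using relations_in_associated_prime[OF tf] by blast
  have card_B: "card B \<le> r"
  proof -
    obtain e where e: "basis_at R M P0 {..<r} e" using basis[OF P0(1)] ..
    have "card B \<le> card {..<r}"
      by (rule card_le_if_relations_in_prime[OF prime[OF P0(1)] B_fin BM' spans_at_B[OF prime[OF P0(1)]], where f = e])
        (use P0(2) e in \<open>auto simp: basis_at_def\<close>)
    then show ?thesis by simp
  qed
  have rel_in: "c b \<in> Q" if Q: "Q \<in> associated_primes R (regular_module R)"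
    and c: "c \<in> relations R M B (\<lambda>b. b)" and b: "b \<in> B" for Q c b
  proof (rule ccontr)
    assume cb: "c b \<notin> Q"
    obtain e where e: "basis_at R M Q {..<r} e" using basis[OF Q] ..
    have Qi: "ideal Q R" using primeideal.axioms(1)[OF prime[OF Q]] .
    have "card {..<r} \<le> card (B - {b})"
    proof (rule card_le_if_relations_in_prime[OF prime[OF Q]])
      show "finite {..<r}" "e \<in> {..<r} \<rightarrow> carrier M" "spans_at R M Q {..<r} e" using e by (simp_all add: basis_at_def)
      show "spans_at R M Q (B - {b}) (\<lambda>b. b)" by (rule spans_at_B_Diff[OF prime[OF Q] c b cb])
      fix d i assume d: "d \<in> relations R M {..<r} e" and i: "i \<in> {..<r}"
      have di: "d i \<in> carrier R" using d i by (auto simp: relations_def)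
      from e d i obtain v where v: "v \<in> carrier R - Q" "v \<otimes> d i = \<zero>" unfolding basis_at_def by blast
      have "v \<otimes> d i \<in> Q" using v(2) additive_subgroup.zero_closed[OF ideal.axioms(1)[OF Qi]] by simp
      then show "d i \<in> Q" using primeideal.I_prime[OF prime[OF Q], of v "d i"] v(1) di by auto
    qed (use B_fin BM in auto)
    moreover have "card (B - {b}) < card B" by (rule card_Diff1_less[OF B_fin b])
    ultimately show False using card_B by simp
  qed
  show ?thesis
    by (rule relations_trivial[where f = "\<lambda>b. b" and J = "{..<r}" and B = B and c = c and b = b])
      (fact B_fin BM' spans_at_B[OF prime] rel_in basis c b)+
qed

end

lemma (in module) is_free_if_no_relations:
  assumes B: "generates R M B" and zero: "\<And>c b. c \<in> relations R M B (\<lambda>b. b) \<Longrightarrow> b \<in> B \<Longrightarrow> c b = \<zero>"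
  shows "is_free R M"
proof -
  have fin: "finite B" and BM: "B \<subseteq> carrier M" and BM': "(\<lambda>b. b) \<in> B \<rightarrow> carrier M"
    using B by (auto simp: generates_def)
  let ?F = "free_module R B"
  interpret F: module R ?F by (rule R.module_free_module)
  have lc: "lincomb R M f = (\<Oplus>\<^bsub>M\<^esub>b\<in>B. f b \<cdot> b)" if "f \<in> carrier ?F" for f
    unfolding lincomb_eq_free_lift
    by (rule free_lift_eq_sum[OF that BM' fin]) (use free_module_carrierD[OF that] in auto)
  have "bij_betw (lincomb R M) (carrier ?F) (carrier M)"
  proof (rule bij_betwI')
    fix f g assume f: "f \<in> carrier ?F" and g: "g \<in> carrier ?F"
    note fD = free_module_carrierD[OF f] and gD = free_module_carrierD[OF g]
    show "(lincomb R M f = lincomb R M g) = (f = g)"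
    proof
      assume eq: "lincomb R M f = lincomb R M g"
      have "(\<Oplus>\<^bsub>M\<^esub>b\<in>B. (f b \<ominus> g b) \<cdot> b) = lincomb R M f \<ominus>\<^bsub>M\<^esub> lincomb R M g"
        unfolding lc[OF f] lc[OF g] by (rule comb_diff[OF fin _ _ BM']) (use fD gD in auto)
      also have "\<dots> = \<zero>\<^bsub>M\<^esub>"
        unfolding eq using mod_homD(1)[OF lincomb_hom[OF BM] g] by (simp add: M.minus_eq M.r_neg)
      finally have rel: "(\<lambda>b. f b \<ominus> g b) \<in> relations R M B (\<lambda>b. b)"
        using fD gD by (auto simp: relations_def)
      show "f = g"
      proof
        fix b
        show "f b = g b"
        proof (cases "b \<in> B")
          case True
          from zero[OF rel True] show ?thesis using fD(1)[of b] gD(1)[of b] by simp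
        qed (use fD(4) gD(4) in simp)
      qed
    qed simp
  next
    fix f assume "f \<in> carrier ?F"
    then show "lincomb R M f \<in> carrier M" by (rule mod_homD(1)[OF lincomb_hom[OF BM]])
  next
    fix y assume "y \<in> carrier M"
    with B obtain c where c: "c \<in> B \<rightarrow> carrier R" "y = (\<Oplus>\<^bsub>M\<^esub>b\<in>B. c b \<cdot> b)" unfolding generates_def by blast
    let ?f = "\<lambda>b. if b \<in> B then c b else \<zero>"
    have f: "?f \<in> carrier ?F"
      using c fin finite_subset[of "{x. ?f x \<noteq> \<zero>}" B] by (auto simp: free_module_def)
    have "y = lincomb R M ?f"
      unfolding lc[OF f] c(2) by (rule comb_cong[OF _ _ BM']) (use c in auto)
    with f show "\<exists>f\<in>carrier ?F. y = lincomb R M f" by blast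
  qed
  with BM show ?thesis by (auto simp: is_free_def is_basis_def)
qed

section \<open>Discrete valuation rings\<close>

text \<open>The main point is that every nonzero element is a unit times a power of \<open>a\<close>. Otherwise choose a counterexample \<open>y\<close> with
  \<open>y R\<close> maximal. It is not a unit, so \<open>y = a s\<close>, and \<open>s\<close> is another counterexample. Hence \<open>s R = y R\<close>, so
  \<open>s = t a s\<close> for some \<open>t\<close>, and \<open>s = 0\<close> since \<open>1 - t a\<close> is a unit.\<close>

lemma (in noetherian_local_ring) discrete_valuation_ring_if_principal_max_ideal:
  assumes a: "a \<in> max_ideal R" and principal: "\<And>r. r \<in> max_ideal R \<Longrightarrow> \<exists>s\<in>carrier R. r = a \<otimes> s"
    and nzd: "\<And>z. z \<in> carrier R \<Longrightarrow> a \<otimes> z = \<zero> \<Longrightarrow> z = \<zero>"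
  shows "discrete_valuation_ring R"
proof -
  have aR: "a \<in> carrier R" using a by simp
  have one: "\<one> \<noteq> \<zero>" using one_notin_max_ideal max_ideal_zero by metis
  have nzd_pow: "z = \<zero>" if "z \<in> carrier R" "a [^] (n::nat) \<otimes> z = \<zero>" for z n
    using that
  proof (induction n arbitrary: z)
    case (Suc n)
    have "a [^] n \<otimes> (a \<otimes> z) = \<zero>" using Suc.prems aR by (simp add: m_assoc)
    with Suc.IH[of "a \<otimes> z"] have "a \<otimes> z = \<zero>" using Suc.prems(1) aR by simp
    with nzd Suc.prems(1) show ?case by blast
  qed simp
  define rep where "rep y \<longleftrightarrow> (\<exists>n::nat. \<exists>u\<in>Units R. y = a [^] n \<otimes> u)" for y
  have rep: "rep y" if y: "y \<in> carrier R" "y \<noteq> \<zero>" for y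
  proof (rule ccontr)
    assume "\<not> rep y"
    define Y where "Y = {y \<in> carrier R. y \<noteq> \<zero> \<and> \<not> rep y}"
    have "Y \<noteq> {}" using y \<open>\<not> rep y\<close> by (auto simp: Y_def)
    moreover have "ideal (PIdl y) R" if "y \<in> Y" for y using that by (intro cgenideal_ideal) (simp add: Y_def)
    ultimately have "\<exists>y\<in>Y. \<forall>z\<in>Y. PIdl y \<subseteq> PIdl z \<longrightarrow> PIdl z = PIdl y"
      by (rule ex_maximal_ideal_in_family[of Y "\<lambda>y. PIdl y"]) blast+
    then obtain y where y: "y \<in> Y" and max: "\<forall>z\<in>Y. PIdl y \<subseteq> PIdl z \<longrightarrow> PIdl z = PIdl y" ..
    have yR: "y \<in> carrier R" "y \<noteq> \<zero>" "\<not> rep y" using y by (auto simp: Y_def)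
    have "y \<notin> Units R"
    proof
      assume "y \<in> Units R"
      then have "rep y" unfolding rep_def by (intro exI[of _ 0] bexI[of _ y]) (use yR in auto)
      with yR show False by simp
    qed
    then have "y \<in> max_ideal R" using unit_if_notin_max_ideal yR(1) by blast
    from principal[OF this] obtain s where s: "s \<in> carrier R" "y = a \<otimes> s" ..
    have s0: "s \<noteq> \<zero>" using s yR aR by auto
    have "\<not> rep s"
    proof
      assume "rep s"
      then obtain n u where "u \<in> Units R" "s = a [^] (n::nat) \<otimes> u" by (auto simp: rep_def)
      then have "y = a [^] Suc n \<otimes> u" using s aR by (simp add: m_ac Units_closed)
      with \<open>u \<in> Units R\<close> have "rep y" unfolding rep_def by blast
      with yR show False by simp
    qed
    then have "s \<in> Y" using s s0 by (simp add: Y_def)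
    moreover have "PIdl y \<subseteq> PIdl s"
      by (rule cgenideal_minimal[OF cgenideal_ideal[OF s(1)]]) (use s aR in \<open>auto simp: cgenideal_def\<close>)
    ultimately have "PIdl s = PIdl y" using max by blast
    with cgenideal_self[OF s(1)] obtain t where t: "t \<in> carrier R" "s = t \<otimes> y" by (auto simp: cgenideal_def)
    define q where "q = \<one> \<oplus> \<ominus> (t \<otimes> a)"
    have qR: "q \<in> carrier R" using t aR by (simp add: q_def)
    have "q \<otimes> s = s \<oplus> \<ominus> (t \<otimes> (a \<otimes> s))" using t(1) aR s(1) by (simp add: q_def l_distr l_minus m_assoc)
    also have "\<dots> = \<zero>" using t(2) s by (simp add: r_neg)
    finally have qs: "q \<otimes> s = \<zero>" .
    have "q \<notin> max_ideal R"
      unfolding q_def by (rule notin_max_ideal_add[OF one_closed one_notin_max_ideal max_ideal_minus[OF max_ideal_mult[OF t(1) a]]])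
    then obtain q' where q': "q' \<in> carrier R" "q' \<otimes> q = \<one>"
      using unit_if_notin_max_ideal[OF qR] by (auto simp: Units_def)
    have "s = (q' \<otimes> q) \<otimes> s" using q' s by simp
    also have "\<dots> = q' \<otimes> (q \<otimes> s)" by (rule m_assoc[OF q'(1) qR s(1)])
    finally show False using qs q' s0 by simp
  qed
  have "domain R"
  proof (rule domain.intro[OF is_cring domain_axioms.intro[OF one]])
    fix y z assume yz: "y \<otimes> z = \<zero>" "y \<in> carrier R" "z \<in> carrier R"
    show "y = \<zero> \<or> z = \<zero>"
    proof (rule ccontr)
      assume "\<not> ?thesis"
      then obtain n u where u: "u \<in> Units R" "y = a [^] (n::nat) \<otimes> u" and z: "z \<noteq> \<zero>"
        using rep[of y] yz by (auto simp: rep_def)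
      have "a [^] n \<otimes> (u \<otimes> z) = \<zero>" using u yz aR by (simp add: m_assoc Units_closed)
      then have uz: "u \<otimes> z = \<zero>" using nzd_pow[of "u \<otimes> z" n] u yz by (simp add: Units_closed)
      obtain u' where u': "u' \<in> carrier R" "u' \<otimes> u = \<one>" using u by (auto simp: Units_def)
      have "z = u' \<otimes> (u \<otimes> z)" using u' u yz by (simp add: m_assoc[symmetric] Units_closed)
      with uz u' z show False by simp
    qed
  qed
  moreover have "\<exists>g\<in>carrier R. I = PIdl g" if I: "ideal I R" for I
  proof (cases "I = {\<zero>}")
    case True
    have "PIdl \<zero> = {\<zero>}" unfolding cgenideal_def by (auto intro: exI[of _ \<zero>])
    with True show ?thesis by (intro bexI[of _ \<zero>]) simp_all
  next
    case False
    have power_mem: "\<exists>n u. u \<in> carrier R \<and> y = a [^] (n::nat) \<otimes> u \<and> a [^] n \<in> I" if y: "y \<in> I" "y \<noteq> \<zero>" for y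
    proof -
      obtain n u where u: "u \<in> Units R" "y = a [^] (n::nat) \<otimes> u"
        using rep[of y] y ideal.Icarr[OF I y(1)] by (auto simp: rep_def)
      obtain u' where u': "u' \<in> carrier R" "u \<otimes> u' = \<one>" using u by (auto simp: Units_def)
      have "y \<otimes> u' \<in> I" by (rule ideal.I_r_closed[OF I y(1) u'(1)])
      moreover have "y \<otimes> u' = a [^] n" using u u' aR by (simp add: m_assoc Units_closed)
      ultimately show ?thesis using u by (intro exI[of _ n] exI[of _ u]) (simp add: Units_closed)
    qed
    have "\<exists>y\<in>I. y \<noteq> \<zero>" using False additive_subgroup.zero_closed[OF ideal.axioms(1)[OF I]] by auto
    then have ex: "\<exists>n::nat. a [^] n \<in> I" using power_mem by blast
    define n where "n = (LEAST n::nat. a [^] n \<in> I)"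
    have n: "a [^] n \<in> I" unfolding n_def using ex by (rule LeastI_ex)
    have least: "n \<le> k" if "a [^] k \<in> I" for k unfolding n_def using that by (rule Least_le)
    have "I = PIdl (a [^] n)"
    proof
      show "PIdl (a [^] n) \<subseteq> I" by (rule cgenideal_minimal[OF I n])
      show "I \<subseteq> PIdl (a [^] n)"
      proof
        fix y assume y: "y \<in> I"
        show "y \<in> PIdl (a [^] n)"
        proof (cases "y = \<zero>")
          case True
          then show ?thesis using additive_subgroup.zero_closed[OF ideal.axioms(1)[OF cgenideal_ideal]] aR by simp
        next
          case False
          then obtain k u where k: "u \<in> carrier R" "y = a [^] (k::nat) \<otimes> u" "a [^] k \<in> I" using power_mem[OF y] by blast
          have "a [^] k = a [^] n \<otimes> a [^] (k - n)" using least[OF k(3)] aR by (simp add: nat_pow_mult)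
          then have "y = (a [^] (k - n) \<otimes> u) \<otimes> a [^] n" using k(1,2) aR by (simp add: m_ac)
          then show ?thesis using k(1) aR unfolding cgenideal_def by blast
        qed
      qed
    qed
    then show ?thesis using aR by blast
  qed
  ultimately have "principal_domain R" by (intro principal_domain.intro principal_domain_axioms.intro)
  moreover have "local_ring R" by unfold_locales
  moreover have "\<not> field R"
  proof
    assume "field R"
    then have "Units R = carrier R - {\<zero>}" by (rule field.field_Units)
    moreover have "a \<noteq> \<zero>" using nzd[of \<one>] one by auto
    ultimately have "a \<in> Units R" using aR by auto
    with not_unit_if_max_ideal[OF a] show False by simp
  qed
  ultimately show ?thesis by (intro discrete_valuation_ring.intro discrete_valuation_ring_axioms.intro)
qed

text \<open>Over a basis, a unit coefficient of \<open>x\<close> turns \<open>r x = a \<tau>(r)\<close> into \<open>r \<in> a R\<close>, and \<open>z x = \<tau>(z a)\<close> shows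
  that \<open>a\<close> is a nonzerodivisor.\<close>

lemma (in burch_data) discrete_valuation_ring_if_no_relations:
  assumes zero: "\<And>c b. c \<in> relations R M B (\<lambda>b. b) \<Longrightarrow> b \<in> B \<Longrightarrow> c b = \<zero>"
  shows "discrete_valuation_ring R"
proof (rule discrete_valuation_ring_if_principal_max_ideal[OF a])
  have BM': "(\<lambda>b. b) \<in> B \<rightarrow> carrier M" using BM by auto
  obtain \<xi> where \<xi>: "\<xi> \<in> B \<rightarrow> carrier R" "x = (\<Oplus>\<^bsub>M\<^esub>b\<in>B. \<xi> b \<cdot> b)"
    using B xM unfolding generates_def by blast
  obtain k where k: "k \<in> B" "\<xi> k \<in> Units R" by (rule ex_unit_coefficient[OF \<xi>])
  then obtain u where u: "u \<in> carrier R" "\<xi> k \<otimes> u = \<one>" by (auto simp: Units_def)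
  have \<xi>k: "\<xi> k \<in> carrier R" using \<xi> k by auto
  { fix r assume r: "r \<in> max_ideal R"
    have rR: "r \<in> carrier R" using r by simp
    obtain \<eta> where \<eta>: "\<eta> \<in> B \<rightarrow> carrier R" "\<tau> r = (\<Oplus>\<^bsub>M\<^esub>b\<in>B. \<eta> b \<cdot> b)"
      using B tau_closed[OF r] unfolding generates_def by blast
    have \<eta>k: "\<eta> k \<in> carrier R" using \<eta> k by auto
    have rx: "r \<cdot> x = a \<cdot> \<tau> r" using tau_smult[OF rR a] tau_smult[OF aR r] R.m_comm[OF rR aR] by simp
    have "(\<Oplus>\<^bsub>M\<^esub>b\<in>B. (r \<otimes> \<xi> b \<ominus> a \<otimes> \<eta> b) \<cdot> b)
      = (\<Oplus>\<^bsub>M\<^esub>b\<in>B. (r \<otimes> \<xi> b) \<cdot> b) \<ominus>\<^bsub>M\<^esub> (\<Oplus>\<^bsub>M\<^esub>b\<in>B. (a \<otimes> \<eta> b) \<cdot> b)"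
      by (rule comb_diff[OF B_fin _ _ BM']) (use rR aR \<xi> \<eta> in auto)
    also have "(\<Oplus>\<^bsub>M\<^esub>b\<in>B. (r \<otimes> \<xi> b) \<cdot> b) = r \<cdot> x"
      unfolding \<xi>(2) by (rule comb_smult[OF B_fin rR \<xi>(1) BM'])
    also have "(\<Oplus>\<^bsub>M\<^esub>b\<in>B. (a \<otimes> \<eta> b) \<cdot> b) = r \<cdot> x"
      unfolding rx \<eta>(2) by (rule comb_smult[OF B_fin aR \<eta>(1) BM'])
    also have "r \<cdot> x \<ominus>\<^bsub>M\<^esub> r \<cdot> x = \<zero>\<^bsub>M\<^esub>" using rR xM by (simp add: M.minus_eq M.r_neg)
    finally have "(\<lambda>b. r \<otimes> \<xi> b \<ominus> a \<otimes> \<eta> b) \<in> relations R M B (\<lambda>b. b)"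
      using \<xi> \<eta> rR aR by (auto simp: relations_def)
    from zero[OF this k(1)] have eq: "r \<otimes> \<xi> k = a \<otimes> \<eta> k" using rR aR \<xi>k \<eta>k by simp
    have "r = r \<otimes> \<xi> k \<otimes> u" using rR \<xi>k u by (simp add: R.m_assoc)
    also have "\<dots> = a \<otimes> (\<eta> k \<otimes> u)" unfolding eq using aR \<eta>k u by (simp add: R.m_assoc)
    finally show "\<exists>s\<in>carrier R. r = a \<otimes> s" using \<eta>k u by blast }
  fix z assume z: "z \<in> carrier R" "a \<otimes> z = \<zero>"
  have "\<tau> \<zero> = \<zero>\<^bsub>M\<^esub>" using tau_smult[OF R.zero_closed a] aR xM by simp
  then have "z \<cdot> x = \<zero>\<^bsub>M\<^esub>" using tau_smult[OF z(1) a] z R.m_comm[OF z(1) aR] by simp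
  moreover have "(\<Oplus>\<^bsub>M\<^esub>b\<in>B. (z \<otimes> \<xi> b) \<cdot> b) = z \<cdot> x"
    unfolding \<xi>(2) by (rule comb_smult[OF B_fin z(1) \<xi>(1) BM'])
  ultimately have "(\<lambda>b. z \<otimes> \<xi> b) \<in> relations R M B (\<lambda>b. b)" using \<xi> z by (auto simp: relations_def)
  from zero[OF this k(1)] have "z \<otimes> \<xi> k = \<zero>" .
  then have "z \<otimes> \<xi> k \<otimes> u = \<zero>" using u by simp
  then show "z = \<zero>" using z \<xi>k u by (simp add: R.m_assoc)
qed

section \<open>Burch modules and the theorem\<close>

lemma (in module) submodule_span_submodule:
  assumes "X \<subseteq> carrier M"
  shows "submodule (submodule_span R M X) R M"
proof (rule submodule_if_closed)
  show "submodule_span R M X \<subseteq> carrier M"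
    using carrier_is_submodule assms by (auto simp: submodule_span_def)
  show "\<zero>\<^bsub>M\<^esub> \<in> submodule_span R M X" using submodule_zero by (auto simp: submodule_span_def)
  fix y z assume "y \<in> submodule_span R M X" "z \<in> submodule_span R M X"
  then show "y \<oplus>\<^bsub>M\<^esub> z \<in> submodule_span R M X" using submoduleE(5) by (auto simp: submodule_span_def)
next
  fix r y assume "r \<in> carrier R" "y \<in> submodule_span R M X"
  then show "r \<cdot> y \<in> submodule_span R M X" using submoduleE(4) by (auto simp: submodule_span_def)
qed

text \<open>If all products \<open>a t\<close> with \<open>a \<in> \<mm>\<close> and \<open>\<mm> t \<subseteq> M\<close> were in \<open>\<mm> M\<close>, so would be the submodule that they generate. So
  some product is outside, and multiplication by its factor \<open>t\<close> is \<open>\<tau>\<close>.\<close>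

lemma (in noetherian_local_module) burch_data_if_burch:
  assumes "burch TYPE('e) R M" "rigid R M" "generates R M B"
    and "\<And>c b. c \<in> relations R M B (\<lambda>b. b) \<Longrightarrow> b \<in> B \<Longrightarrow> c b \<in> max_ideal R"
  shows "\<exists>\<tau> a N. burch_data R M \<tau> a B N"
proof -
  let ?m = "max_ideal R"
  from assms(1) obtain T :: "('a, 'e) module" and \<iota> where T: "module R T" and \<iota>: "\<iota> \<in> mod_hom R M T"
    and inj: "inj_on \<iota> (carrier M)"
    and nsub: "\<not> ideal_smult R T ?m (colon T (\<iota> ` carrier M) ?m) \<subseteq> ideal_smult R T ?m (\<iota> ` carrier M)"
    unfolding burch_def by blast
  interpret T: module R T by fact
  note D = mod_homD[OF \<iota>]
  let ?G = "{r \<odot>\<^bsub>T\<^esub> y | r y. r \<in> ?m \<and> y \<in> \<iota> ` carrier M}"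
  have G: "?G \<subseteq> carrier T" using D(1) by auto
  have span: "submodule (ideal_smult R T ?m (\<iota> ` carrier M)) R T"
    unfolding ideal_smult_def by (rule T.submodule_span_submodule[OF G])
  have gen: "r \<odot>\<^bsub>T\<^esub> \<iota> y \<in> ideal_smult R T ?m (\<iota> ` carrier M)" if "r \<in> ?m" "y \<in> carrier M" for r y
    using that unfolding ideal_smult_def submodule_span_def by blast
  have "\<exists>a\<in>?m. \<exists>t\<in>colon T (\<iota> ` carrier M) ?m. a \<odot>\<^bsub>T\<^esub> t \<notin> ideal_smult R T ?m (\<iota> ` carrier M)"
  proof (rule ccontr)
    assume "\<not> ?thesis"
    then have sub: "{r \<odot>\<^bsub>T\<^esub> y | r y. r \<in> ?m \<and> y \<in> colon T (\<iota> ` carrier M) ?m} \<subseteq> ideal_smult R T ?m (\<iota> ` carrier M)"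
      by blast
    have "ideal_smult R T ?m (colon T (\<iota> ` carrier M) ?m) \<subseteq> ideal_smult R T ?m (\<iota> ` carrier M)"
      unfolding ideal_smult_def[of R T ?m "colon T (\<iota> ` carrier M) ?m"] submodule_span_def
      using span sub by blast
    with nsub show False by simp
  qed
  then obtain a t where a: "a \<in> ?m" and t: "t \<in> colon T (\<iota> ` carrier M) ?m"
    and at: "a \<odot>\<^bsub>T\<^esub> t \<notin> ideal_smult R T ?m (\<iota> ` carrier M)" by blast
  have tT: "t \<in> carrier T" and tm: "\<And>r. r \<in> ?m \<Longrightarrow> r \<odot>\<^bsub>T\<^esub> t \<in> \<iota> ` carrier M" using t by (auto simp: colon_def)
  define \<tau> where "\<tau> r = inv_into (carrier M) \<iota> (r \<odot>\<^bsub>T\<^esub> t)" for r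
  have \<tau>M: "\<tau> r \<in> carrier M" and \<iota>\<tau>: "\<iota> (\<tau> r) = r \<odot>\<^bsub>T\<^esub> t" if "r \<in> ?m" for r
    unfolding \<tau>_def using inv_into_into[OF tm[OF that]] f_inv_into_f[OF tm[OF that]] by auto
  have \<iota>_eq: "y = z" if "y \<in> carrier M" "z \<in> carrier M" "\<iota> y = \<iota> z" for y z
    using inj that by (auto simp: inj_on_def)
  define N where "N = {y \<in> carrier M. \<iota> y \<in> ideal_smult R T ?m (\<iota> ` carrier M)}"
  have "burch_data R M \<tau> a B N"
  proof (rule burch_data.intro[OF noetherian_local_module_axioms burch_data_axioms.intro])
    show "submodule N R M"
    proof (rule submodule_if_closed)
      have "module R M" by unfold_locales
      then show "\<zero>\<^bsub>M\<^esub> \<in> N" using T.submodule_zero[OF span] mod_hom_zero[OF _ T \<iota>] by (simp add: N_def)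
    qed (use D T.submoduleE(4,5)[OF span] in \<open>auto simp: N_def\<close>)
    show "\<tau> r \<in> carrier M" if "r \<in> ?m" for r using \<tau>M[OF that] .
    show "\<tau> (r \<oplus> s) = \<tau> r \<oplus>\<^bsub>M\<^esub> \<tau> s" if "r \<in> ?m" "s \<in> ?m" for r s
    proof (rule \<iota>_eq)
      show "\<iota> (\<tau> (r \<oplus> s)) = \<iota> (\<tau> r \<oplus>\<^bsub>M\<^esub> \<tau> s)"
        using \<iota>\<tau>[OF max_ideal_add[OF that]] \<iota>\<tau>[OF that(1)] \<iota>\<tau>[OF that(2)] \<tau>M[OF that(1)] \<tau>M[OF that(2)] D(2) that tT
        by (simp add: T.smult_l_distr)
    qed (use \<tau>M max_ideal_add that in auto)
    show "\<tau> (q \<otimes> s) = q \<cdot> \<tau> s" if "q \<in> carrier R" "s \<in> ?m" for q s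
    proof (rule \<iota>_eq)
      show "\<iota> (\<tau> (q \<otimes> s)) = \<iota> (q \<cdot> \<tau> s)"
        using \<iota>\<tau>[OF max_ideal_mult[OF that]] \<iota>\<tau>[OF that(2)] \<tau>M[OF that(2)] D(3) that tT
        by (simp add: T.smult_assoc1)
    qed (use \<tau>M max_ideal_mult that in auto)
    show "r \<cdot> y \<in> N" if "r \<in> ?m" "y \<in> carrier M" for r y
      using gen[OF that] D(3) that by (simp add: N_def)
    show "\<tau> a \<notin> N" using \<iota>\<tau>[OF a] at by (simp add: N_def)
  qed (use assms(2-4) a in auto)
  then show ?thesis by blast
qed

theorem theorem1p2:
  fixes R :: "('a, 'k) ring_scheme" and M :: "('a, 'b, 'm) module_scheme"
  assumes "noetherian_ring R" and "local_ring R"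
    and "module R M" and "finitely_generated R M"
    and "torsion_free R M" and "has_rank R M"
    and "burch TYPE('c) R M" and "rigid R M"
  shows "is_free R M \<and> (field R \<or> discrete_valuation_ring R)"
proof -
  interpret noetherian_ring R by fact
  interpret local_ring R by fact
  interpret noetherian_local_ring R by unfold_locales
  interpret module R M by fact
  interpret noetherian_local_module R M by unfold_locales
  obtain B where B: "generates R M B"
    "\<And>c b. c \<in> relations R M B (\<lambda>b. b) \<Longrightarrow> b \<in> B \<Longrightarrow> c b \<in> max_ideal R"
    by (rule ex_minimal_generators[OF assms(4)]) blast
  have "\<exists>\<tau> a N. burch_data R M \<tau> a B N"
    by (rule burch_data_if_burch[OF assms(7,8) B(1)]) (rule B(2))
  then obtain \<tau> a N where "burch_data R M \<tau> a B N" by (elim exE)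
  then interpret burch_data R M \<tau> a B N .
  note zero = relations_zero[OF assms(5,6)]
  show ?thesis
    using is_free_if_no_relations[OF B(1)] discrete_valuation_ring_if_no_relations zero by blast
qed

end
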